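(* Let $d\ge 1$ and let $\mathsf X_1=(X_1,\alpha_1)$ and $\mathsf X_2=(X_2,\alpha_2)$ be connected mixing Noetherian algebraic $\mathbb{Z}^d$-actions. Then the following properties are equivalent. (1) Every equivariant continuous map $\mathsf X_1\to\mathsf X_2$ is an affine map. (2) The system $\mathsf X_2$ has finite topological entropy.
   Context: All compact groups are assumed metrizable; groups are written multiplicatively and $e$ denotes the identity element. An algebraic $\mathbb{Z}^d$-action $\mathsf X=(X,\alpha)$ is a compact abelian group $X$ together with a homomorphism $\alpha:\mathbf n\mapsto\alpha(\mathbf n)$ from $\mathbb{Z}^d$ to the group $\mathrm{Aut}(X)$ of continuous automorphisms of $X$. It is called connected if $X$ is connected. It is called mixing if $\lim_{\mathbf n\to\infty}\lambda_X(A_1\cap\alpha(\mathbf n)(A_2))=\lambda_X(A_1)\lambda_X(A_2)$ for all measurable $A_1,A_2\subset X$, where $\lambda_X$ is the (normalized) Haar measure on $X$. Let $R_d=\mathbb{Z}[u_1^{\pm1},\dots,u_d^{\pm1}]$, with elements written $f=\sum_{\mathbf n\in\mathbb{Z}^d}f_{\mathbf n}\mathbf u^{\mathbf n}$, where $\mathbf u^{\mathbf n}=u_1^{n_1}\cdots u_d^{n_d}$ and $f_{\mathbf n}\in\mathbb{Z}$ vanishes for all but finitely many $\mathbf n$. The dual module of $\mathsf X$ is the countable Pontryagin dual group $\widehat X$, regarded as an $R_d$-module via $f\cdot a=\sum_{\mathbf n}f_{\mathbf n}\,\widehat{\alpha}(\mathbf n)(a)$ (additive notation in $\widehat X$), where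 $\widehat\alpha(\mathbf n)$ is the automorphism of $\widehat X$ dual to $\alpha(\mathbf n)$, i.e. $\widehat\alpha(\mathbf n)(a)=a\circ\alpha(\mathbf n)$. The system $\mathsf X$ is Noetherian if its dual module is a Noetherian $R_d$-module (equivalently, finitely generated over $R_d$). A map $\phi:\mathsf X_1\to\mathsf X_2$ means a map $\phi:X_1\to X_2$; it is equivariant if $\phi\circ\alpha_1(\mathbf n)=\alpha_2(\mathbf n)\circ\phi$ for all $\mathbf n\in\mathbb{Z}^d$, and affine if there are a continuous group homomorphism $\psi:X_1\to X_2$ and an element $y\in X_2$ with $\phi(x)=\psi(x)\cdot y$ for all $x\in X_1$. Topological entropy is the usual topological entropy of a $\mathbb{Z}^d$-action by homeomorphisms of a compact space: the supremum over finite open covers $\mathcal U$ of $\lim_{k\to\infty}k^{-d}\log N\bigl(\bigvee_{\mathbf n\in\{0,\dots,k-1\}^d}\alpha(-\mathbf n)(\mathcal U)\bigr)$, where $N$ denotes the minimal cardinality of a subcover.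
   Formalization: The group X_1 is additionally assumed to be nontrivial; for X_1 = {e} every map is constant, hence affine, so (1) holds even when X_2 (e.g. the full shift on T^(Z^d)) has infinite entropy. *)

theory Defs
  imports "HOL-Probability.Probability" "HOL-Library.Poly_Mapping"
begin

text \<open>
  Groups are written additively, following the type class
  \<open>topological_ab_group_add\<close>. A compact metrizable abelian group is a type of
  class \<open>{topological_ab_group_add, metric_space}\<close> whose universe is compact; only the topology
  induced by the metric is ever used. The group \<open>\<int>\<^sup>d\<close> is \<open>int ^ 'd\<close> with
  \<open>d = CARD('d) \<ge> 1\<close>.
\<close>

section \<open>Algebraic actions\<close>

definition continuous_automorphism :: "('a::topological_ab_group_add \<Rightarrow> 'a) \<Rightarrow> bool" where
  "continuous_automorphism f \<longleftrightarrow> Modules.additive f \<and> (\<exists>g. homeomorphism UNIV UNIV f g)"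

definition algebraic_action ::
    "(int ^ 'd \<Rightarrow> 'a::{topological_ab_group_add, metric_space} \<Rightarrow> 'a) \<Rightarrow> bool" where
  "algebraic_action \<alpha> \<longleftrightarrow>
     compact (UNIV :: 'a set) \<and>
     (\<forall>n. continuous_automorphism (\<alpha> n)) \<and>
     (\<forall>m n. \<alpha> (m + n) = \<alpha> m \<circ> \<alpha> n)"

definition haar_measure :: "'a::topological_ab_group_add measure" where
  "haar_measure = (THE M. sets M = sets borel \<and> prob_space M \<and>
                          (\<forall>a. distr M M (\<lambda>x. a + x) = M))"

text \<open>In the discrete group \<open>\<int>\<^sup>d\<close>, convergence to infinity is convergence along the
  cofinite filter.\<close>

definition mixing :: "(int ^ 'd \<Rightarrow> 'a::topological_ab_group_add \<Rightarrow> 'a) \<Rightarrow> bool" where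
  "mixing \<alpha> \<longleftrightarrow>
     (\<forall>A\<in>sets borel. \<forall>B\<in>sets borel.
        ((\<lambda>n. measure haar_measure (A \<inter> \<alpha> n ` B))
           \<longlongrightarrow> measure haar_measure A * measure haar_measure B) cofinite)"

section \<open>The dual module\<close>

type_synonym 'd laurent = "(int ^ 'd) \<Rightarrow>\<^sub>0 int"

typedef (overloaded) ('a::topological_ab_group_add) character =
  "{\<xi> :: 'a \<Rightarrow> complex. continuous_on UNIV \<xi> \<and> (\<forall>x. norm (\<xi> x) = 1) \<and>
                         (\<forall>x y. \<xi> (x + y) = \<xi> x * \<xi> y)}"
  morphisms eval_character Character
  by (rule exI[of _ "\<lambda>_. 1"]) auto

setup_lifting type_definition_character

text \<open>The dual group is written additively: addition of characters is pointwise
  multiplication of their values in the unit circle.\<close>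

instantiation character :: (topological_ab_group_add) ab_group_add
begin

lift_definition zero_character :: "'a character" is "\<lambda>_. 1" by auto

lift_definition plus_character :: "'a character \<Rightarrow> 'a character \<Rightarrow> 'a character"
  is "\<lambda>\<xi> \<eta> x. \<xi> x * \<eta> x"
  by (auto intro!: continuous_intros simp: norm_mult)

lift_definition uminus_character :: "'a character \<Rightarrow> 'a character" is "\<lambda>\<xi> x. inverse (\<xi> x)"
  by (auto intro!: continuous_intros simp: norm_inverse) (metis norm_zero zero_neq_one)

definition minus_character :: "'a character \<Rightarrow> 'a character \<Rightarrow> 'a character" where
  "minus_character a b = a + (- b)"

instance
proof
  fix a b c :: "'a character"
  show "a + b + c = a + (b + c)" by transfer (auto simp: mult.assoc)
  show "a + b = b + a" by transfer (auto simp: mult.commute)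
  show "0 + a = a" by transfer auto
  show "- a + a = 0"
    by transfer (auto simp: fun_eq_iff, metis left_inverse norm_zero zero_neq_one)
  show "a - b = a + - b" by (fact minus_character_def)
qed

end

lift_definition int_scale :: "int \<Rightarrow> 'a::topological_ab_group_add character \<Rightarrow> 'a character"
  is "\<lambda>k \<xi> x. \<xi> x powi k"
  by (auto intro!: continuous_intros simp: norm_power_int power_int_mult_distrib)
     (metis norm_zero zero_neq_one)

text \<open>Meaningful only if \<open>g\<close> is a continuous endomorphism.\<close>

definition dual_map ::
    "('a \<Rightarrow> 'a) \<Rightarrow> 'a::topological_ab_group_add character \<Rightarrow> 'a character" where
  "dual_map g a = Character (eval_character a \<circ> g)"

definition dual_scale ::
    "(int ^ 'd \<Rightarrow> 'a \<Rightarrow> 'a) \<Rightarrow> 'd laurent \<Rightarrow> 'a::topological_ab_group_add character \<Rightarrow> 'a character"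
  where
  "dual_scale \<alpha> f a =
     (\<Sum>n\<in>Poly_Mapping.keys f. int_scale (Poly_Mapping.lookup f n) (dual_map (\<alpha> n) a))"

definition noetherian_module :: "('r::comm_ring_1 \<Rightarrow> 'm::ab_group_add \<Rightarrow> 'm) \<Rightarrow> bool" where
  "noetherian_module s \<longleftrightarrow>
     (\<forall>N. module.subspace s N \<longrightarrow> (\<exists>S. finite S \<and> module.span s S = N))"

definition noetherian_action ::
    "(int ^ 'd \<Rightarrow> 'a::topological_ab_group_add \<Rightarrow> 'a) \<Rightarrow> bool" where
  "noetherian_action \<alpha> \<longleftrightarrow> noetherian_module (dual_scale \<alpha>)"

lemma eval_character_0 [simp]: "eval_character 0 x = 1"
  by transfer simp

lemma eval_character_add: "eval_character (a + b) x = eval_character a x * eval_character b x"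
  by transfer simp

lemma eval_character_nonzero [simp]: "eval_character a x \<noteq> 0"
  by transfer (auto, metis norm_zero zero_neq_one)

lemma eval_character_int_scale: "eval_character (int_scale k a) x = eval_character a x powi k"
  by transfer simp

lemma eval_dual_map:
  assumes "continuous_automorphism g"
  shows "eval_character (dual_map g a) x = eval_character a (g x)"
proof -
  have g: "continuous_on UNIV g" "\<And>x y. g (x + y) = g x + g y"
    using assms by (auto simp: continuous_automorphism_def homeomorphism_def Modules.additive_def)
  have "continuous_on UNIV (eval_character a \<circ> g)"
    using eval_character[of a] g(1)
    by (intro continuous_on_compose) (auto intro: continuous_on_subset)
  then have "eval_character a \<circ> g \<in> {\<xi>. continuous_on UNIV \<xi> \<and> (\<forall>x. norm (\<xi> x) = 1) \<and>
      (\<forall>x y. \<xi> (x + y) = \<xi> x * \<xi> y)}"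
    using eval_character[of a] g by auto
  then show ?thesis
    unfolding dual_map_def by (subst Character_inverse) auto
qed

lemma eval_character_sum:
  "eval_character (\<Sum>i\<in>I. c i) x = (\<Prod>i\<in>I. eval_character (c i) x)"
  by (induction I rule: infinite_finite_induct) (auto simp: eval_character_add)

lemma character_eqI: "(\<And>x. eval_character a x = eval_character b x) \<Longrightarrow> a = b"
  by transfer auto

lemma eval_dual_scale_superset:
  assumes "algebraic_action \<alpha>" "finite K" "Poly_Mapping.keys f \<subseteq> K"
  shows "eval_character (dual_scale \<alpha> f a) x =
         (\<Prod>n\<in>K. eval_character a (\<alpha> n x) powi Poly_Mapping.lookup f n)"
proof -
  have "eval_character (dual_scale \<alpha> f a) x =
      (\<Prod>n\<in>Poly_Mapping.keys f. eval_character a (\<alpha> n x) powi Poly_Mapping.lookup f n)"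
    using assms(1)
    by (simp add: dual_scale_def eval_character_sum eval_character_int_scale
                  eval_dual_map algebraic_action_def)
  also have "\<dots> = (\<Prod>n\<in>K. eval_character a (\<alpha> n x) powi Poly_Mapping.lookup f n)"
    by (rule prod.mono_neutral_left) (use assms in \<open>auto simp: in_keys_iff\<close>)
  finally show ?thesis .
qed

lemma dual_scale_add_left:
  assumes "algebraic_action \<alpha>"
  shows "dual_scale \<alpha> (f + g) a = dual_scale \<alpha> f a + dual_scale \<alpha> g a"
proof (rule character_eqI)
  fix x
  let ?K = "Poly_Mapping.keys f \<union> Poly_Mapping.keys g"
  show "eval_character (dual_scale \<alpha> (f + g) a) x =
        eval_character (dual_scale \<alpha> f a + dual_scale \<alpha> g a) x"
    by (simp add: eval_dual_scale_superset[OF assms, of ?K] keys_add eval_character_add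
                  lookup_add power_int_add prod.distrib)
qed

lemma dual_scale_add_right:
  assumes "algebraic_action \<alpha>"
  shows "dual_scale \<alpha> f (a + b) = dual_scale \<alpha> f a + dual_scale \<alpha> f b"
  by (rule character_eqI)
     (simp add: eval_dual_scale_superset[OF assms finite_keys order_refl] eval_character_add
                power_int_mult_distrib prod.distrib)

lemma dual_scale_single:
  assumes "algebraic_action \<alpha>"
  shows "eval_character (dual_scale \<alpha> (Poly_Mapping.single n k) a) x =
         eval_character a (\<alpha> n x) powi k"
  by (subst eval_dual_scale_superset[OF assms, of "{n}"]) auto

lemma algebraic_action_0:
  assumes "algebraic_action \<alpha>"
  shows "\<alpha> 0 x = x"
proof -
  have "\<alpha> 0 (\<alpha> 0 x) = \<alpha> 0 x"
    using assms unfolding algebraic_action_def by (metis add_0 comp_apply)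
  moreover have "inj (\<alpha> 0)"
    using assms unfolding algebraic_action_def continuous_automorphism_def homeomorphism_def
    by (metis UNIV_I injI)
  ultimately show ?thesis by (auto dest: injD)
qed

lemma dual_module:
  fixes \<alpha> :: "int ^ 'd \<Rightarrow> 'a::{topological_ab_group_add, metric_space} \<Rightarrow> 'a"
  assumes "algebraic_action \<alpha>"
  shows "module (dual_scale \<alpha>)"
proof
  note add_left = dual_scale_add_left[OF assms] and add_right = dual_scale_add_right[OF assms]
  fix f g :: "'d laurent" and a b :: "'a character"
  show "dual_scale \<alpha> f (a + b) = dual_scale \<alpha> f a + dual_scale \<alpha> f b" by (fact add_right)
  show "dual_scale \<alpha> (f + g) a = dual_scale \<alpha> f a + dual_scale \<alpha> g a" by (fact add_left)
  show "dual_scale \<alpha> 1 a = a"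
    by (rule character_eqI)
       (simp add: dual_scale_single[OF assms] algebraic_action_0[OF assms] flip: single_one)
  have diff_left: "dual_scale \<alpha> (p - q) c = dual_scale \<alpha> p c - dual_scale \<alpha> q c" for p q c
    using add_left[of "p - q" q c] by (simp add: algebra_simps)
  have zero_left: "dual_scale \<alpha> 0 c = 0" for c
    by (simp add: dual_scale_def)
  have diff_right: "dual_scale \<alpha> p (c - e) = dual_scale \<alpha> p c - dual_scale \<alpha> p e" for p c e
    using add_right[of p "c - e" e] by (simp add: algebra_simps)
  have zero_right: "dual_scale \<alpha> p 0 = 0" for p
    using add_right[of p 0 0] by simp
  have act: "\<alpha> (m + n) x = \<alpha> m (\<alpha> n x)" for m n x
    using assms by (simp add: algebraic_action_def)
  have *: "dual_scale \<alpha> (frag_of m) (dual_scale \<alpha> (frag_of n) a) = dual_scale \<alpha> (frag_of m * frag_of n) a"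
    for m n
    by (rule character_eqI)
       (simp add: dual_scale_single[OF assms] mult_single act[symmetric] add.commute)
  have **: "dual_scale \<alpha> (frag_of m) (dual_scale \<alpha> g a) = dual_scale \<alpha> (frag_of m * g) a" for m
    using subset_UNIV
    by (induction g rule: frag_induction)
       (simp_all only: * zero_left zero_right diff_left diff_right mult_zero_right right_diff_distrib)
  show "dual_scale \<alpha> f (dual_scale \<alpha> g a) = dual_scale \<alpha> (f * g) a"
    using subset_UNIV
    by (induction f rule: frag_induction)
       (simp_all only: ** zero_left diff_left mult_zero_left left_diff_distrib)
qed

section \<open>Maps between actions\<close>

definition equivariant :: "(int ^ 'd \<Rightarrow> 'a \<Rightarrow> 'a) \<Rightarrow> (int ^ 'd \<Rightarrow> 'b \<Rightarrow> 'b) \<Rightarrow> ('a \<Rightarrow> 'b) \<Rightarrow> bool" where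
  "equivariant \<alpha> \<beta> \<phi> \<longleftrightarrow> (\<forall>n. \<phi> \<circ> \<alpha> n = \<beta> n \<circ> \<phi>)"

definition affine_map ::
    "('a::topological_ab_group_add \<Rightarrow> 'b::topological_ab_group_add) \<Rightarrow> bool" where
  "affine_map \<phi> \<longleftrightarrow>
     (\<exists>\<psi> y. continuous_on UNIV \<psi> \<and> Modules.additive \<psi> \<and> (\<forall>x. \<phi> x = \<psi> x + y))"

section \<open>Topological entropy\<close>

definition box_index :: "nat \<Rightarrow> (int ^ 'd) set" where
  "box_index k = {n. \<forall>i. 0 \<le> n $ i \<and> n $ i < int k}"

definition finite_open_cover :: "'a::topological_space set set \<Rightarrow> bool" where
  "finite_open_cover U \<longleftrightarrow> finite U \<and> (\<forall>u\<in>U. open u) \<and> \<Union>U = UNIV"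

definition min_subcover_card :: "'a set set \<Rightarrow> nat" where
  "min_subcover_card W = (LEAST k. \<exists>V\<subseteq>W. finite V \<and> \<Union>V = UNIV \<and> card V = k)"

text \<open>The members of the join \<open>\<Or>\<^sub>n \<alpha>(-n)(U)\<close> are the intersections of one member of each
  cover \<open>\<alpha>(-n)(U)\<close>.\<close>

definition join_cover ::
    "(int ^ 'd \<Rightarrow> 'a \<Rightarrow> 'a) \<Rightarrow> nat \<Rightarrow> 'a set set \<Rightarrow> 'a set set" where
  "join_cover \<alpha> k U = {(\<Inter>n\<in>box_index k. \<alpha> (- n) ` c n) | c. \<forall>n\<in>box_index k. c n \<in> U}"

definition cover_entropy ::
    "(int ^ 'd \<Rightarrow> 'a \<Rightarrow> 'a) \<Rightarrow> 'a set set \<Rightarrow> real" where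
  "cover_entropy \<alpha> U =
     lim (\<lambda>k. ln (real (min_subcover_card (join_cover \<alpha> k U))) / real k ^ CARD('d))"

definition topological_entropy ::
    "(int ^ 'd \<Rightarrow> 'a::topological_space \<Rightarrow> 'a) \<Rightarrow> ereal" where
  "topological_entropy \<alpha> = (SUP U\<in>{U. finite_open_cover U}. ereal (cover_entropy \<alpha> U))"

end

theory Submission
  imports Defs
begin

text \<open>
  A continuous map from a compact connected abelian group to the circle is a constant times a character
  times \<open>exp (\<i> F)\<close> with \<open>F\<close> real and of mean zero, and this decomposition is unique. Composing an
  equivariant map with the characters \<open>a\<close> of the target therefore yields functions \<open>F\<^sub>a\<close> that depend
  linearly on \<open>a\<close> over the Laurent ring, and the map is affine iff all of them vanish. If \<open>f\<close> annihilates \<open>a\<close>,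
  the Fourier coefficients of \<open>F\<^sub>a\<close> along an orbit of characters, which is free by mixing, form a square
  summable solution of the difference equation given by \<open>f\<close>; a rank count on large boxes shows that such a
  solution is zero. So a torsion dual module forces rigidity. Conversely, if some \<open>a\<close> is free, a nonzero module
  homomorphism \<open>T\<close> from the dual module to the Laurent ring and any nonconstant \<open>F\<close> yield, by duality, an
  equivariant map whose composition with \<open>b\<close> is \<open>exp (\<i> T b \<cdot> F)\<close>, and it is not affine.

  Torsion of the dual module is equivalent to finite entropy: the orbit of a free character realises all
  patterns, while the lifts of an orbit of a torsion character satisfy an integral difference equation, so they
  are determined by bounded integers in a box and by data on its boundary.

  Haar measure comes from the uniform approximation of constants by averages of translates, and the characters
  from the power method for a convolution operator: its normalised powers converge to an idempotent, and
  a minimal idempotent below it is a multiple of a character.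
\<close>

section \<open>Invariant means\<close>

text \<open>A connected compact group such as a solenoid need not be path connected, so a continuous
  logarithm cannot be carried along paths. Instead the quotients of a circle valued map by its own
  translates are lifted: for small translations the principal logarithm works, and connectedness
  spreads this to all translations. The difference equation for \<open>f\<close> cannot be treated
  by dividing by \<open>f\<close>, which may vanish on the torus, and it can have bounded nonzero
  solutions (constants, for a difference of two monomials). Square summability therefore has to
  enter; in the rank count it is a bound, uniform over the boxes, on the norms of the translates of
  the solution. The same vanishing result shows that the Laurent ring is a domain and that a nonzero
  Laurent polynomial applied to a nonconstant function is not constant. One density result for
  simultaneous values of characters likewise serves twice: it realises the patterns in the orbit of
  a free character, and it makes evaluation surjective onto the bidual.\<close>

inductive averaging :: "(('a::ab_group_add \<Rightarrow> real) \<Rightarrow> 'a \<Rightarrow> real) \<Rightarrow> bool" where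
  averaging_id: "averaging (\<lambda>f. f)"
| averaging_step: "averaging T \<Longrightarrow> finite A \<Longrightarrow> A \<noteq> {} \<Longrightarrow>
    averaging (\<lambda>f x. (\<Sum>a\<in>A. T f (x + a)) / card A)"

lemma averaging_linear:
  assumes "averaging T"
  shows "T (\<lambda>x. c * f x + g x) x = c * T f x + T g x"
  using assms
proof (induction arbitrary: x)
  case (averaging_step T A)
  then show ?case
    by (simp add: sum.distrib sum_distrib_left add_divide_distrib)
qed simp

lemma averaging_mono:
  assumes "averaging T" "\<And>x. f x \<le> g x"
  shows "T f x \<le> T g x"
  using assms(1)
proof (induction arbitrary: x)
  case averaging_id
  show ?case by (rule assms(2))
next
  case (averaging_step T A)
  then show ?case by (intro divide_right_mono sum_mono) auto
qed

lemma averaging_const: "averaging T \<Longrightarrow> T (\<lambda>x. c) x = c"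
  by (induction arbitrary: x rule: averaging.induct) auto

lemma averaging_zero: "averaging T \<Longrightarrow> T (\<lambda>x. 0) x = 0"
  by (rule averaging_const)

lemma averaging_add: "averaging T \<Longrightarrow> T (\<lambda>x. f x + g x) x = T f x + T g x"
  using averaging_linear[of T 1 f g x] by simp

lemma averaging_mult: "averaging T \<Longrightarrow> T (\<lambda>x. c * f x) x = c * T f x"
  using averaging_linear[of T c f "\<lambda>x. 0" x] by (simp add: averaging_zero)

lemma averaging_sum:
  assumes "averaging T"
  shows "T (\<lambda>x. \<Sum>i\<in>I. f i x) x = (\<Sum>i\<in>I. T (f i) x)"
proof (induction I rule: infinite_finite_induct)
  case (insert i I)
  have "T (\<lambda>x. f i x + (\<Sum>i\<in>I. f i x)) x = T (f i) x + T (\<lambda>x. \<Sum>i\<in>I. f i x) x"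
    by (rule averaging_add[OF assms])
  with insert show ?case by simp
qed (simp_all add: averaging_zero[OF assms])

lemma averaging_translate:
  "averaging T \<Longrightarrow> T (\<lambda>x. f (x + a)) x = T f (x + a)"
proof (induction arbitrary: x rule: averaging.induct)
  case (averaging_step T A)
  then show ?case by (simp add: add_ac)
qed simp

lemma averaging_compose: "averaging S \<Longrightarrow> averaging T \<Longrightarrow> averaging (\<lambda>f. S (T f))"
  by (induction S rule: averaging.induct) (auto intro: averaging.intros)

text \<open>Translations of an abelian group commute. This is what makes the constant approximated
  by averages unique.\<close>

lemma averaging_commute:
  assumes "averaging S" "averaging T"
  shows "S (T f) x = T (S f) x"
  using assms(1)
proof (induction arbitrary: x)
  case (averaging_step S A)
  have "T (\<lambda>x. (\<Sum>a\<in>A. S f (x + a)) / card A) x = T (\<lambda>x. (1 / card A) * (\<Sum>a\<in>A. S f (x + a))) x"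
    by simp
  also have "\<dots> = (1 / card A) * (\<Sum>a\<in>A. T (S f) (x + a))"
    unfolding averaging_mult[OF assms(2)] averaging_sum[OF assms(2)] averaging_translate[OF assms(2)] by (rule refl)
  finally show ?case using averaging_step by simp
qed simp

lemma averaging_continuous:
  fixes f :: "'a::topological_ab_group_add \<Rightarrow> real"
  assumes "averaging T" "continuous_on UNIV f"
  shows "continuous_on UNIV (T f)"
  using assms
proof (induction)
  case (averaging_step T A)
  then have "continuous_on UNIV (\<lambda>x. T f (x + a))" for a
    by (intro continuous_on_compose2[of UNIV "T f" UNIV "\<lambda>x. x + a"] continuous_intros) auto
  then show ?case
    using averaging_step by (intro continuous_intros) auto
qed simp

text \<open>An average inherits every modulus of continuity of \<open>f\<close>, so a neighbourhood
  chosen once for \<open>f\<close> serves all \<open>T f\<close>.\<close>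

lemma averaging_modulus:
  assumes "averaging T" "\<And>x. \<bar>f (x + v) - f x\<bar> \<le> e"
  shows "\<bar>T f (x + v) - T f x\<bar> \<le> e"
proof -
  have "T (\<lambda>x. f (x + v)) x \<le> T (\<lambda>x. 1 * f x + e) x"
    using assms(2) by (intro averaging_mono[OF assms(1)]) (simp add: abs_le_iff algebra_simps)
  moreover have "T (\<lambda>x. 1 * f x + (- e)) x \<le> T (\<lambda>x. f (x + v)) x"
    using assms(2) by (intro averaging_mono[OF assms(1)]) (simp add: abs_le_iff algebra_simps)
  ultimately show ?thesis
    unfolding averaging_linear[OF assms(1)] averaging_const[OF assms(1)]
      averaging_translate[OF assms(1)] by simp
qed

text \<open>The metric need not be translation invariant, so uniformity is expressed by a
  neighbourhood of 0. It comes from covering the slice over 0 by open boxes, as in the tube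
  lemma.\<close>

lemma translation_uniformly_continuous:
  fixes f :: "'a::{topological_ab_group_add, metric_space} \<Rightarrow> 'b::metric_space"
  assumes "compact (UNIV :: 'a set)" "continuous_on UNIV f" "e > 0"
  obtains V where "open V" "0 \<in> V" "\<And>x v. v \<in> V \<Longrightarrow> dist (f (x + v)) (f x) < e"
proof -
  define W where "W = {p :: 'a \<times> 'a. dist (f (fst p + snd p)) (f (fst p)) < e}"
  have "continuous_on UNIV (\<lambda>p :: 'a \<times> 'a. dist (f (fst p + snd p)) (f (fst p)))"
    by (intro continuous_on_dist continuous_on_compose2[OF assms(2)] continuous_intros) auto
  then have "open W"
    unfolding W_def by (intro open_Collect_less) auto
  have "\<forall>x. \<exists>P. open (fst P) \<and> open (snd P) \<and> x \<in> fst P \<and> 0 \<in> snd P \<and> fst P \<times> snd P \<subseteq> W"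
  proof
    fix x :: 'a
    have "(x, 0) \<in> W" using assms(3) by (simp add: W_def)
    then obtain U V where "open U" "open V" "(x, 0) \<in> U \<times> V" "U \<times> V \<subseteq> W"
      using open_prod_elim[OF \<open>open W\<close>] by metis
    then show "\<exists>P. open (fst P) \<and> open (snd P) \<and> x \<in> fst P \<and> 0 \<in> snd P \<and> fst P \<times> snd P \<subseteq> W"
      by (intro exI[of _ "(U, V)"]) auto
  qed
  from choice[OF this] obtain P where P: "\<forall>x. open (fst (P x)) \<and> open (snd (P x)) \<and> x \<in> fst (P x) \<and>
      0 \<in> snd (P x) \<and> fst (P x) \<times> snd (P x) \<subseteq> W" by blast
  define U V where "U x = fst (P x)" and "V x = snd (P x)" for x
  have UV: "open (U x)" "open (V x)" "x \<in> U x" "0 \<in> V x" "U x \<times> V x \<subseteq> W" for x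
    using P by (auto simp: U_def V_def)
  obtain C where C: "finite C" "(\<Union>x\<in>C. U x) = UNIV"
  proof -
    obtain D where "D \<subseteq> UNIV" "finite D" "UNIV \<subseteq> (\<Union>x\<in>D. U x)"
      by (rule compactE_image[OF assms(1), of UNIV U]) (use UV in auto)
    then show ?thesis using that by blast
  qed
  show ?thesis
  proof
    show "open (\<Inter>x\<in>C. V x)" using C UV by auto
    show "0 \<in> (\<Inter>x\<in>C. V x)" using UV by auto
    show "dist (f (x + v)) (f x) < e" if "v \<in> (\<Inter>x\<in>C. V x)" for x v
    proof -
      obtain y where "y \<in> C" "x \<in> U y" using C by auto
      with that have "(x, v) \<in> U y \<times> V y" by auto
      with UV(5)[of y] have "(x, v) \<in> W" by blast
      then show ?thesis by (simp add: W_def)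
    qed
  qed
qed

text \<open>Finitely many translations suffice to move every point near a minimum \<open>z\<close>
  of \<open>T f\<close>. In the average over them one summand is then within \<open>e / 2\<close> of
  the minimum, so the oscillation shrinks by the factor \<open>q\<close> up to the error
  \<open>e / 2\<close>; iteration brings it below \<open>e\<close>.\<close>

lemma averaging_oscillation:
  fixes f :: "'a::{topological_ab_group_add, metric_space} \<Rightarrow> real"
  assumes cpt: "compact (UNIV :: 'a set)" and f: "continuous_on UNIV f" and e: "e > 0"
  obtains T where "averaging T" "\<And>x y. T f x - T f y \<le> e"
proof -
  obtain V where V: "open V" "0 \<in> V" "\<And>x v. v \<in> V \<Longrightarrow> dist (f (x + v)) (f x) < e / 2"
    using translation_uniformly_continuous[OF cpt f, of "e / 2"] e by auto
  have op: "open ((\<lambda>v. a - v) ` V)" for a :: 'a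
  proof -
    have "(\<lambda>v. a - v) ` V = (\<lambda>x. a - x) -` V" by (auto intro!: image_eqI[where x = "a - _"])
    moreover have "open ((\<lambda>x. a - x) -` V)"
      by (intro open_vimage V continuous_intros)
    ultimately show ?thesis by simp
  qed
  obtain A where A: "finite A" "UNIV \<subseteq> (\<Union>a\<in>A. (\<lambda>v. a - v) ` V)"
    by (rule compactE_image[OF cpt, of UNIV "\<lambda>a. (\<lambda>v. a - v) ` V"]) (use op V(2) in \<open>auto intro!: image_eqI[of _ _ 0]\<close>)
  have "A \<noteq> {}" using A(2) by auto
  define N where "N = real (card A)"
  have N: "N \<ge> 1" using A(1) \<open>A \<noteq> {}\<close> unfolding N_def
    by (metis One_nat_def Suc_leI card_gt_0_iff of_nat_1 of_nat_mono)
  define q where "q = 1 - 1 / N"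
  have q: "0 \<le> q" "q < 1" using N by (auto simp: q_def)
  obtain D where D: "\<And>x. \<bar>f x\<bar> \<le> D"
    using compact_imp_bounded[OF compact_continuous_image[OF f cpt]]
    by (auto simp: bounded_iff)
  have "\<exists>T. averaging T \<and> (\<forall>x y. T f x - T f y \<le> e / 2 + q ^ n * (2 * D))" for n
  proof (induction n)
    case 0
    have "f x - f y \<le> e / 2 + q ^ 0 * (2 * D)" for x y using D[of x] D[of y] e by auto
    then show ?case using averaging_id by blast
  next
    case (Suc n)
    then obtain T where T: "averaging T" "\<And>x y. T f x - T f y \<le> e / 2 + q ^ n * (2 * D)" by blast
    define E where "E = e / 2 + q ^ n * (2 * D)"
    obtain z where z: "\<And>x. T f z \<le> T f x"
      using continuous_attains_inf[OF cpt _ averaging_continuous[OF T(1) f]] by auto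
    have "(\<Sum>a\<in>A. T f (x + a)) / N - (\<Sum>a\<in>A. T f (y + a)) / N \<le> e / 2 + q ^ Suc n * (2 * D)" for x y
    proof -
      obtain a v where a: "a \<in> A" "v \<in> V" "z - x = a - v" using A(2) by blast
      then have xa: "x + a = z + v" by (simp add: algebra_simps)
      have "\<bar>T f (z + v) - T f z\<bar> \<le> e / 2"
        using V(3)[OF a(2)] by (intro averaging_modulus[OF T(1)]) (simp add: dist_real_def less_imp_le)
      then have "T f (x + a) - T f z \<le> e / 2" unfolding xa by linarith
      moreover have "(\<Sum>b\<in>A - {a}. T f (x + b) - T f z) \<le> (\<Sum>b\<in>A - {a}. E)"
        unfolding E_def by (intro sum_mono T)
      moreover have "real (card (A - {a})) = N - 1"
        using A(1) a(1) card_gt_0_iff[of A] \<open>A \<noteq> {}\<close> by (simp add: N_def of_nat_diff Suc_leI)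
      ultimately have "(\<Sum>b\<in>A. T f (x + b) - T f z) \<le> (N - 1) * E + e / 2"
        unfolding sum.remove[OF A(1) a(1)] by simp
      moreover have "0 \<le> (\<Sum>b\<in>A. T f (y + b) - T f z)" using z by (intro sum_nonneg) simp
      ultimately have "(\<Sum>b\<in>A. T f (x + b)) - (\<Sum>b\<in>A. T f (y + b)) \<le> (N - 1) * E + e / 2"
        by (simp add: sum_subtractf)
      then have "((\<Sum>b\<in>A. T f (x + b)) - (\<Sum>b\<in>A. T f (y + b))) / N \<le> ((N - 1) * E + e / 2) / N"
        using N by (intro divide_right_mono) auto
      also have "\<dots> = q * E + (1 - q) * (e / 2)" 
        using N by (simp add: q_def add_divide_distrib diff_divide_distrib left_diff_distrib)
      also have "\<dots> = e / 2 + q ^ Suc n * (2 * D)" by (simp add: E_def algebra_simps, simp add: diff_divide_distrib)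
      finally show ?thesis by (simp add: diff_divide_distrib)
    qed
    then show ?case
      using averaging_step[OF T(1) A(1) \<open>A \<noteq> {}\<close>] unfolding N_def by blast
  qed
  note small = this
  have "\<exists>n. q ^ n * (2 * D) < e / 2"
  proof -
    have "(\<lambda>n. q ^ n * (2 * D)) \<longlonglongrightarrow> 0"
      using q by (intro tendsto_mult_left_zero LIMSEQ_power_zero) auto
    then have "\<forall>\<^sub>F n in sequentially. q ^ n * (2 * D) < e / 2"
      using e by (intro order_tendstoD(2)) auto
    then show ?thesis by (rule eventually_happens'[OF sequentially_bot])
  qed
  then obtain n where n: "q ^ n * (2 * D) < e / 2" by blast
  from small[of n] obtain T where T: "averaging T" "\<And>x y. T f x - T f y \<le> e / 2 + q ^ n * (2 * D)"
    by blast
  have "T f x - T f y \<le> e" for x y using T(2)[of x y] n by linarith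
  with T(1) show ?thesis by (rule that)
qed

text \<open>The mean of \<open>f\<close> is the constant that averages of translates of \<open>f\<close> approximate uniformly.\<close>

definition mean :: "('a::{topological_ab_group_add, metric_space} \<Rightarrow> real) \<Rightarrow> real" where
  "mean f = (INF T\<in>Collect averaging. SUP x. T f x)"

lemma averaging_bounded:
  assumes "averaging T" "\<And>x. \<bar>f x\<bar> \<le> D"
  shows "\<bar>T f x\<bar> \<le> D"
proof -
  have "f x \<le> D" "- D \<le> f x" for x using assms(2)[of x] by linarith+
  then show ?thesis
    using averaging_mono[OF assms(1), of f "\<lambda>_. D" x] averaging_mono[OF assms(1), of "\<lambda>_. -D" f x]
    by (simp add: averaging_const[OF assms(1)] abs_le_iff)
qed

text \<open>An operator \<open>S\<close> of small oscillation works: since \<open>T\<close> and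
  \<open>S\<close> commute, the supremum of \<open>T f\<close> never drops below
  \<open>S f y - e\<close>, so the infimum over all \<open>T\<close> is nearly reached by
  \<open>S\<close> already.\<close>

lemma mean_approx:
  fixes f :: "'a::{topological_ab_group_add, metric_space} \<Rightarrow> real"
  assumes cpt: "compact (UNIV :: 'a set)" and f: "continuous_on UNIV f" and e: "e > 0"
  obtains T where "averaging T" "\<And>x. \<bar>T f x - mean f\<bar> \<le> e"
proof -
  obtain S where S: "averaging S" "\<And>x y. S f x - S f y \<le> e"
    using averaging_oscillation[OF assms] by blast
  obtain D where D: "\<And>x. \<bar>f x\<bar> \<le> D"
    using compact_imp_bounded[OF compact_continuous_image[OF f cpt]]
    by (auto simp: bounded_iff)
  have bdd: "bdd_above (range (T f))" if "averaging T" for T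
    using averaging_bounded[OF that D] by (auto intro!: bdd_aboveI[of _ D] simp: abs_le_iff)
  have low: "S f y - e \<le> (SUP x. T f x)" if T: "averaging T" for T y
  proof -
    have "S f y - e = T (\<lambda>_. S f y - e) y" using averaging_const[OF T] by simp
    also have "\<dots> \<le> T (S f) y" using S(2) by (intro averaging_mono[OF T]) (simp add: algebra_simps)
    also have "\<dots> = S (T f) y" using averaging_commute[OF S(1) T] by simp
    also have "\<dots> \<le> S (\<lambda>_. SUP x. T f x) y"
      by (intro averaging_mono[OF S(1)] cSUP_upper bdd T) auto
    also have "\<dots> = (SUP x. T f x)" by (rule averaging_const[OF S(1)])
    finally show ?thesis .
  qed
  have "\<bar>S f y - mean f\<bar> \<le> e" for y
  proof -
    have "S f y - e \<le> mean f"
      unfolding mean_def using low averaging_id by (intro cINF_greatest) auto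
    moreover have "mean f \<le> (SUP x. S f x)"
      unfolding mean_def using low S(1) by (intro cINF_lower bdd_belowI[of _ "S f y - e"]) auto
    moreover have "(SUP x. S f x) \<le> S f y + e"
      using S(2) by (intro cSUP_least) (auto simp: algebra_simps)
    ultimately show ?thesis by linarith
  qed
  with S(1) show ?thesis by (rule that)
qed

text \<open>Two averages that flatten \<open>f\<close> to two constants give the same function when
  applied one after the other in either order, and this function is close to both constants.\<close>

lemma mean_eqI:
  fixes f :: "'a::{topological_ab_group_add, metric_space} \<Rightarrow> real"
  assumes cpt: "compact (UNIV :: 'a set)" and f: "continuous_on UNIV f"
    and c: "\<And>e. e > 0 \<Longrightarrow> \<exists>T. averaging T \<and> (\<forall>x. \<bar>T f x - c\<bar> \<le> e)"
  shows "mean f = c"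
proof (rule ccontr)
  assume ne: "mean f \<noteq> c"
  define e where "e = \<bar>mean f - c\<bar> / 3"
  have e: "e > 0" using ne by (simp add: e_def)
  obtain T where T: "averaging T" "\<And>x. \<bar>T f x - mean f\<bar> \<le> e" using mean_approx[OF cpt f e] by blast
  obtain S where S: "averaging S" "\<And>x. \<bar>S f x - c\<bar> \<le> e" using c[OF e] by blast
  have close: "\<bar>R g x - b\<bar> \<le> e" if "averaging R" "\<And>x. \<bar>g x - b\<bar> \<le> e" for R g b and x :: 'a
  proof -
    have "R (\<lambda>x. 1 * g x + (- b)) x = R g x - b"
      unfolding averaging_linear[OF that(1)] averaging_const[OF that(1)] by simp
    moreover have "\<bar>R (\<lambda>x. 1 * g x + (- b)) x\<bar> \<le> e"
      using that(2) by (intro averaging_bounded[OF that(1)]) auto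
    ultimately show ?thesis by simp
  qed
  have "\<bar>S (T f) 0 - mean f\<bar> \<le> e" "\<bar>T (S f) 0 - c\<bar> \<le> e"
    using close T S by blast+
  then have "\<bar>mean f - c\<bar> \<le> 2 * e" using averaging_commute[OF S(1) T(1), of f 0] by linarith
  then show False using e by (simp add: e_def)
qed

lemma mean_add:
  fixes f g :: "'a::{topological_ab_group_add, metric_space} \<Rightarrow> real"
  assumes cpt: "compact (UNIV :: 'a set)" and f: "continuous_on UNIV f" and g: "continuous_on UNIV g"
  shows "mean (\<lambda>x. f x + g x) = mean f + mean g"
proof (rule mean_eqI[OF cpt])
  show "continuous_on UNIV (\<lambda>x. f x + g x)" by (intro continuous_intros f g)
  fix e :: real assume "e > 0"
  then have e: "e / 2 > 0" by simp
  obtain T where T: "averaging T" "\<And>x. \<bar>T f x - mean f\<bar> \<le> e / 2" using mean_approx[OF cpt f e] by blast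
  obtain S where S: "averaging S" "\<And>x. \<bar>S g x - mean g\<bar> \<le> e / 2" using mean_approx[OF cpt g e] by blast
  have close: "\<bar>R h x - b\<bar> \<le> e / 2" if "averaging R" "\<And>x. \<bar>h x - b\<bar> \<le> e / 2" for R h b and x :: 'a
  proof -
    have "R (\<lambda>x. 1 * h x + (- b)) x = R h x - b"
      unfolding averaging_linear[OF that(1)] averaging_const[OF that(1)] by simp
    moreover have "\<bar>R (\<lambda>x. 1 * h x + (- b)) x\<bar> \<le> e / 2"
      using that(2) by (intro averaging_bounded[OF that(1)]) auto
    ultimately show ?thesis by simp
  qed
  have "\<bar>S (T (\<lambda>x. f x + g x)) x - (mean f + mean g)\<bar> \<le> e" for x
  proof -
    have "S (T (\<lambda>x. f x + g x)) x = S (\<lambda>x. T f x + T g x) x"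
      using averaging_add[OF T(1), of f g] by presburger
    also have "\<dots> = S (T f) x + T (S g) x"
      by (simp add: averaging_add[OF S(1)] averaging_commute[OF S(1) T(1)])
    finally show ?thesis using close[OF S(1), where h = "T f" and x = x, OF T(2)] close[OF T(1), where h = "S g" and x = x, OF S(2)]
      by linarith
  qed
  then show "\<exists>T. averaging T \<and> (\<forall>x. \<bar>T (\<lambda>x. f x + g x) x - (mean f + mean g)\<bar> \<le> e)"
    using averaging_compose[OF S(1) T(1)] by blast
qed

lemma mean_const:
  assumes cpt: "compact (UNIV :: 'a::{topological_ab_group_add, metric_space} set)"
  shows "mean (\<lambda>x::'a. c) = c"
  by (rule mean_eqI[OF cpt]) (auto intro!: exI[of _ "\<lambda>f. f"] averaging_id)

lemma mean_mono:
  fixes f g :: "'a::{topological_ab_group_add, metric_space} \<Rightarrow> real"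
  assumes cpt: "compact (UNIV :: 'a set)" and f: "continuous_on UNIV f" and g: "continuous_on UNIV g"
    and le: "\<And>x. f x \<le> g x"
  shows "mean f \<le> mean g"
proof -
  have h: "continuous_on UNIV (\<lambda>x. g x - f x)" by (intro continuous_intros f g)
  have "0 \<le> mean (\<lambda>x. g x - f x)"
  proof (rule field_le_epsilon)
    fix e :: real assume "e > 0"
    then obtain T where T: "averaging T" "\<And>x. \<bar>T (\<lambda>x. g x - f x) x - mean (\<lambda>x. g x - f x)\<bar> \<le> e"
      using mean_approx[OF cpt h] by blast
    have "0 \<le> T (\<lambda>x. g x - f x) 0"
      using averaging_mono[OF T(1), of "\<lambda>_. 0" "\<lambda>x. g x - f x" 0] averaging_zero[OF T(1)] le by simp
    then show "0 \<le> mean (\<lambda>x. g x - f x) + e" using T(2)[of 0] by linarith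
  qed
  moreover have "mean g = mean f + mean (\<lambda>x. g x - f x)"
    using mean_add[OF cpt f h] by simp
  ultimately show ?thesis by simp
qed

lemma mean_translate:
  fixes f :: "'a::{topological_ab_group_add, metric_space} \<Rightarrow> real"
  assumes cpt: "compact (UNIV :: 'a set)" and f: "continuous_on UNIV f"
  shows "mean (\<lambda>x. f (x + a)) = mean f"
proof (rule mean_eqI[OF cpt])
  show "continuous_on UNIV (\<lambda>x. f (x + a))"
    by (intro continuous_on_compose2[OF f] continuous_intros) auto
  fix e :: real assume "e > 0"
  then obtain T where T: "averaging T" "\<And>x. \<bar>T f x - mean f\<bar> \<le> e" using mean_approx[OF cpt f] by blast
  then show "\<exists>T. averaging T \<and> (\<forall>x. \<bar>T (\<lambda>x. f (x + a)) x - mean f\<bar> \<le> e)"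
    using averaging_translate[OF T(1)] by metis
qed

section \<open>Haar measure\<close>

definition subordinate :: "'a::metric_space set \<Rightarrow> ('a \<Rightarrow> real) \<Rightarrow> bool" where
  "subordinate U f \<longleftrightarrow> continuous_on UNIV f \<and> (\<forall>x. 0 \<le> f x \<and> f x \<le> 1) \<and> (\<forall>x. x \<notin> U \<longrightarrow> f x = 0)"

text \<open>Riesz's construction: open sets are measured from inside by continuous functions,
  arbitrary sets from outside by open sets, and Caratheodory's criterion then yields a Borel
  measure.\<close>

definition vol :: "'a::{topological_ab_group_add, metric_space} set \<Rightarrow> real" where
  "vol U = (SUP f\<in>Collect (subordinate U). mean f)"

definition outer_vol :: "'a::{topological_ab_group_add, metric_space} set \<Rightarrow> ennreal" where
  "outer_vol A = (INF U\<in>{U. open U \<and> A \<subseteq> U}. ennreal (vol U))"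

lemma subordinate_zero: "subordinate U (\<lambda>x. 0)"
  by (simp add: subordinate_def)

lemma subordinate_mono: "subordinate U f \<Longrightarrow> U \<subseteq> V \<Longrightarrow> subordinate V f"
  by (auto simp: subordinate_def)

context
  fixes ty :: "'a::{topological_ab_group_add, metric_space} itself"
  assumes cpt: "compact (UNIV :: 'a set)"
begin

lemma mean_subordinate:
  assumes "subordinate U (f :: 'a \<Rightarrow> real)"
  shows "0 \<le> mean f" "mean f \<le> 1"
proof -
  have "continuous_on UNIV f" "\<And>x. 0 \<le> f x" "\<And>x. f x \<le> 1" using assms by (auto simp: subordinate_def)
  then have "mean (\<lambda>_::'a. 0) \<le> mean f" "mean f \<le> mean (\<lambda>_::'a. 1)"
    by (auto intro!: mean_mono[OF cpt])
  then show "0 \<le> mean f" "mean f \<le> 1" by (simp_all add: mean_const[OF cpt])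
qed

lemma vol_upper: "subordinate U (f :: 'a \<Rightarrow> real) \<Longrightarrow> mean f \<le> vol U"
  unfolding vol_def by (intro cSUP_upper bdd_aboveI[of _ 1]) (auto dest: mean_subordinate)

lemma vol_least:
  fixes U :: "'a set"
  assumes "\<And>f. subordinate U f \<Longrightarrow> mean f \<le> c"
  shows "vol U \<le> c"
  unfolding vol_def using assms subordinate_zero by (intro cSUP_least) auto

lemma vol_approx:
  assumes "e > 0"
  obtains f :: "'a \<Rightarrow> real" where "subordinate U f" "vol U - e < mean f"
proof (rule ccontr)
  assume "\<not> thesis"
  then have "vol U \<le> vol U - e"
    using that by (intro vol_least) (meson not_le_imp_less)
  with assms show False by simp
qed

lemma vol_nonneg: "0 \<le> vol (U :: 'a set)"
  using vol_upper[OF subordinate_zero, of U] by (simp add: mean_const[OF cpt])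

lemma vol_le_1: "vol (U :: 'a set) \<le> 1"
  by (rule vol_least) (rule mean_subordinate)

lemma vol_mono: "U \<subseteq> V \<Longrightarrow> vol (U :: 'a set) \<le> vol V"
  by (intro vol_least vol_upper) (rule subordinate_mono)

lemma vol_UNIV: "vol (UNIV :: 'a set) = 1"
proof (rule antisym[OF vol_le_1])
  have "mean (\<lambda>x::'a. 1) \<le> vol (UNIV :: 'a set)" by (rule vol_upper) (simp add: subordinate_def)
  then show "1 \<le> vol (UNIV :: 'a set)" by (simp add: mean_const[OF cpt])
qed

lemma vol_empty: "vol ({} :: 'a set) = 0"
proof (rule antisym[OF _ vol_nonneg], rule vol_least)
  fix f :: "'a \<Rightarrow> real" assume "subordinate {} f"
  then have "f = (\<lambda>x. 0)" by (auto simp: subordinate_def)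
  then show "mean f \<le> 0" by (simp add: mean_const[OF cpt])
qed

lemma mean_sum:
  assumes "\<And>i. i \<in> I \<Longrightarrow> continuous_on UNIV (f i :: 'a \<Rightarrow> real)"
  shows "mean (\<lambda>x. \<Sum>i\<in>I. f i x) = (\<Sum>i\<in>I. mean (f i))"
  using assms
proof (induction I rule: infinite_finite_induct)
  case (insert i I)
  have "mean (\<lambda>x. f i x + (\<Sum>i\<in>I. f i x)) = mean (f i) + mean (\<lambda>x. \<Sum>i\<in>I. f i x)"
    using insert by (intro mean_add[OF cpt] continuous_intros) auto
  with insert show ?case by simp
qed (simp_all add: mean_const[OF cpt])

text \<open>A function vanishing off an open set need not have closed support inside it. Lowering
  \<open>f\<close> by \<open>e\<close> confines it to the closed set where
  \<open>e \<le> f x\<close>, at the cost \<open>e\<close> in the mean.\<close>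

lemma mean_le_positive_part:
  assumes f: "continuous_on UNIV (f :: 'a \<Rightarrow> real)"
  shows "mean f \<le> e + mean (\<lambda>x. max 0 (f x - e))"
proof -
  have "mean f \<le> mean (\<lambda>x. e + max 0 (f x - e))"
    by (intro mean_mono[OF cpt] continuous_intros f) simp
  also have "\<dots> = e + mean (\<lambda>x. max 0 (f x - e))"
    by (subst mean_add[OF cpt]) (auto intro!: continuous_intros f simp: mean_const[OF cpt])
  finally show ?thesis .
qed

text \<open>A function almost attaining the volume of the union is cut off at level
  \<open>c\<close>. What remains lives on a compact set covered by finitely many \<open>U n\<close>
  and is distributed over them by a partition of unity.\<close>

lemma vol_UN_le:
  fixes U :: "nat \<Rightarrow> 'a set"
  assumes U: "\<And>n. open (U n)"
  shows "ennreal (vol (\<Union>n. U n)) \<le> suminf (\<lambda>n. ennreal (vol (U n)))"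
proof (rule ennreal_le_epsilon)
  fix e :: real assume e: "e > 0"
  obtain f :: "'a \<Rightarrow> real" where f: "subordinate (\<Union>n. U n) f" "vol (\<Union>n. U n) - e/2 < mean f"
    using vol_approx[of "e/2"] e by auto
  define c where "c = e / 2"
  have c: "c > 0" using e by (simp add: c_def)
  have fc: "continuous_on UNIV f" and f01: "\<And>x. 0 \<le> f x" "\<And>x. f x \<le> 1" using f by (auto simp: subordinate_def)
  define K where "K = {x. c \<le> f x}"
  have "closed K" unfolding K_def by (intro closed_Collect_le continuous_intros fc)
  then have "compact K" using compact_Int_closed[OF cpt, of K] by simp
  have "K \<subseteq> (\<Union>n. U n)"
  proof
    fix x assume "x \<in> K"
    then have "f x \<noteq> 0" using c by (auto simp: K_def)
    then show "x \<in> (\<Union>n. U n)" using f(1) unfolding subordinate_def by blast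
  qed
  then obtain I where I: "finite I" "K \<subseteq> (\<Union>n\<in>I. U n)"
    using compactE_image[OF \<open>compact K\<close>, of UNIV U] U by metis
  \<comment> \<open>The distance to an empty complement is 0 by convention, so the full space gets
    its own value.\<close>
  define d where "d n x = (if U n = UNIV then 1 else infdist x (- U n))" for n and x :: 'a
  have dc: "continuous_on UNIV (d n)" for n
    unfolding d_def by (cases "U n = UNIV") (auto intro!: continuous_intros)
  have d0: "d n x \<ge> 0" "x \<notin> U n \<Longrightarrow> d n x = 0" for n x
    by (auto simp: d_def infdist_nonneg)
  have dpos: "d n x > 0" if "x \<in> U n" for n x
    using infdist_pos_not_in_closed[of "- U n" x] U[of n] that by (auto simp: d_def closed_def)
  define s where "s x = (\<Sum>n\<in>I. d n x)" for x
  \<comment> \<open>The added term vanishes where \<open>c \<le> f x\<close>, so the weights sum to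
    1 there, and it keeps the denominator positive elsewhere.\<close>
  define t where "t x = s x + max 0 (c - f x)" for x
  have s0: "s x \<ge> 0" for x unfolding s_def by (intro sum_nonneg d0)
  have spos: "s x > 0" if xK: "x \<in> K" for x
  proof -
    obtain n where "n \<in> I" "x \<in> U n" using subsetD[OF I(2) xK] by blast
    then show ?thesis unfolding s_def using I(1) d0 dpos by (intro sum_pos2[of I n]) auto
  qed
  have tpos: "t x > 0" for x
    using s0[of x] spos[of x] by (cases "x \<in> K") (auto simp: t_def K_def add_nonneg_pos add_pos_nonneg)
  have tc: "continuous_on UNIV t" unfolding t_def s_def by (intro continuous_intros dc fc)
  define g where "g n x = max 0 (f x - c) * d n x / t x" for n x
  have gc: "continuous_on UNIV (g n)" for n
    unfolding g_def using tpos by (intro continuous_intros fc dc tc) (auto simp: less_le)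
  have gsum: "(\<Sum>n\<in>I. g n x) = max 0 (f x - c)" for x
  proof -
    have "(\<Sum>n\<in>I. g n x) = max 0 (f x - c) * s x / t x"
      by (simp add: g_def s_def sum_distrib_left sum_divide_distrib)
    moreover have "t x = s x" if "f x \<ge> c" using that by (simp add: t_def)
    ultimately show ?thesis using tpos[of x] by (cases "f x \<ge> c") auto
  qed
  have g0: "0 \<le> g n x" for n x
    unfolding g_def using d0(1)[of n x] tpos[of x] by auto
  have gsub: "subordinate (U n) (g n)" if "n \<in> I" for n
  proof -
    have "g n x \<le> 1" for x
    proof -
      have "g n x \<le> (\<Sum>n\<in>I. g n x)" using that I(1) g0 by (intro member_le_sum) auto
      also have "\<dots> \<le> 1" using gsum[of x] f01(2)[of x] c by simp
      finally show ?thesis .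
    qed
    then show ?thesis using gc g0 d0 by (auto simp: subordinate_def g_def)
  qed
  have "vol (\<Union>n. U n) \<le> c + mean f" using f(2) by (simp add: c_def)
  also have "mean f \<le> c + mean (\<lambda>x. max 0 (f x - c))" by (rule mean_le_positive_part[OF fc])
  also have "mean (\<lambda>x. max 0 (f x - c)) = mean (\<lambda>x. \<Sum>n\<in>I. g n x)" by (simp add: gsum)
  also have "\<dots> = (\<Sum>n\<in>I. mean (g n))" by (rule mean_sum[OF gc])
  also have "\<dots> \<le> (\<Sum>n\<in>I. vol (U n))" by (intro sum_mono vol_upper gsub)
  finally have "vol (\<Union>n. U n) \<le> (\<Sum>n\<in>I. vol (U n)) + e" by (simp add: c_def)
  then have "ennreal (vol (\<Union>n. U n)) \<le> ennreal ((\<Sum>n\<in>I. vol (U n)) + e)" by (rule ennreal_leI)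
  also have "\<dots> = (\<Sum>n\<in>I. ennreal (vol (U n))) + ennreal e"
    using e vol_nonneg by (subst ennreal_plus) (auto intro: sum_nonneg)
  also have "(\<Sum>n\<in>I. ennreal (vol (U n))) \<le> suminf (\<lambda>n. ennreal (vol (U n)))"
    using I(1) by (intro sum_le_suminf) auto
  finally show "ennreal (vol (\<Union>n. U n)) \<le> suminf (\<lambda>n. ennreal (vol (U n))) + ennreal e" by (simp add: add_right_mono)
qed

lemma outer_vol_open: "open U \<Longrightarrow> outer_vol (U :: 'a set) = ennreal (vol U)"
  unfolding outer_vol_def by (intro antisym INF_lower INF_greatest ennreal_leI vol_mono) auto

lemma outer_vol_mono: "A \<subseteq> B \<Longrightarrow> outer_vol (A :: 'a set) \<le> outer_vol B"
  unfolding outer_vol_def by (intro INF_superset_mono) auto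

lemma outer_vol_approx:
  assumes "e > 0"
  obtains U where "open U" "A \<subseteq> U" "ennreal (vol U) \<le> outer_vol (A :: 'a set) + ennreal e"
proof -
  have "outer_vol A \<le> outer_vol (UNIV :: 'a set)" by (rule outer_vol_mono) simp
  then have "outer_vol A < \<infinity>" by (auto simp: outer_vol_open vol_UNIV intro: le_less_trans)
  then have "outer_vol A < outer_vol A + ennreal e" using assms
    by (metis ennreal_add_eq_top ennreal_add_left_cancel_less ennreal_less_zero_iff infinity_ennreal_def add.right_neutral less_irrefl)
  then have "(INF U\<in>{U. open U \<and> A \<subseteq> U}. ennreal (vol U)) < outer_vol A + ennreal e"
    by (simp only: outer_vol_def)
  then obtain U where "U \<in> {U. open U \<and> A \<subseteq> U}" "ennreal (vol U) < outer_vol A + ennreal e"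
    unfolding INF_less_iff by blast
  then show ?thesis by (intro that[of U]) auto
qed

lemma outer_vol_UN_le:
  fixes A :: "nat \<Rightarrow> 'a set"
  shows "outer_vol (\<Union>n. A n) \<le> suminf (\<lambda>n. outer_vol (A n))"
proof (rule ennreal_le_epsilon)
  fix e :: real assume e: "e > 0"
  have "\<exists>U. open U \<and> A n \<subseteq> U \<and> ennreal (vol U) \<le> outer_vol (A n) + ennreal (e * (1/2) ^ Suc n)" for n
    by (rule outer_vol_approx[of "e * (1/2) ^ Suc n" "A n"]) (use e in auto)
  then obtain U where U: "\<And>n. open (U n)" "\<And>n. A n \<subseteq> U n"
     "\<And>n. ennreal (vol (U n)) \<le> outer_vol (A n) + ennreal (e * (1/2) ^ Suc n)" by metis
  have "outer_vol (\<Union>n. A n) \<le> ennreal (vol (\<Union>n. U n))"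
    unfolding outer_vol_def using U by (intro INF_lower) auto
  also have "\<dots> \<le> suminf (\<lambda>n. ennreal (vol (U n)))" by (rule vol_UN_le[OF U(1)])
  also have "\<dots> \<le> suminf (\<lambda>n. outer_vol (A n) + ennreal (e * (1/2) ^ Suc n))"
    by (intro suminf_le U(3) summableI)
  also have "\<dots> = suminf (\<lambda>n. outer_vol (A n)) + suminf (\<lambda>n. ennreal (e * (1/2) ^ Suc n))"
    by (intro suminf_add[symmetric] summableI)
  also have "suminf (\<lambda>n. ennreal (e * (1/2) ^ Suc n)) = ennreal e"
    using sums_mult[OF power_half_series, of e] e
    by (intro suminf_ennreal_eq) auto
  finally show "outer_vol (\<Union>n. A n) \<le> suminf (\<lambda>n. outer_vol (A n)) + ennreal e" .
qed

lemma outer_measure_space_outer_vol: "outer_measure_space UNIV (outer_vol :: 'a set \<Rightarrow> ennreal)"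
  unfolding outer_measure_space_def positive_def increasing_def countably_subadditive_def
  using outer_vol_open[of "{}"] by (auto simp: vol_empty intro: outer_vol_mono outer_vol_UN_le)

text \<open>This is the half of Caratheodory's criterion that subadditivity does not give. With
  \<open>K\<close> the set where \<open>f\<close> is at least \<open>c\<close>, the cut-off of
  \<open>f\<close> and a function \<open>g\<close> vanishing on \<open>K\<close> are never both
  nonzero, so their sum is still subordinate to \<open>U\<close>.\<close>

lemma outer_vol_split:
  fixes V E :: "'a set"
  assumes V: "open V"
  shows "outer_vol (V \<inter> E) + outer_vol (- V \<inter> E) \<le> outer_vol E"
proof (rule ennreal_le_epsilon)
  fix e :: real assume e: "e > 0"
  define c where "c = e / 4"
  have c: "c > 0" using e by (simp add: c_def)
  obtain U where U: "open U" "E \<subseteq> U" "ennreal (vol U) \<le> outer_vol E + ennreal c"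
    using outer_vol_approx[OF c] by blast
  obtain f where f: "subordinate (U \<inter> V) f" "vol (U \<inter> V) - c < mean f"
    using vol_approx[OF c] by blast
  have fc: "continuous_on UNIV f" using f by (auto simp: subordinate_def)
  define K where "K = {x. c \<le> f x}"
  have K: "closed K" unfolding K_def by (intro closed_Collect_le continuous_intros fc)
  have "x \<in> V" if "x \<in> K" for x
  proof (rule ccontr)
    assume "x \<notin> V"
    then have "f x = 0" using f(1) unfolding subordinate_def by blast
    with that c show False by (simp add: K_def)
  qed
  then have KV: "K \<subseteq> V" by blast
  obtain g where g: "subordinate (U - K) g" "vol (U - K) - c < mean g"
    using vol_approx[OF c] by blast
  have gc: "continuous_on UNIV g" using g by (auto simp: subordinate_def)
  define h where "h x = max 0 (f x - c) + g x" for x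
  have "subordinate U h"
  proof -
    have "h x \<le> 1 \<and> 0 \<le> h x \<and> (x \<notin> U \<longrightarrow> h x = 0)" for x
    proof (cases "x \<in> K")
      case True
      then have "g x = 0" using g(1) by (auto simp: subordinate_def)
      then show ?thesis using f(1) c by (auto simp: h_def subordinate_def max_def) (smt (verit))
    next
      case False
      then show ?thesis using g(1) by (auto simp: h_def subordinate_def K_def)
    qed
    then show ?thesis by (auto simp: subordinate_def h_def intro!: continuous_intros fc gc)
  qed
  then have "mean h \<le> vol U" by (rule vol_upper)
  moreover have "mean h = mean (\<lambda>x. max 0 (f x - c)) + mean g"
    unfolding h_def by (intro mean_add[OF cpt] continuous_intros fc gc)
  ultimately have "vol (U \<inter> V) + vol (U - K) \<le> vol U + 3 * c"
    using mean_le_positive_part[OF fc, of c] f(2) g(2) by linarith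
  then have "ennreal (vol (U \<inter> V) + vol (U - K)) \<le> ennreal (vol U + 3 * c)" by (rule ennreal_leI)
  then have *: "ennreal (vol (U \<inter> V)) + ennreal (vol (U - K)) \<le> ennreal (vol U) + ennreal (3 * c)"
    using vol_nonneg c by (simp add: ennreal_plus)
  have "outer_vol (V \<inter> E) + outer_vol (- V \<inter> E) \<le> ennreal (vol (U \<inter> V)) + ennreal (vol (U - K))"
  proof (intro add_mono)
    show "outer_vol (V \<inter> E) \<le> ennreal (vol (U \<inter> V))"
      unfolding outer_vol_def using U V by (intro INF_lower) auto
    show "outer_vol (- V \<inter> E) \<le> ennreal (vol (U - K))"
      unfolding outer_vol_def using U K KV by (intro INF_lower) auto
  qed
  also note *
  also have "ennreal (vol U) + ennreal (3 * c) \<le> (outer_vol E + ennreal c) + ennreal (3 * c)"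
    by (intro add_right_mono U)
  also have "\<dots> = outer_vol E + ennreal e"
    using c by (simp add: add.assoc flip: ennreal_plus) (simp add: c_def)
  finally show "outer_vol (V \<inter> E) + outer_vol (- V \<inter> E) \<le> outer_vol E + ennreal e" .
qed

lemma measure_space_outer_vol: "measure_space UNIV (sets borel) (outer_vol :: 'a set \<Rightarrow> ennreal)"
proof (rule measure_down)
  interpret Pow: sigma_algebra "UNIV :: 'a set" UNIV
    using sigma_algebra_Pow[of "UNIV :: 'a set"] by simp
  let ?L = "lambda_system UNIV UNIV (outer_vol :: 'a set \<Rightarrow> ennreal)"
  show *: "measure_space UNIV ?L outer_vol"
    by (rule Pow.caratheodory_lemma[OF outer_measure_space_outer_vol])
  show "sigma_algebra UNIV (sets (borel :: 'a measure))"
    using sets.sigma_algebra_axioms[of "borel :: 'a measure"] by simp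
  have "V \<in> ?L" if V: "open V" for V
  proof -
    have "outer_vol (V \<inter> E) + outer_vol (- V \<inter> E) = outer_vol E" for E
    proof (rule antisym[OF outer_vol_split[OF V]])
      define B where "B n = (if n = 0 then V \<inter> E else if n = 1 then - V \<inter> E else {})" for n :: nat
      have "E \<subseteq> B 0 \<union> B 1" by (auto simp: B_def)
      then have "outer_vol E \<le> outer_vol (\<Union>n. B n)" by (intro outer_vol_mono) blast
      also have "\<dots> \<le> suminf (\<lambda>n. outer_vol (B n))" by (rule outer_vol_UN_le)
      also have "\<dots> = (\<Sum>n<2. outer_vol (B n))"
        by (rule suminf_finite) (auto simp: B_def outer_vol_open vol_empty)
      also have "\<dots> = outer_vol (V \<inter> E) + outer_vol (- V \<inter> E)" by (simp add: numeral_2_eq_2 B_def)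
      finally show "outer_vol E \<le> outer_vol (V \<inter> E) + outer_vol (- V \<inter> E)" .
    qed
    then show ?thesis by (simp add: lambda_system_def Compl_eq_Diff_UNIV)
  qed
  moreover have "sigma_algebra UNIV ?L" using * by (simp add: measure_space_def)
  ultimately show "sets borel \<subseteq> ?L"
    unfolding sets_borel by (intro sigma_algebra.sigma_sets_subset) auto
qed

lemma outer_vol_translate: "outer_vol ((\<lambda>x. a + x) -` A) = outer_vol (A :: 'a set)"
proof -
  have le: "outer_vol ((\<lambda>x. a + x) -` A) \<le> outer_vol A" for a :: 'a and A
    unfolding outer_vol_def[of A]
  proof (rule INF_greatest)
    fix U assume U: "U \<in> {U. open U \<and> A \<subseteq> U}"
    have "vol ((\<lambda>x. a + x) -` U) \<le> vol U"
    proof (rule vol_least)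
      fix f assume f: "subordinate ((\<lambda>x. a + x) -` U) f"
      then have fc: "continuous_on UNIV f" by (simp add: subordinate_def)
      have "subordinate U (\<lambda>x. f (x + (- a)))"
        using f by (auto simp: subordinate_def intro!: continuous_on_compose2[OF fc] continuous_intros)
      from vol_upper[OF this] show "mean f \<le> vol U" unfolding mean_translate[OF cpt fc] .
    qed
    moreover have "open ((\<lambda>x. a + x) -` U)" using U by (intro open_vimage continuous_intros) auto
    ultimately show "outer_vol ((\<lambda>x. a + x) -` A) \<le> ennreal (vol U)"
      using U unfolding outer_vol_def by (intro INF_lower2[of "(\<lambda>x. a + x) -` U"] ennreal_leI) auto
  qed
  have "(\<lambda>x. - a + x) -` ((\<lambda>x. a + x) -` A) = A" by auto
  with le[of a A] le[of "- a" "(\<lambda>x. a + x) -` A"] show ?thesis by simp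
qed

definition invariant_prob :: "'a measure \<Rightarrow> bool" where
  "invariant_prob M \<longleftrightarrow> sets M = sets borel \<and> prob_space M \<and> (\<forall>a. distr M M (\<lambda>x. a + x) = M)"

lemma invariant_prob_exists: "\<exists>M. invariant_prob M"
proof -
  define M where "M = measure_of (UNIV :: 'a set) (sets borel) outer_vol"
  have sets: "sets M = sets borel" unfolding M_def by (metis sets.sets_measure_of_eq space_borel)
  have space: "space M = UNIV" using sets_eq_imp_space_eq[OF sets] by simp
  have em: "emeasure M A = outer_vol A" if "A \<in> sets M" for A
    by (rule emeasure_measure_of[OF M_def])
       (use that measure_space_outer_vol sets in \<open>auto simp: measure_space_def\<close>)
  have "prob_space M"
    by (rule prob_spaceI) (simp add: space em sets outer_vol_open vol_UNIV)
  moreover have "distr M M (\<lambda>x. a + x) = M" for a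
  proof (rule measure_eqI)
    fix A assume "A \<in> sets (distr M M (\<lambda>x. a + x))"
    then have A: "A \<in> sets M" by simp
    have mea: "(\<lambda>x. a + x) \<in> measurable M M"
      using sets by (auto simp: measurable_cong_sets[OF sets sets] intro!: borel_measurable_continuous_onI continuous_intros)
    then have "(\<lambda>x. a + x) -` A \<in> sets M" using measurable_sets[OF mea A] by (simp add: space)
    then show "emeasure (distr M M (\<lambda>x. a + x)) A = emeasure M A"
      using A mea by (simp add: emeasure_distr space em outer_vol_translate)
  qed simp
  ultimately show ?thesis using sets unfolding invariant_prob_def by blast
qed

lemma continuous_integrable:
  fixes f :: "'a \<Rightarrow> 'b::{banach, second_countable_topology}"
  assumes "sets M = sets (borel :: 'a measure)" "prob_space M" "continuous_on UNIV f"
  shows "integrable M f"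
proof -
  obtain D where D: "\<And>x. norm (f x) \<le> D"
    using compact_imp_bounded[OF compact_continuous_image[OF assms(3) cpt]]
    by (auto simp: bounded_iff)
  interpret prob_space M by fact
  have "f \<in> borel_measurable M"
    using borel_measurable_continuous_onI[OF assms(3)] by (simp add: measurable_cong_sets[OF assms(1) refl])
  then show ?thesis using D by (intro integrable_const_bound[of _ D]) auto
qed

text \<open>An invariant measure integrates \<open>T f\<close> like \<open>f\<close>, and
  \<open>T f\<close> is uniformly close to a constant. Hence the integrals of continuous functions
  do not depend on \<open>M\<close>.\<close>

lemma integral_eq_mean:
  fixes f :: "'a \<Rightarrow> real"
  assumes M: "invariant_prob M" and f: "continuous_on UNIV f"
  shows "integral\<^sup>L M f = mean f"
proof -
  have sets: "sets M = sets borel" and pr: "prob_space M" and inv: "\<And>a. distr M M (\<lambda>x. a + x) = M"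
    using M by (auto simp: invariant_prob_def)
  interpret prob_space M by fact
  note int = continuous_integrable[OF sets pr]
  have tr: "integral\<^sup>L M (\<lambda>x. g (x + a)) = integral\<^sup>L M g" if "continuous_on UNIV g" for g :: "'a \<Rightarrow> real" and a
  proof -
    have "(\<lambda>x. a + x) \<in> measurable M M"
      using sets by (auto simp: measurable_cong_sets[OF sets sets] intro!: borel_measurable_continuous_onI continuous_intros)
    moreover have "g \<in> borel_measurable M" using int[OF that] by auto
    ultimately have "integral\<^sup>L (distr M M (\<lambda>x. a + x)) g = integral\<^sup>L M (\<lambda>x. g (a + x))"
      by (rule integral_distr)
    then have "integral\<^sup>L M g = integral\<^sup>L M (\<lambda>x. g (a + x))" unfolding inv .
    then show ?thesis by (simp add: add.commute)
  qed
  have T: "integral\<^sup>L M (T f) = integral\<^sup>L M f" if "averaging T" for T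
    using that
  proof induction
    case (averaging_step T A)
    have c: "continuous_on UNIV (T f)" by (rule averaging_continuous[OF averaging_step(1) f])
    have "integrable M (\<lambda>x. T f (x + a))" for a
      by (intro int continuous_on_compose2[OF c] continuous_intros) auto
    then show ?case using averaging_step by (simp add: tr[OF c])
  qed simp
  show ?thesis
  proof (rule antisym; rule field_le_epsilon)
    fix e :: real assume "e > 0"
    then obtain T where A: "averaging T" "\<And>x. \<bar>T f x - mean f\<bar> \<le> e" using mean_approx[OF cpt f] by blast
    note i = int[OF averaging_continuous[OF A(1) f]]
    have le: "T f x \<le> mean f + e" "mean f - e \<le> T f x" for x using A(2)[of x] by linarith+
    have "integral\<^sup>L M (T f) \<le> integral\<^sup>L M (\<lambda>x. mean f + e)"
      by (intro integral_mono i) (auto intro: le)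
    then show "integral\<^sup>L M f \<le> mean f + e" by (simp add: T[OF A(1)] prob_space)
    have "integral\<^sup>L M (\<lambda>x. mean f - e) \<le> integral\<^sup>L M (T f)"
      by (intro integral_mono i) (auto intro: le)
    then show "mean f \<le> integral\<^sup>L M f + e" by (simp add: T[OF A(1)] prob_space)
  qed
qed

text \<open>Continuous functions decreasing to the indicator of a closed set carry the equality of
  integrals over to closed sets, which generate the Borel sets and are stable under
  intersection.\<close>

lemma invariant_prob_unique:
  assumes M: "invariant_prob M" and N: "invariant_prob N"
  shows "M = N"
proof -
  have sM: "sets M = sets borel" and sN: "sets N = sets borel" and pM: "prob_space M" and pN: "prob_space N"
    using assms by (auto simp: invariant_prob_def)
  interpret M: prob_space M by fact
  interpret N: prob_space N by fact
  have spM: "space M = UNIV" using sets_eq_imp_space_eq[OF sM] by simp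
  have "measure M C = measure N C" if C: "closed C" "C \<noteq> {}" for C
  proof -
    define f where "f n x = max 0 (1 - real n * infdist x C)" for n and x :: 'a
    have fc: "continuous_on UNIV (f n)" for n unfolding f_def by (intro continuous_intros)
    have lim: "(\<lambda>n. f n x) \<longlonglongrightarrow> indicator C x" for x
    proof (cases "x \<in> C")
      case True
      then show ?thesis by (simp add: f_def)
    next
      case False
      then have pos: "infdist x C > 0" using infdist_pos_not_in_closed[OF C] by auto
      obtain m where m: "1 / infdist x C < real m" using reals_Archimedean2 by blast
      have "\<forall>n\<ge>m. f n x = indicator C x"
      proof (intro allI impI)
        fix n assume "n \<ge> m"
        then have "1 / infdist x C \<le> real n" using m by linarith
        then have "1 \<le> real n * infdist x C" using pos by (simp add: field_simps)
        then show "f n x = indicator C x" using False by (simp add: f_def)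
      qed
      then show ?thesis by (intro tendsto_eventually) (auto simp: eventually_sequentially)
    qed
    have conv: "(\<lambda>n. integral\<^sup>L L (f n)) \<longlonglongrightarrow> measure L C" if L: "invariant_prob L" for L
    proof -
      have sL: "sets L = sets borel" and pL: "prob_space L" using L by (auto simp: invariant_prob_def)
      interpret L: prob_space L by fact
      have "(\<lambda>n. integral\<^sup>L L (f n)) \<longlonglongrightarrow> integral\<^sup>L L (indicator C)"
      proof (rule integral_dominated_convergence[where w = "\<lambda>_. 1"])
        show "(indicator C :: 'a \<Rightarrow> real) \<in> borel_measurable L" using C sL by (intro borel_measurable_indicator) auto
        show "f n \<in> borel_measurable L" for n using continuous_integrable[OF sL pL fc] by auto
        show "integrable L (\<lambda>_. 1 :: real)" by simp
        show "AE x in L. (\<lambda>n. f n x) \<longlonglongrightarrow> indicator C x" using lim by auto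
        show "AE x in L. norm (f n x) \<le> 1" for n by (auto simp: f_def infdist_nonneg)
      qed
      then show ?thesis using sets_eq_imp_space_eq[OF sL] by simp
    qed
    have "integral\<^sup>L M (f n) = integral\<^sup>L N (f n)" for n
      by (simp add: integral_eq_mean[OF M fc] integral_eq_mean[OF N fc])
    then have "(\<lambda>n. integral\<^sup>L N (f n)) \<longlonglongrightarrow> measure M C" using conv[OF M] by simp
    then show ?thesis by (rule LIMSEQ_unique[OF _ conv[OF N]])
  qed
  then have eq: "emeasure M C = emeasure N C" if "closed C" for C
    using that by (cases "C = {}") (auto simp: M.emeasure_eq_measure N.emeasure_eq_measure)
  show ?thesis
  proof (rule measure_eqI_generator_eq[where E = "Collect closed" and \<Omega> = UNIV and A = "\<lambda>_. UNIV"])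
    show "Int_stable (Collect closed :: 'a set set)" by (intro Int_stableI) (simp add: closed_Int)
    show "sets M = sigma_sets UNIV (Collect closed)" "sets N = sigma_sets UNIV (Collect closed)"
      unfolding sM sN borel_eq_closed by simp_all
    show "emeasure M C = emeasure N C" if "C \<in> Collect closed" for C using that eq by simp
    show "emeasure M UNIV \<noteq> \<infinity>" by (simp add: M.emeasure_eq_measure)
    show "range (\<lambda>_::nat. UNIV :: 'a set) \<subseteq> Collect closed" by auto
    show "Collect closed \<subseteq> Pow (UNIV :: 'a set)" by auto
    show "\<Union> (range (\<lambda>_::nat. UNIV)) = (UNIV :: 'a set)" by auto
  qed
qed

lemma haar_measure_invariant: "invariant_prob haar_measure"
proof -
  obtain M where M: "invariant_prob M" using invariant_prob_exists by blast
  have "haar_measure = (THE M :: 'a measure. invariant_prob M)"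
    unfolding haar_measure_def invariant_prob_def by (rule refl)
  also have "\<dots> = M" by (rule the_equality) (fact M, rule invariant_prob_unique[OF _ M])
  finally show ?thesis using M by simp
qed

lemma invariant_prob_eq_haar_measure: "invariant_prob M \<Longrightarrow> M = haar_measure"
  by (rule invariant_prob_unique[OF _ haar_measure_invariant])

end

section \<open>Convolution on a compact abelian group\<close>

definition conv :: "('a::topological_ab_group_add \<Rightarrow> complex) \<Rightarrow> ('a \<Rightarrow> complex) \<Rightarrow> 'a \<Rightarrow> complex" where
  "conv f g x = integral\<^sup>L haar_measure (\<lambda>y. f (x - y) * g y)"

definition sqnorm :: "('a::topological_ab_group_add \<Rightarrow> complex) \<Rightarrow> real" where
  "sqnorm f = integral\<^sup>L haar_measure (\<lambda>x. (cmod (f x))\<^sup>2)"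

definition hermitian :: "('a::topological_ab_group_add \<Rightarrow> complex) \<Rightarrow> bool" where
  "hermitian f \<longleftrightarrow> (\<forall>x. f (- x) = cnj (f x))"

context
  fixes ty :: "'a::{topological_ab_group_add, metric_space} itself"
  assumes cpt: "compact (UNIV :: 'a set)"
begin

lemma haar_sets: "sets (haar_measure :: 'a measure) = sets borel"
  and haar_prob: "prob_space (haar_measure :: 'a measure)"
  and haar_translate: "distr haar_measure haar_measure (\<lambda>x. a + x) = (haar_measure :: 'a measure)"
  using haar_measure_invariant[OF cpt] by (auto simp: invariant_prob_def[OF cpt])

lemma haar_space: "space (haar_measure :: 'a measure) = UNIV"
  using sets_eq_imp_space_eq[OF haar_sets] by simp

lemma haar_integrable:
  fixes f :: "'a \<Rightarrow> 'b::{banach, second_countable_topology}"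
  shows "continuous_on UNIV f \<Longrightarrow> integrable haar_measure f"
  by (rule continuous_integrable[OF cpt haar_sets haar_prob])

lemma haar_measurable:
  fixes g :: "'a \<Rightarrow> 'b::topological_space"
  shows "continuous_on UNIV g \<Longrightarrow> g \<in> borel_measurable haar_measure"
  using borel_measurable_continuous_onI[of g] by (simp add: measurable_cong_sets[OF haar_sets refl])

lemma haar_measurable_self:
  fixes g :: "'a \<Rightarrow> 'a"
  shows "continuous_on UNIV g \<Longrightarrow> g \<in> measurable haar_measure haar_measure"
  using haar_measurable[of g] by (simp add: measurable_cong_sets[OF refl haar_sets])

lemma haar_const: "integral\<^sup>L (haar_measure :: 'a measure) (\<lambda>x. c :: 'b::{banach, second_countable_topology}) = c"
proof -
  interpret prob_space "haar_measure :: 'a measure" by (rule haar_prob)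
  show ?thesis using prob_space by simp
qed

lemma haar_shift:
  fixes f :: "'a \<Rightarrow> 'b::{banach, second_countable_topology}"
  assumes f: "continuous_on UNIV f"
  shows "integral\<^sup>L haar_measure (\<lambda>x. f (x + a)) = integral\<^sup>L haar_measure f"
proof -
  have "(\<lambda>x. a + x) \<in> measurable haar_measure haar_measure"
    by (intro haar_measurable_self continuous_intros)
  then have "integral\<^sup>L (distr haar_measure haar_measure (\<lambda>x. a + x)) f = integral\<^sup>L haar_measure (\<lambda>x. f (a + x))"
    by (rule integral_distr) (rule haar_measurable[OF f])
  then show ?thesis unfolding haar_translate by (simp add: add.commute)
qed

text \<open>By surjectivity every translation lifts through \<open>g\<close>, so the image measure
  is again invariant and uniqueness applies. Used for the automorphisms of an action and for
  negation.\<close>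

lemma haar_distr_epimorphism:
  fixes g :: "'a \<Rightarrow> 'a"
  assumes g: "continuous_on UNIV g" "\<And>x y. g (x + y) = g x + g y" "surj g"
  shows "distr haar_measure haar_measure g = haar_measure"
proof (rule invariant_prob_eq_haar_measure[OF cpt])
  interpret prob_space "haar_measure :: 'a measure" by (rule haar_prob)
  have mg: "g \<in> measurable haar_measure haar_measure" by (rule haar_measurable_self[OF g(1)])
  have mt: "(\<lambda>x. a + x) \<in> measurable haar_measure haar_measure" for a :: 'a
    by (intro haar_measurable_self continuous_intros)
  let ?D = "distr haar_measure haar_measure g"
  have "distr ?D ?D (\<lambda>x. a + x) = ?D" for a
  proof -
    obtain b where b: "g b = a" using g(3) by (metis surjD)
    have "distr ?D ?D (\<lambda>x. a + x) = distr ?D haar_measure (\<lambda>x. a + x)" by (rule distr_cong) auto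
    also have "\<dots> = distr haar_measure haar_measure ((\<lambda>x. a + x) \<circ> g)"
      by (rule distr_distr[OF mt mg])
    also have "(\<lambda>x. a + x) \<circ> g = g \<circ> (\<lambda>x. b + x)" by (auto simp: g(2) b)
    also have "distr haar_measure haar_measure (g \<circ> (\<lambda>x. b + x)) =
        distr (distr haar_measure haar_measure (\<lambda>x. b + x)) haar_measure g"
      by (rule distr_distr[OF mg mt, symmetric])
    finally show ?thesis unfolding haar_translate .
  qed
  moreover have "prob_space ?D" by (rule prob_space_distr[OF mg])
  ultimately show "invariant_prob ?D"
    unfolding invariant_prob_def[OF cpt] using haar_sets by simp
qed

lemma haar_epimorphism:
  fixes f :: "'a \<Rightarrow> 'b::{banach, second_countable_topology}" and g :: "'a \<Rightarrow> 'a"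
  assumes g: "continuous_on UNIV g" "\<And>x y. g (x + y) = g x + g y" "surj g"
    and f: "continuous_on UNIV f"
  shows "integral\<^sup>L haar_measure (\<lambda>x. f (g x)) = integral\<^sup>L haar_measure f"
  using integral_distr[OF haar_measurable_self[OF g(1)] haar_measurable[OF f]]
  unfolding haar_distr_epimorphism[OF g] by simp

lemma haar_reflect:
  fixes f :: "'a \<Rightarrow> 'b::{banach, second_countable_topology}"
  assumes f: "continuous_on UNIV f"
  shows "integral\<^sup>L haar_measure (\<lambda>x. f (a - x)) = integral\<^sup>L haar_measure f"
proof -
  have "integral\<^sup>L haar_measure (\<lambda>x. f (a + (- x))) = integral\<^sup>L haar_measure (\<lambda>x. f (a + x))"
  proof (rule haar_epimorphism[where f = "\<lambda>x. f (a + x)"])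
    show "surj (uminus :: 'a \<Rightarrow> 'a)" by (metis surj_def minus_minus)
  qed (auto intro!: continuous_intros continuous_on_compose2[OF f])
  then show ?thesis using haar_shift[OF f, of a] by (simp add: add.commute)
qed

text \<open>Finitely many translates of \<open>U\<close> cover the group, and all have the same
  measure.\<close>

lemma haar_open_pos:
  fixes U :: "'a set"
  assumes U: "open U" "U \<noteq> {}"
  shows "measure haar_measure U > 0"
proof (rule ccontr)
  interpret prob_space "haar_measure :: 'a measure" by (rule haar_prob)
  assume "\<not> ?thesis"
  then have U0: "measure haar_measure U = 0" using measure_nonneg[of haar_measure U] by linarith
  obtain u where u: "u \<in> U" using U by auto
  have op: "open ((\<lambda>x. a + x) -` U)" for a by (intro open_vimage U continuous_intros)
  have cov: "UNIV \<subseteq> (\<Union>a\<in>UNIV. (\<lambda>x. a + x) -` U)"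
  proof
    fix x
    have "x \<in> (\<lambda>y. (u - x) + y) -` U" using u by simp
    then show "x \<in> (\<Union>a\<in>UNIV. (\<lambda>x. a + x) -` U)" by blast
  qed
  obtain A where A: "finite A" "UNIV \<subseteq> (\<Union>a\<in>A. (\<lambda>x. a + x) -` U)"
    by (rule compactE_image[OF cpt op cov])
  have sets: "(\<lambda>x. a + x) -` U \<in> sets haar_measure" for a using op by (simp add: haar_sets)
  have "measure haar_measure ((\<lambda>x. a + x) -` U) = 0" for a
  proof -
    have "measure (distr haar_measure haar_measure (\<lambda>x. a + x)) U =
        measure haar_measure ((\<lambda>x. a + x) -` U \<inter> space haar_measure)"
      using U by (intro measure_distr haar_measurable_self continuous_intros) (simp add: haar_sets)
    then show ?thesis by (simp add: haar_translate haar_space U0)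
  qed
  then have "measure haar_measure (\<Union>a\<in>A. (\<lambda>x. a + x) -` U) \<le> 0"
    using finite_measure_subadditive_finite[OF A(1), of "\<lambda>a. (\<lambda>x. a + x) -` U"] sets by auto
  moreover have "(\<Union>a\<in>A. (\<lambda>x. a + x) -` U) = space haar_measure" using A(2) haar_space by auto
  ultimately show False using prob_space by simp
qed

lemma haar_integral_eq_0:
  fixes f :: "'a \<Rightarrow> real"
  assumes f: "continuous_on UNIV f" and f0: "\<And>x. f x \<ge> 0" and int: "integral\<^sup>L haar_measure f = 0"
  shows "f x = 0"
proof (rule ccontr)
  interpret prob_space "haar_measure :: 'a measure" by (rule haar_prob)
  assume "f x \<noteq> 0"
  with f0[of x] have pos: "f x > 0" by simp
  define U where "U = {y. f y > f x / 2}"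
  have "open U" unfolding U_def by (intro open_Collect_less continuous_intros f)
  moreover have "x \<in> U" using pos by (simp add: U_def)
  ultimately have m: "measure haar_measure U > 0" by (intro haar_open_pos) auto
  have Us: "U \<in> sets haar_measure" using \<open>open U\<close> by (simp add: haar_sets)
  have "integral\<^sup>L haar_measure (\<lambda>y. f x / 2 * indicator U y) \<le> integral\<^sup>L haar_measure f"
  proof (intro integral_mono haar_integrable[OF f] integrable_mult_right)
    show "integrable haar_measure (indicator U :: 'a \<Rightarrow> real)"
      using Us by (intro integrable_real_indicator) (auto simp: emeasure_eq_measure)
    show "f x / 2 * indicator U y \<le> f y" for y using f0[of y] by (auto simp: U_def indicator_def)
  qed
  moreover have "integral\<^sup>L haar_measure (\<lambda>y. f x / 2 * indicator U y) = f x / 2 * measure haar_measure U"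
    using Us sets.sets_into_space[OF Us] by (simp add: Int_absorb2)
  ultimately show False using m pos int by (simp add: mult_le_0_iff)
qed

subsection \<open>Iterated integrals of continuous functions\<close>

lemma uniform_in_parameter:
  fixes F :: "'a \<times> 'a \<Rightarrow> complex"
  assumes F: "continuous_on UNIV F" and e: "e > 0"
  obtains d where "d > 0" "\<And>x x' y. dist x x' < d \<Longrightarrow> cmod (F (x, y) - F (x', y)) < e"
proof -
  have "compact (UNIV :: ('a \<times> 'a) set)" using compact_Times[OF cpt cpt] by simp
  then have "uniformly_continuous_on UNIV F" by (rule compact_uniformly_continuous[OF F])
  then obtain d where d: "d > 0" "\<And>p q. dist p q < d \<Longrightarrow> dist (F p) (F q) < e"
    using e unfolding uniformly_continuous_on_def by (metis UNIV_I dist_commute)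
  show ?thesis
  proof (rule that[OF d(1)])
    fix x x' y :: 'a assume "dist x x' < d"
    then have "dist (x, y) (x', y) < d" by (simp add: dist_Pair_Pair)
    from d(2)[OF this] show "cmod (F (x, y) - F (x', y)) < e" by (simp add: dist_norm)
  qed
qed

lemma continuous_slice:
  fixes F :: "'a \<times> 'a \<Rightarrow> complex"
  assumes F: "continuous_on UNIV F"
  shows "continuous_on UNIV (\<lambda>y. F (x, y))" "continuous_on UNIV (\<lambda>x. F (x, y))"
  by (intro continuous_on_compose2[OF F] continuous_intros; simp)+

lemma haar_norm_le:
  fixes f :: "'a \<Rightarrow> complex"
  assumes "continuous_on UNIV f" "\<And>x. cmod (f x) \<le> e"
  shows "cmod (integral\<^sup>L haar_measure f) \<le> e"
proof -
  have "cmod (integral\<^sup>L haar_measure f) \<le> integral\<^sup>L haar_measure (\<lambda>x. cmod (f x))" by simp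
  also have "\<dots> \<le> integral\<^sup>L haar_measure (\<lambda>x::'a. e)"
    using assms by (intro integral_mono haar_integrable continuous_intros) auto
  also have "\<dots> = e" by (rule haar_const)
  finally show ?thesis .
qed

lemma haar_diff_le:
  fixes f g :: "'a \<Rightarrow> complex"
  assumes "continuous_on UNIV f" "continuous_on UNIV g" "\<And>x. cmod (f x - g x) \<le> e"
  shows "cmod (integral\<^sup>L haar_measure f - integral\<^sup>L haar_measure g) \<le> e"
proof -
  have "integral\<^sup>L haar_measure f - integral\<^sup>L haar_measure g = integral\<^sup>L haar_measure (\<lambda>x. f x - g x)"
    using assms by (intro Bochner_Integration.integral_diff[symmetric] haar_integrable)
  then show ?thesis using assms by (auto intro!: haar_norm_le continuous_intros)
qed

lemma continuous_partial_integral: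
  fixes F :: "'a \<times> 'a \<Rightarrow> complex"
  assumes F: "continuous_on UNIV F"
  shows "continuous_on UNIV (\<lambda>x. integral\<^sup>L haar_measure (\<lambda>y. F (x, y)))"
  unfolding continuous_on_iff
proof (intro ballI allI impI)
  fix x :: 'a and e :: real assume e: "e > 0"
  obtain d where d: "d > 0" "\<And>x x' y. dist x x' < d \<Longrightarrow> cmod (F (x, y) - F (x', y)) < e / 2"
    using uniform_in_parameter[OF F, of "e / 2"] e by auto
  have "dist (integral\<^sup>L haar_measure (\<lambda>y. F (x', y))) (integral\<^sup>L haar_measure (\<lambda>y. F (x, y))) < e"
    if "dist x' x < d" for x'
  proof -
    have "dist (integral\<^sup>L haar_measure (\<lambda>y. F (x', y))) (integral\<^sup>L haar_measure (\<lambda>y. F (x, y))) \<le> e / 2"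
      unfolding dist_norm using d(2)[OF that] by (intro haar_diff_le continuous_slice F) (simp add: less_imp_le)
    also have "\<dots> < e" using e by simp
    finally show ?thesis .
  qed
  then show "\<exists>d>0. \<forall>x'\<in>UNIV. dist x' x < d \<longrightarrow>
      dist (integral\<^sup>L haar_measure (\<lambda>y. F (x', y))) (integral\<^sup>L haar_measure (\<lambda>y. F (x, y))) < e"
    using d(1) by blast
qed

text \<open>\<open>F\<close> is uniformly within \<open>e\<close> of a finite sum of products
  \<open>p c x * F (c, y)\<close>, where \<open>p\<close> is a partition of unity on balls of radius
  \<open>d\<close>. For such sums the exchange is mere linearity.\<close>

lemma haar_Fubini:
  fixes F :: "'a \<times> 'a \<Rightarrow> complex"
  assumes F: "continuous_on UNIV F"
  shows "integral\<^sup>L haar_measure (\<lambda>x. integral\<^sup>L haar_measure (\<lambda>y. F (x, y))) =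
         integral\<^sup>L haar_measure (\<lambda>y. integral\<^sup>L haar_measure (\<lambda>x. F (x, y)))"
    (is "?L = ?R")
proof -
  have *: "cmod (?L - ?R) \<le> 2 * e" if e: "e > 0" for e
  proof -
    obtain d where d: "d > 0" "\<And>x x' y. dist x x' < d \<Longrightarrow> cmod (F (x, y) - F (x', y)) < e"
      using uniform_in_parameter[OF F e] by auto
    have "UNIV \<subseteq> (\<Union>c\<in>UNIV. ball (c :: 'a) d)" using d(1) by auto
    then obtain C where C: "finite C" "UNIV \<subseteq> (\<Union>c\<in>C. ball (c :: 'a) d)"
      using compactE_image[OF cpt, of UNIV "\<lambda>c. ball c d"] by (metis open_ball)
    define w where "w c x = max 0 (d - dist c x)" for c x :: 'a
    define s where "s x = (\<Sum>c\<in>C. w c x)" for x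
    have s: "s x > 0" for x
    proof -
      obtain c where "c \<in> C" "dist c x < d" using C(2) by (auto simp: ball_def)
      then show ?thesis unfolding s_def using C(1) by (intro sum_pos2[of C c]) (auto simp: w_def)
    qed
    define p where "p c x = complex_of_real (w c x / s x)" for c x
    have pc: "continuous_on UNIV (p c)" for c
      unfolding p_def s_def w_def
      using s by (intro continuous_intros) (auto simp: s_def w_def less_le)
    define G where "G x y = (\<Sum>c\<in>C. p c x * F (c, y))" for x y
    have close: "cmod (F (x, y) - G x y) \<le> e" for x y
    proof -
      have sum1: "(\<Sum>c\<in>C. w c x / s x) = 1"
        using s[of x] by (simp add: s_def flip: sum_divide_distrib)
      then have "(\<Sum>c\<in>C. p c x) = 1" unfolding p_def by (metis of_real_1 of_real_sum)
      then have "F (x, y) - G x y = (\<Sum>c\<in>C. p c x * (F (x, y) - F (c, y)))"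
        by (simp add: G_def right_diff_distrib sum_subtractf flip: sum_distrib_right)
      also have "cmod \<dots> \<le> (\<Sum>c\<in>C. (w c x / s x) * e)"
      proof (rule sum_norm_le)
        fix c assume "c \<in> C"
        have "cmod (p c x) = w c x / s x"
          using s[of x] by (simp add: p_def w_def norm_divide)
        moreover have "w c x / s x * cmod (F (x, y) - F (c, y)) \<le> w c x / s x * e"
        proof (cases "dist c x < d")
          case True
          then show ?thesis using d(2)[of x c y] s[of x] by (intro mult_left_mono) (auto simp: dist_commute w_def)
        qed (simp add: w_def)
        ultimately show "cmod (p c x * (F (x, y) - F (c, y))) \<le> w c x / s x * e"
          by (simp add: norm_mult)
      qed
      also have "\<dots> = e" using sum1 by (metis sum_distrib_right mult_1)
      finally show ?thesis .
    qed
    have Fs: "continuous_on UNIV (\<lambda>y. F (x, y))" "continuous_on UNIV (\<lambda>x. F (x, y))" for x y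
      using continuous_slice[OF F] by auto
    have swp: "continuous_on UNIV (\<lambda>q :: 'a \<times> 'a. F (snd q, fst q))"
      by (intro continuous_on_compose2[OF F] continuous_intros) auto
    have Gx: "integral\<^sup>L haar_measure (\<lambda>y. G x y) = (\<Sum>c\<in>C. p c x * integral\<^sup>L haar_measure (\<lambda>y. F (c, y)))" for x
      unfolding G_def using haar_integrable[OF Fs(1)] by simp
    have Gy: "integral\<^sup>L haar_measure (\<lambda>x. G x y) = (\<Sum>c\<in>C. integral\<^sup>L haar_measure (p c) * F (c, y))" for y
      unfolding G_def using haar_integrable[OF pc] by simp
    have LG: "integral\<^sup>L haar_measure (\<lambda>x. integral\<^sup>L haar_measure (\<lambda>y. G x y)) =
        (\<Sum>c\<in>C. integral\<^sup>L haar_measure (p c) * integral\<^sup>L haar_measure (\<lambda>y. F (c, y)))"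
      unfolding Gx using haar_integrable[OF pc] by simp
    have RG: "integral\<^sup>L haar_measure (\<lambda>y. integral\<^sup>L haar_measure (\<lambda>x. G x y)) =
        (\<Sum>c\<in>C. integral\<^sup>L haar_measure (p c) * integral\<^sup>L haar_measure (\<lambda>y. F (c, y)))"
      unfolding Gy using haar_integrable[OF Fs(1)] by simp
    have Gc: "continuous_on UNIV (G x)" "continuous_on UNIV (\<lambda>x. G x y)" for x y
      unfolding G_def by (intro continuous_intros Fs pc)+
    have 1: "cmod (?L - integral\<^sup>L haar_measure (\<lambda>x. integral\<^sup>L haar_measure (\<lambda>y. G x y))) \<le> e"
    proof (rule haar_diff_le)
      show "continuous_on UNIV (\<lambda>x. integral\<^sup>L haar_measure (\<lambda>y. G x y))"
        unfolding Gx by (intro continuous_intros pc)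
    qed (intro continuous_partial_integral F haar_diff_le Fs Gc close)+
    have 2: "cmod (?R - integral\<^sup>L haar_measure (\<lambda>y. integral\<^sup>L haar_measure (\<lambda>x. G x y))) \<le> e"
    proof (rule haar_diff_le)
      show "continuous_on UNIV (\<lambda>y. integral\<^sup>L haar_measure (\<lambda>x. F (x, y)))"
        using continuous_partial_integral[OF swp] by simp
      show "continuous_on UNIV (\<lambda>y. integral\<^sup>L haar_measure (\<lambda>x. G x y))"
        unfolding Gy by (intro continuous_intros Fs)
    qed (intro haar_diff_le Fs Gc close)
    have "?L - ?R = (?L - integral\<^sup>L haar_measure (\<lambda>x. integral\<^sup>L haar_measure (\<lambda>y. G x y)))
        - (?R - integral\<^sup>L haar_measure (\<lambda>y. integral\<^sup>L haar_measure (\<lambda>x. G x y)))"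
      unfolding LG RG by simp
    also have "cmod \<dots> \<le> e + e" by (rule order_trans[OF norm_triangle_ineq4 add_mono[OF 1 2]])
    finally show ?thesis by simp
  qed
  have "cmod (?L - ?R) \<le> 0"
  proof (rule field_le_epsilon)
    fix e :: real assume "e > 0"
    with * [of "e / 2"] show "cmod (?L - ?R) \<le> 0 + e" by simp
  qed
  then show ?thesis by simp
qed

subsection \<open>The convolution algebra\<close>

lemma conv_integrand_continuous:
  fixes f g :: "'a \<Rightarrow> complex"
  assumes f: "continuous_on UNIV f" and g: "continuous_on UNIV g"
  shows "continuous_on UNIV (\<lambda>y. f (x - y) * g y)"
  by (intro continuous_intros continuous_on_compose2[OF f] g) auto

lemma conv_continuous:
  fixes f g :: "'a \<Rightarrow> complex"
  assumes f: "continuous_on UNIV f" and g: "continuous_on UNIV g"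
  shows "continuous_on UNIV (conv f g)"
proof -
  have "continuous_on UNIV (\<lambda>q :: 'a \<times> 'a. f (fst q - snd q) * g (snd q))"
    by (intro continuous_intros continuous_on_compose2[OF f] continuous_on_compose2[OF g]) auto
  from continuous_partial_integral[OF this] show ?thesis unfolding conv_def[abs_def] by simp
qed

lemma conv_commute:
  fixes f g :: "'a \<Rightarrow> complex"
  assumes f: "continuous_on UNIV f" and g: "continuous_on UNIV g"
  shows "conv f g = conv g f"
proof
  fix x
  show "conv f g x = conv g f x"
    using haar_reflect[OF conv_integrand_continuous[OF f g, of x], of x]
    by (simp add: conv_def mult.commute)
qed

lemma conv_assoc:
  fixes f g h :: "'a \<Rightarrow> complex"
  assumes f: "continuous_on UNIV f" and g: "continuous_on UNIV g" and h: "continuous_on UNIV h"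
  shows "conv (conv f g) h = conv f (conv g h)"
proof
  fix x
  have F: "continuous_on UNIV (\<lambda>q :: 'a \<times> 'a. f (x - fst q) * (g (fst q - snd q) * h (snd q)))"
    by (intro continuous_intros continuous_on_compose2[OF f] continuous_on_compose2[OF g]
        continuous_on_compose2[OF h]) auto
  have "conv f (conv g h) x = integral\<^sup>L haar_measure (\<lambda>y. integral\<^sup>L haar_measure (\<lambda>z. f (x - y) * (g (y - z) * h z)))"
    unfolding conv_def by simp
  also have "\<dots> = integral\<^sup>L haar_measure (\<lambda>z. integral\<^sup>L haar_measure (\<lambda>y. f (x - y) * (g (y - z) * h z)))"
    using haar_Fubini[OF F] by simp
  also have "\<dots> = integral\<^sup>L haar_measure (\<lambda>z. conv f g (x - z) * h z)"
  proof (intro Bochner_Integration.integral_cong refl)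
    fix z
    have "integral\<^sup>L haar_measure (\<lambda>y. f (x - y) * (g (y - z) * h z)) =
        integral\<^sup>L haar_measure (\<lambda>y. f (x - y) * g (y - z)) * h z"
      by (simp add: mult.assoc[symmetric])
    also have "integral\<^sup>L haar_measure (\<lambda>y. f (x - y) * g (y - z)) =
        integral\<^sup>L haar_measure (\<lambda>y. f (x - (y + z)) * g (y + z - z))"
      by (rule haar_shift[symmetric]) (intro continuous_intros continuous_on_compose2[OF f] continuous_on_compose2[OF g]; simp)
    also have "\<dots> = conv f g (x - z)" by (simp add: conv_def algebra_simps)
    finally show "integral\<^sup>L haar_measure (\<lambda>y. f (x - y) * (g (y - z) * h z)) = conv f g (x - z) * h z" .
  qed
  finally show "conv (conv f g) h x = conv f (conv g h) x" by (simp add: conv_def)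
qed

lemma conv_linear_right:
  fixes f g h :: "'a \<Rightarrow> complex"
  assumes f: "continuous_on UNIV f" and g: "continuous_on UNIV g" and h: "continuous_on UNIV h"
  shows "conv f (\<lambda>x. a * g x + b * h x) x = a * conv f g x + b * conv f h x"
proof -
  have "f (x - y) * (a * g y + b * h y) = a * (f (x - y) * g y) + b * (f (x - y) * h y)" for y
    by (simp add: algebra_simps)
  then show ?thesis unfolding conv_def
    using haar_integrable[OF conv_integrand_continuous[OF f g, of x]] haar_integrable[OF conv_integrand_continuous[OF f h, of x]]
    by simp
qed

lemma conv_linear_left:
  fixes f g h :: "'a \<Rightarrow> complex"
  assumes f: "continuous_on UNIV f" and g: "continuous_on UNIV g" and h: "continuous_on UNIV h"
  shows "conv (\<lambda>x. a * g x + b * h x) f x = a * conv g f x + b * conv h f x"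
proof -
  have "conv (\<lambda>x. a * g x + b * h x) f = conv f (\<lambda>x. a * g x + b * h x)"
    by (intro conv_commute continuous_intros f g h)
  then show ?thesis
    by (simp add: conv_linear_right[OF f g h] conv_commute[OF f g] conv_commute[OF f h])
qed

lemma conv_scale_left:
  fixes f g :: "'a \<Rightarrow> complex"
  shows "conv (\<lambda>x. a * g x) f x = a * conv g f x"
  unfolding conv_def by (simp add: mult.assoc)

lemma conv_scale_right:
  fixes f g :: "'a \<Rightarrow> complex"
  shows "conv f (\<lambda>x. a * g x) x = a * conv f g x"
  unfolding conv_def by (simp add: mult.left_commute)

lemma conv_translate: "conv (\<lambda>x. f (x + a)) g x = conv f g (x + a)" for f :: "'a \<Rightarrow> complex"
  unfolding conv_def by (simp add: algebra_simps)

lemma sqnorm_nonneg: "sqnorm f \<ge> 0" for f :: "'a \<Rightarrow> complex"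
  unfolding sqnorm_def by simp

lemma sqnorm_eq_0:
  fixes f :: "'a \<Rightarrow> complex"
  assumes "continuous_on UNIV f" "sqnorm f = 0"
  shows "f x = 0"
proof -
  have "(cmod (f x))\<^sup>2 = 0"
    using assms unfolding sqnorm_def
    by (intro haar_integral_eq_0[where f = "\<lambda>x. (cmod (f x))\<^sup>2"] continuous_intros) auto
  then show ?thesis by simp
qed

lemma real_Cauchy_Schwarz:
  fixes a b :: "'a \<Rightarrow> real"
  assumes a: "continuous_on UNIV a" and b: "continuous_on UNIV b"
  shows "(integral\<^sup>L haar_measure (\<lambda>x. a x * b x))\<^sup>2 \<le>
    integral\<^sup>L haar_measure (\<lambda>x. (a x)\<^sup>2) * integral\<^sup>L haar_measure (\<lambda>x. (b x)\<^sup>2)"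
proof -
  define A B C where "A = integral\<^sup>L haar_measure (\<lambda>x. (a x)\<^sup>2)"
    and "B = integral\<^sup>L haar_measure (\<lambda>x. (b x)\<^sup>2)" and "C = integral\<^sup>L haar_measure (\<lambda>x. a x * b x)"
  have i: "integrable haar_measure (\<lambda>x. (a x)\<^sup>2)" "integrable haar_measure (\<lambda>x. (b x)\<^sup>2)"
     "integrable haar_measure (\<lambda>x. a x * b x)"
    by (intro haar_integrable continuous_intros a b)+
  have B0: "B \<ge> 0" unfolding B_def by simp
  show ?thesis
  proof (cases "B = 0")
    case True
    then have "(b x)\<^sup>2 = 0" for x
      unfolding B_def by (intro haar_integral_eq_0[where f = "\<lambda>x. (b x)\<^sup>2"] continuous_intros b) auto
    then show ?thesis by simp
  next
    case False
    have "0 \<le> integral\<^sup>L haar_measure (\<lambda>x. (B * a x - C * b x)\<^sup>2)" by simp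
    also have "(\<lambda>x. (B * a x - C * b x)\<^sup>2) = (\<lambda>x. B\<^sup>2 * (a x)\<^sup>2 - 2 * B * C * (a x * b x) + C\<^sup>2 * (b x)\<^sup>2)"
      by (auto simp: power2_eq_square algebra_simps)
    also have "integral\<^sup>L haar_measure \<dots> = B\<^sup>2 * A - 2 * B * C * C + C\<^sup>2 * B"
      using i by (simp add: A_def B_def C_def)
    also have "\<dots> = B * (A * B - C\<^sup>2)" by (simp add: power2_eq_square algebra_simps)
    finally have "A * B - C\<^sup>2 \<ge> 0" using B0 False by (simp add: zero_le_mult_iff)
    then show ?thesis by (simp add: A_def B_def C_def)
  qed
qed

lemma Cauchy_Schwarz:
  fixes f g :: "'a \<Rightarrow> complex"
  assumes f: "continuous_on UNIV f" and g: "continuous_on UNIV g"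
  shows "(cmod (integral\<^sup>L haar_measure (\<lambda>x. f x * g x)))\<^sup>2 \<le> sqnorm f * sqnorm g"
proof -
  have "cmod (integral\<^sup>L haar_measure (\<lambda>x. f x * g x)) \<le> integral\<^sup>L haar_measure (\<lambda>x. cmod (f x * g x))" by simp
  also have "\<dots> = integral\<^sup>L haar_measure (\<lambda>x. cmod (f x) * cmod (g x))" by (simp add: norm_mult)
  finally have "(cmod (integral\<^sup>L haar_measure (\<lambda>x. f x * g x)))\<^sup>2 \<le>
      (integral\<^sup>L haar_measure (\<lambda>x. cmod (f x) * cmod (g x)))\<^sup>2" by (intro power_mono) auto
  also have "\<dots> \<le> sqnorm f * sqnorm g"
    unfolding sqnorm_def by (intro real_Cauchy_Schwarz continuous_intros f g)
  finally show ?thesis .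
qed

text \<open>One convolution turns control in the square norm into uniform control. This is how
  square norm Cauchy sequences will acquire continuous limits.\<close>

lemma conv_bound:
  fixes f g :: "'a \<Rightarrow> complex"
  assumes f: "continuous_on UNIV f" and g: "continuous_on UNIV g"
  shows "(cmod (conv f g x))\<^sup>2 \<le> sqnorm f * sqnorm g"
proof -
  have fx: "continuous_on UNIV (\<lambda>y. f (x - y))" by (intro continuous_on_compose2[OF f] continuous_intros) auto
  have "sqnorm (\<lambda>y. f (x - y)) = sqnorm f"
    unfolding sqnorm_def by (rule haar_reflect[where f = "\<lambda>x. (cmod (f x))\<^sup>2"]) (intro continuous_intros f)
  with Cauchy_Schwarz[OF fx g] show ?thesis by (simp add: conv_def)
qed

lemma sqnorm_conv_le:
  fixes f g :: "'a \<Rightarrow> complex"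
  assumes f: "continuous_on UNIV f" and g: "continuous_on UNIV g"
  shows "sqnorm (conv f g) \<le> sqnorm f * sqnorm g"
proof -
  have "sqnorm (conv f g) \<le> integral\<^sup>L haar_measure (\<lambda>x::'a. sqnorm f * sqnorm g)"
    unfolding sqnorm_def[of "conv f g"] using conv_bound[OF f g]
    by (intro integral_mono haar_integrable continuous_intros conv_continuous f g) auto
  then show ?thesis by (simp only: haar_const)
qed

text \<open>For a Hermitian function the value at 0 is an inner product, so inner products of
  convolution powers are themselves values of powers.\<close>

lemma conv_hermitian_0:
  fixes f g :: "'a \<Rightarrow> complex"
  assumes "hermitian f"
  shows "conv f g 0 = integral\<^sup>L haar_measure (\<lambda>y. cnj (f y) * g y)"
  using assms by (simp add: conv_def hermitian_def)

lemma conv_hermitian_self_0: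
  fixes f :: "'a \<Rightarrow> complex"
  assumes "hermitian f"
  shows "conv f f 0 = complex_of_real (sqnorm f)"
proof -
  have "cnj (f y) * f y = complex_of_real ((cmod (f y))\<^sup>2)" for y
    by (metis complex_norm_square mult.commute)
  then show ?thesis unfolding conv_hermitian_0[OF assms] sqnorm_def by (simp only: integral_complex_of_real)
qed

lemma hermitian_conv:
  fixes f g :: "'a \<Rightarrow> complex"
  assumes f: "continuous_on UNIV f" "hermitian f" and g: "continuous_on UNIV g" "hermitian g"
  shows "hermitian (conv f g)"
  unfolding hermitian_def
proof
  fix x
  have "cnj (conv f g x) = integral\<^sup>L haar_measure (\<lambda>y. cnj (f (x - y) * g y))"
    by (simp only: conv_def Bochner_Integration.integral_cnj)
  also have "\<dots> = integral\<^sup>L haar_measure (\<lambda>y. f (- x - (0 - y)) * g (0 - y))"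
  proof (intro Bochner_Integration.integral_cong refl)
    fix y
    have "f (- x - (0 - y)) = cnj (f (x - y))"
      using f(2)[unfolded hermitian_def, rule_format, of "x - y"] by (simp add: algebra_simps)
    moreover have "g (0 - y) = cnj (g y)" using g(2) by (simp add: hermitian_def)
    ultimately show "cnj (f (x - y) * g y) = f (- x - (0 - y)) * g (0 - y)" by simp
  qed
  also have "\<dots> = conv f g (- x)"
    unfolding conv_def by (rule haar_reflect) (rule conv_integrand_continuous[OF f(1) g(1)])
  finally show "conv f g (- x) = cnj (conv f g x)" by simp
qed

end

subsection \<open>Spectral idempotents\<close>

text \<open>Index \<open>n\<close> stands for the power of order \<open>n + 1\<close>, since in
  general no continuous function is a unit for convolution. Hence the \<open>Suc\<close> in the law
  of exponents, and \<open>Suc (2 * n)\<close> for the even powers.\<close>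

primrec conv_pow :: "('a::topological_ab_group_add \<Rightarrow> complex) \<Rightarrow> nat \<Rightarrow> 'a \<Rightarrow> complex" where
  "conv_pow k 0 = k"
| "conv_pow k (Suc n) = conv k (conv_pow k n)"

context
  fixes ty :: "'a::{topological_ab_group_add, metric_space} itself"
  assumes cpt: "compact (UNIV :: 'a set)"
begin

lemma conv_dominated:
  fixes f g :: "nat \<Rightarrow> 'a \<Rightarrow> complex"
  assumes "\<And>n. continuous_on UNIV (f n)" "\<And>n. continuous_on UNIV (g n)"
    "continuous_on UNIV f'" "continuous_on UNIV g'"
    "\<And>n x. cmod (f n x) \<le> B" "\<And>n x. cmod (g n x) \<le> B"
    "\<And>x. (\<lambda>n. f n x) \<longlonglongrightarrow> f' x" "\<And>x. (\<lambda>n. g n x) \<longlonglongrightarrow> g' x"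
  shows "(\<lambda>n. conv (f n) (g n) x) \<longlonglongrightarrow> conv f' g' x"
  unfolding conv_def
proof (rule integral_dominated_convergence[where w = "\<lambda>_. B * B"])
  interpret prob_space "haar_measure :: 'a measure" by (rule haar_prob[OF cpt])
  show "(\<lambda>y. f' (x - y) * g' y) \<in> borel_measurable haar_measure"
    by (rule haar_measurable[OF cpt conv_integrand_continuous[OF cpt assms(3,4)]])
  show "(\<lambda>y. f n (x - y) * g n y) \<in> borel_measurable haar_measure" for n
    by (rule haar_measurable[OF cpt conv_integrand_continuous[OF cpt assms(1,2)]])
  show "integrable haar_measure (\<lambda>_::'a. B * B)" by simp
  show "AE y in haar_measure. (\<lambda>n. f n (x - y) * g n y) \<longlonglongrightarrow> f' (x - y) * g' y"
    by (intro AE_I2 tendsto_mult assms)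
  have "0 \<le> B" using assms(5)[of 0 0] norm_ge_zero order_trans by blast
  then show "AE y in haar_measure. norm (f n (x - y) * g n y) \<le> B * B" for n
    by (intro AE_I2) (auto simp: norm_mult intro!: mult_mono assms)
qed

context
  fixes k :: "'a \<Rightarrow> complex"
  assumes kc: "continuous_on UNIV k" and kh: "hermitian k" and k0: "k \<noteq> (\<lambda>x. 0)"
begin

private definition "t n = sqnorm (conv_pow k n)"

lemma conv_pow_continuous: "continuous_on UNIV (conv_pow k n)"
  by (induction n) (auto intro: kc conv_continuous[OF cpt])

lemma conv_pow_hermitian: "hermitian (conv_pow k n)"
  by (induction n) (auto intro: kh kc conv_pow_continuous hermitian_conv[OF cpt])

lemma conv_pow_add: "conv (conv_pow k m) (conv_pow k n) = conv_pow k (Suc (m + n))"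
proof (induction m)
  case (Suc m)
  then show ?case by (simp add: conv_assoc[OF cpt kc conv_pow_continuous conv_pow_continuous])
qed simp

private lemma conv_pow_0: "conv_pow k (Suc (2 * n)) 0 = complex_of_real (t n)"
  using conv_hermitian_self_0[OF cpt conv_pow_hermitian[of n]] by (simp add: conv_pow_add t_def mult_2)

private lemma inner: "integral\<^sup>L haar_measure (\<lambda>y. cnj (conv_pow k m y) * conv_pow k n y) = complex_of_real (t j)"
  if "m + n = 2 * j"
  using conv_hermitian_0[OF cpt conv_pow_hermitian[of m], of "conv_pow k n"]
  unfolding conv_pow_add that conv_pow_0 by simp

text \<open>Cauchy-Schwarz for two powers whose inner product is the square norm of the power
  between them. It makes the ratios \<open>r\<close> increase.\<close>

private lemma t_convex: "(t (Suc n))\<^sup>2 \<le> t n * t (Suc (Suc n))"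
proof -
  have c: "continuous_on UNIV (\<lambda>y. cnj (conv_pow k n y))" by (intro continuous_intros conv_pow_continuous)
  have "sqnorm (\<lambda>y. cnj (conv_pow k n y)) = t n" by (simp add: t_def sqnorm_def)
  moreover have "(cmod (integral\<^sup>L haar_measure (\<lambda>y. cnj (conv_pow k n y) * conv_pow k (Suc (Suc n)) y)))\<^sup>2
      \<le> sqnorm (\<lambda>y. cnj (conv_pow k n y)) * sqnorm (conv_pow k (Suc (Suc n)))"
    by (rule Cauchy_Schwarz[OF cpt c conv_pow_continuous])
  moreover have "integral\<^sup>L haar_measure (\<lambda>y. cnj (conv_pow k n y) * conv_pow k (Suc (Suc n)) y) = complex_of_real (t (Suc n))"
    by (rule inner) simp
  ultimately show ?thesis by (simp add: t_def)
qed

private lemma t_submult: "t (Suc (m + n)) \<le> t m * t n"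
  using sqnorm_conv_le[OF cpt conv_pow_continuous conv_pow_continuous, of m n] by (simp add: conv_pow_add t_def)

text \<open>The value of \<open>conv k k\<close> at 0 is \<open>t 0\<close>, which gives
  \<open>t 1 > 0\<close>; log-convexity carries positivity on from there.\<close>

private lemma t_pos: "t n > 0"
proof -
  have nn: "t n \<ge> 0" for n unfolding t_def by (rule sqnorm_nonneg[OF cpt])
  have z: "conv_pow k n x = 0" if "t n = 0" for n x
    using sqnorm_eq_0[OF cpt conv_pow_continuous] that by (simp add: t_def)
  have t0: "t 0 > 0"
    using nn[of 0] z[of 0] k0 by (auto simp: less_le)
  have "conv_pow k 1 0 \<noteq> 0" using conv_pow_0[of 0] t0 by simp
  then have t1: "t 1 > 0" using nn[of 1] z[of 1] by (auto simp: less_le)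
  have "t n > 0 \<and> t (Suc n) > 0"
  proof (induction n)
    case (Suc n)
    then have "0 < t n * t (Suc (Suc n))" using t_convex[of n] by (smt (verit) zero_less_power)
    then show ?case using Suc by (simp add: zero_less_mult_iff)
  qed (use t0 t1 in simp)
  then show ?thesis by simp
qed

private definition "r n = t (Suc n) / t n"

private lemma r_pos: "r n > 0" unfolding r_def using t_pos by simp

private lemma r_mono: "m \<le> n \<Longrightarrow> r m \<le> r n"
proof (rule lift_Suc_mono_le[of r])
  show "r n \<le> r (Suc n)" for n
    using t_convex[of n] t_pos[of n] t_pos[of "Suc n"] by (simp add: r_def field_simps power2_eq_square)
qed

private lemma r_le: "r n \<le> t 0"
  using t_submult[of n 0] t_pos[of n] by (simp add: r_def field_simps)

text \<open>The limit of the increasing ratios; it turns out to be an eigenvalue of convolution by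
  \<open>conv k k\<close>.\<close>

private definition "\<Lambda> = (SUP n. r n)"

private lemma r_le_\<Lambda>: "r n \<le> \<Lambda>"
  unfolding \<Lambda>_def by (intro cSUP_upper bdd_aboveI[of _ "t 0"]) (auto simp: r_le)

private lemma \<Lambda>_pos: "\<Lambda> > 0"
  using r_pos[of 0] r_le_\<Lambda>[of 0] by linarith

text \<open>Since the ratios increase, \<open>t m * r m ^ Suc n\<close> is at most
  \<open>t (m + Suc n)\<close>, which submultiplicativity bounds by \<open>t m * t n\<close>.
  Cancelling \<open>t m\<close> leaves a bound without constants, and in the limit this keeps the
  normalised powers from tending to 0.\<close>

private lemma t_ge_r: "(r m) ^ Suc n \<le> t n"
proof -
  have "t m * r m ^ n \<le> t (m + n)" for n
  proof (induction n)
    case (Suc n)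
    have "t m * r m ^ Suc n = (t m * r m ^ n) * r m" by simp
    also have "\<dots> \<le> t (m + n) * r (m + n)"
      using Suc r_pos[of m] t_pos[of "m + n"] by (intro mult_mono r_mono) auto
    also have "\<dots> = t (m + Suc n)" using t_pos[of "m + n"] by (simp add: r_def)
    finally show ?case .
  qed simp
  from this[of "Suc n"] have "t m * r m ^ Suc n \<le> t m * t n"
    using t_submult[of m n] by simp
  then show ?thesis using t_pos[of m] by simp
qed

private lemma t_ge: "\<Lambda> ^ Suc n \<le> t n"
proof -
  have "r \<longlonglongrightarrow> \<Lambda>"
    unfolding \<Lambda>_def by (intro LIMSEQ_incseq_SUP bdd_aboveI[of _ "t 0"]) (auto simp: r_le incseq_def r_mono)
  then have "(\<lambda>m. r m ^ Suc n) \<longlonglongrightarrow> \<Lambda> ^ Suc n" by (intro tendsto_intros)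
  then show ?thesis by (rule LIMSEQ_le_const2) (use t_ge_r in blast)
qed

private definition "c n = t n / \<Lambda> ^ Suc n"

private lemma c_ge_1: "c n \<ge> 1"
  using t_ge[of n] \<Lambda>_pos unfolding c_def by (simp add: le_divide_eq_1)

private lemma c_decseq: "decseq c"
proof (rule decseq_SucI)
  fix n
  have "t (Suc n) \<le> \<Lambda> * t n" using r_le_\<Lambda>[of n] t_pos[of n] by (simp add: r_def field_simps)
  then have "t (Suc n) / \<Lambda> ^ Suc (Suc n) \<le> \<Lambda> * t n / \<Lambda> ^ Suc (Suc n)"
    using \<Lambda>_pos by (intro divide_right_mono) auto
  then show "c (Suc n) \<le> c n" using \<Lambda>_pos by (simp add: c_def)
qed

text \<open>The power of order \<open>n + 1\<close> of \<open>conv k k\<close>, normalised by the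
  eigenvalue \<open>\<Lambda>\<close>.\<close>

private definition "L n x = complex_of_real (1 / \<Lambda> ^ Suc n) * conv_pow k (Suc (2 * n)) x"

private lemma L_continuous: "continuous_on UNIV (L n)"
  unfolding L_def by (intro continuous_intros conv_pow_continuous)

private lemma L_0: "L n 0 = complex_of_real (c n)"
  unfolding L_def conv_pow_0 by (simp add: c_def)

private lemma L_add: "conv (L m) (L n) x = L (Suc (m + n)) x"
proof -
  have "conv (L m) (L n) x = complex_of_real (1 / \<Lambda> ^ Suc m) * (complex_of_real (1 / \<Lambda> ^ Suc n) *
      conv (conv_pow k (Suc (2 * m))) (conv_pow k (Suc (2 * n))) x)"
    unfolding L_def[abs_def] by (simp only: conv_scale_left[OF cpt] conv_scale_right[OF cpt])
  also have "\<dots> = L (Suc (m + n)) x"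
    unfolding conv_pow_add by (simp add: L_def power_add)
  finally show ?thesis .
qed

private lemma L_Suc: "L (Suc n) x = complex_of_real (1 / \<Lambda>) * conv (conv k k) (L n) x"
proof -
  have "L (Suc n) x = complex_of_real (1 / \<Lambda>) *
      (complex_of_real (1 / \<Lambda> ^ Suc n) * conv (conv_pow k 1) (conv_pow k (Suc (2 * n))) x)"
    unfolding conv_pow_add by (simp add: L_def)
  also have "\<dots> = complex_of_real (1 / \<Lambda>) * conv (conv k k) (L n) x"
    unfolding L_def[abs_def] conv_scale_right[OF cpt] by simp
  finally show ?thesis .
qed

private lemma L_bound: "cmod (L n x) \<le> c 0"
proof -
  have "(cmod (conv (conv_pow k n) (conv_pow k n) x))\<^sup>2 \<le> (t n)\<^sup>2"
    using conv_bound[OF cpt conv_pow_continuous conv_pow_continuous, of n n x] by (simp add: t_def power2_eq_square)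
  then have "cmod (conv_pow k (Suc (2 * n)) x) \<le> t n"
    using t_pos[of n] by (auto dest!: power2_le_imp_le simp: conv_pow_add mult_2)
  then have "cmod (L n x) \<le> c n"
    using \<Lambda>_pos unfolding L_def c_def by (simp add: norm_mult norm_divide norm_power field_simps)
  also have "\<dots> \<le> c 0" using c_decseq by (simp add: decseq_def)
  finally show ?thesis .
qed

text \<open>Inner products of the \<open>L n\<close> depend only on the sum of the indices, so the
  squared distance is a combination of values of \<open>c\<close> whose coefficients add up to 0. It
  becomes small because \<open>c\<close> converges.\<close>

private lemma L_diff: "sqnorm (\<lambda>x. L m x - L n x) = c (Suc (2 * m)) + c (Suc (2 * n)) - 2 * c (Suc (m + n))"
proof -
  define a b where "a = 1 / \<Lambda> ^ Suc m" and "b = 1 / \<Lambda> ^ Suc n"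
  define P where "P = conv_pow k (Suc (2 * m))"
  define Q where "Q = conv_pow k (Suc (2 * n))"
  have Pc: "continuous_on UNIV P" and Qc: "continuous_on UNIV Q" unfolding P_def Q_def by (rule conv_pow_continuous)+
  have ii: "integral\<^sup>L haar_measure (\<lambda>y. cnj (P y) * P y) = t (Suc (2 * m))"
    "integral\<^sup>L haar_measure (\<lambda>y. cnj (Q y) * Q y) = t (Suc (2 * n))"
    "integral\<^sup>L haar_measure (\<lambda>y. cnj (P y) * Q y) = t (Suc (m + n))"
    "integral\<^sup>L haar_measure (\<lambda>y. cnj (Q y) * P y) = t (Suc (m + n))"
    unfolding P_def Q_def by (intro inner; simp)+
  have i: "integrable haar_measure (\<lambda>y. cnj (P y) * P y)" "integrable haar_measure (\<lambda>y. cnj (Q y) * Q y)"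
      "integrable haar_measure (\<lambda>y. cnj (P y) * Q y)" "integrable haar_measure (\<lambda>y. cnj (Q y) * P y)"
    by (intro haar_integrable[OF cpt] continuous_intros Pc Qc)+
  have gen: "integral\<^sup>L haar_measure (\<lambda>x. A * u1 x + B * u2 x - C * u3 x - C * u4 x) =
      A * integral\<^sup>L haar_measure u1 + B * integral\<^sup>L haar_measure u2
      - C * integral\<^sup>L haar_measure u3 - C * integral\<^sup>L haar_measure u4"
    if "integrable haar_measure u1" "integrable haar_measure u2" "integrable haar_measure u3" "integrable haar_measure u4"
    for A B C :: complex and u1 u2 u3 u4 :: "'a \<Rightarrow> complex"
    using that by simp
  have "complex_of_real (sqnorm (\<lambda>x. L m x - L n x)) =
      integral\<^sup>L haar_measure (\<lambda>x. cnj (L m x - L n x) * (L m x - L n x))"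
  proof -
    have "cnj z * z = complex_of_real ((cmod z)\<^sup>2)" for z by (metis complex_norm_square mult.commute)
    then show ?thesis unfolding sqnorm_def by (simp only: integral_complex_of_real)
  qed
  also have "(\<lambda>x. cnj (L m x - L n x) * (L m x - L n x)) = (\<lambda>x. of_real (a\<^sup>2) * (cnj (P x) * P x) + of_real (b\<^sup>2) * (cnj (Q x) * Q x)
      - of_real (a * b) * (cnj (P x) * Q x) - of_real (a * b) * (cnj (Q x) * P x))"
  proof
    fix x
    have L: "L m x = of_real a * P x" "L n x = of_real b * Q x"
      by (simp_all only: L_def P_def Q_def a_def b_def)
    show "cnj (L m x - L n x) * (L m x - L n x) = of_real (a\<^sup>2) * (cnj (P x) * P x) + of_real (b\<^sup>2) * (cnj (Q x) * Q x)
      - of_real (a * b) * (cnj (P x) * Q x) - of_real (a * b) * (cnj (Q x) * P x)"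
      unfolding L by (simp add: algebra_simps power2_eq_square)
  qed
  also have "integral\<^sup>L haar_measure \<dots> = of_real (a\<^sup>2 * t (Suc (2 * m)) + b\<^sup>2 * t (Suc (2 * n)) - 2 * (a * b) * t (Suc (m + n)))"
    using gen[OF i, of "of_real (a\<^sup>2)" "of_real (b\<^sup>2)" "of_real (a * b)"] unfolding ii
    by (simp add: algebra_simps)
  finally have "sqnorm (\<lambda>x. L m x - L n x) = a\<^sup>2 * t (Suc (2 * m)) + b\<^sup>2 * t (Suc (2 * n)) - 2 * (a * b) * t (Suc (m + n))"
    by (simp only: of_real_eq_iff)
  moreover have "a\<^sup>2 * t (Suc (2 * m)) = c (Suc (2 * m))" "b\<^sup>2 * t (Suc (2 * n)) = c (Suc (2 * n))"
    "(a * b) * t (Suc (m + n)) = c (Suc (m + n))"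
    by (simp_all add: a_def b_def c_def power2_eq_square power_add mult_2)
  ultimately show ?thesis by simp
qed

private lemma L_Cauchy:
  assumes "e > 0"
  shows "\<exists>N. \<forall>m\<ge>N. \<forall>n\<ge>N. \<forall>x. cmod (L (Suc m) x - L (Suc n) x) < e"
proof -
  have "convergent c"
    using c_decseq c_ge_1 by (intro Bseq_monoseq_convergent decseq_bounded) (auto simp: monoseq_iff)
  then obtain l where l: "c \<longlonglongrightarrow> l" by (auto simp: convergent_def)
  \<comment> \<open>Chosen so that the estimate from \<open>conv_bound\<close>,
    \<open>t 1 * d / \<Lambda>\<^sup>2\<close>, equals \<open>e\<^sup>2\<close>. The coefficients in
    \<open>L_diff\<close> have total size 4, so values of \<open>c\<close> within
    \<open>d / 5\<close> of \<open>l\<close> give less than \<open>d\<close>.\<close>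
  define d where "d = e\<^sup>2 * \<Lambda>\<^sup>2 / t 1"
  have d: "d > 0" using assms \<Lambda>_pos t_pos by (simp add: d_def)
  then obtain N where N: "\<And>n. n \<ge> N \<Longrightarrow> \<bar>c n - l\<bar> < d / 5"
    using LIMSEQ_D[OF l, of "d / 5"] by auto
  show ?thesis
  proof (intro exI[of _ N] allI impI)
    fix m n x assume mn: "m \<ge> N" "n \<ge> N"
    have s: "sqnorm (\<lambda>x. L m x - L n x) < d"
      unfolding L_diff using N[of "Suc (2 * m)"] N[of "Suc (2 * n)"] N[of "Suc (m + n)"] mn by linarith
    have "L (Suc m) x - L (Suc n) x = complex_of_real (1 / \<Lambda>) * conv (conv k k) (\<lambda>x. 1 * L m x + (- 1) * L n x) x"
      unfolding L_Suc conv_linear_right[OF cpt conv_continuous[OF cpt kc kc] L_continuous L_continuous]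
      by (simp add: diff_divide_distrib)
    then have "(cmod (L (Suc m) x - L (Suc n) x))\<^sup>2 = (1 / \<Lambda>)\<^sup>2 * (cmod (conv (conv k k) (\<lambda>x. 1 * L m x + (- 1) * L n x) x))\<^sup>2"
      using \<Lambda>_pos by (simp add: norm_mult norm_divide power_mult_distrib power_divide)
    also have "\<dots> \<le> (1 / \<Lambda>)\<^sup>2 * (sqnorm (conv k k) * sqnorm (\<lambda>x. 1 * L m x + (- 1) * L n x))"
      by (intro mult_left_mono conv_bound[OF cpt] conv_continuous[OF cpt] kc continuous_intros L_continuous) auto
    also have "sqnorm (conv k k) = t 1" by (simp add: t_def)
    also have "(\<lambda>x. 1 * L m x + (- 1) * L n x) = (\<lambda>x. L m x - L n x)" by auto
    also have "(1 / \<Lambda>)\<^sup>2 * (t 1 * sqnorm (\<lambda>x. L m x - L n x)) < (1 / \<Lambda>)\<^sup>2 * (t 1 * d)"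
      using s \<Lambda>_pos t_pos[of 1] by (intro mult_strict_left_mono) auto
    also have "\<dots> = e\<^sup>2" using \<Lambda>_pos t_pos[of 1] by (simp add: d_def power_divide)
    finally show "cmod (L (Suc m) x - L (Suc n) x) < e" using assms by (simp add: power2_less_imp_less)
  qed
qed

text \<open>The normalised even powers of \<open>k\<close> converge to the projection onto the
  eigenspace of the largest eigenvalue of convolution by \<open>k * k\<close>.\<close>

lemma spectral_idempotent:
  obtains p :: "'a \<Rightarrow> complex" and s :: real where
    "s > 0" "continuous_on UNIV p" "hermitian p" "conv p p = p" "p \<noteq> (\<lambda>x. 0)"
    "conv (conv k k) p = (\<lambda>x. s * p x)"
    "\<And>q. continuous_on UNIV q \<Longrightarrow> conv q k = k \<Longrightarrow> conv q p = p"
proof -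
  have "uniformly_Cauchy_on UNIV (\<lambda>n. L (Suc n))"
    unfolding uniformly_Cauchy_on_def dist_norm using L_Cauchy by blast
  then have "uniformly_convergent_on UNIV (\<lambda>n. L (Suc n))" by (rule Cauchy_uniformly_convergent)
  then obtain p where p: "uniform_limit UNIV (\<lambda>n. L (Suc n)) p sequentially"
    by (auto simp: uniformly_convergent_on_def)
  have pc: "continuous_on UNIV p"
    by (rule uniform_limit_theorem[OF _ p]) (auto simp: L_continuous)
  have lim': "(\<lambda>n. L (Suc n) x) \<longlonglongrightarrow> p x" for x by (rule tendsto_uniform_limitI[OF p]) simp
  then have lim: "(\<lambda>n. L n x) \<longlonglongrightarrow> p x" for x by (rule LIMSEQ_imp_Suc)
  have qlim: "(\<lambda>n. conv q (L n) x) \<longlonglongrightarrow> conv q p x" if q: "continuous_on UNIV q" for q x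
  proof -
    obtain D where D: "\<And>x. cmod (q x) \<le> D"
      using compact_imp_bounded[OF compact_continuous_image[OF q cpt]] by (auto simp: bounded_iff)
    show ?thesis
    proof (rule conv_dominated[where B = "max D (c 0)"])
      show "cmod (q x) \<le> max D (c 0)" for x using D[of x] by simp
      show "cmod (L n x) \<le> max D (c 0)" for n x using L_bound[of n x] by simp
    qed (auto intro: q pc lim L_continuous)
  qed
  show ?thesis
  proof (rule that[of \<Lambda> p])
    show "\<Lambda> > 0" by (rule \<Lambda>_pos)
    show "continuous_on UNIV p" by fact
    show "hermitian p"
      unfolding hermitian_def
    proof
      fix x
      have "L n (- x) = cnj (L n x)" for n
        using conv_pow_hermitian[of "Suc (2 * n)"] by (simp add: L_def hermitian_def)
      then have "(\<lambda>n. L n (- x)) \<longlonglongrightarrow> cnj (p x)" using tendsto_cnj[OF lim[of x]] by simp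
      then show "p (- x) = cnj (p x)" by (rule LIMSEQ_unique[OF lim])
    qed
    show "conv p p = p"
    proof
      fix x
      have "(\<lambda>n. conv (L n) (L n) x) \<longlonglongrightarrow> conv p p x"
        by (rule conv_dominated[where B = "c 0"]) (auto intro: L_continuous pc L_bound lim)
      moreover have "(\<lambda>n. L (Suc (n + n)) x) \<longlonglongrightarrow> p x"
        by (rule filterlim_compose[OF lim, of "\<lambda>n. Suc (n + n)"]) (auto intro!: filterlim_subseq simp: strict_mono_def)
      ultimately show "conv p p x = p x" unfolding L_add by (rule LIMSEQ_unique)
    qed
    \<comment> \<open>At 0 the approximants take the values \<open>c n\<close>, which are at least
      1.\<close>
    show "p \<noteq> (\<lambda>x. 0)"
    proof
      assume "p = (\<lambda>x. 0)"
      then have "(\<lambda>n. Re (L n 0)) \<longlonglongrightarrow> 0" using tendsto_Re[OF lim[of 0]] by simp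
      then have "(1::real) \<le> 0"
        by (rule LIMSEQ_le_const) (auto simp: L_0 c_ge_1)
      then show False by simp
    qed
    show "conv (conv k k) p = (\<lambda>x. \<Lambda> * p x)"
    proof
      fix x
      have "(\<lambda>n. conv (conv k k) (L n) x) \<longlonglongrightarrow> conv (conv k k) p x"
        by (rule qlim[OF conv_continuous[OF cpt kc kc]])
      moreover have "conv (conv k k) (L n) x = \<Lambda> * L (Suc n) x" for n
        using \<Lambda>_pos by (simp add: L_Suc)
      moreover have "(\<lambda>n. \<Lambda> * L (Suc n) x) \<longlonglongrightarrow> \<Lambda> * p x" by (intro tendsto_intros lim')
      ultimately show "conv (conv k k) p x = \<Lambda> * p x" using LIMSEQ_unique by simp
    qed
    \<comment> \<open>Whatever acts as the identity on \<open>k\<close> does so on its powers and on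
      their limit. This later places the spectral idempotent below a given one.\<close>
    show "conv q p = p" if q: "continuous_on UNIV q" "conv q k = k" for q
    proof
      fix x
      have "conv q (conv_pow k n) = conv_pow k n" for n
        using q by (cases n) (simp_all add: conv_assoc[OF cpt q(1) kc conv_pow_continuous, symmetric])
      note qk = this
      have "conv q (L n) x = L n x" for n
        unfolding L_def[abs_def] conv_scale_right[OF cpt] by (simp only: qk)
      then show "conv q p x = p x" using LIMSEQ_unique[OF qlim[OF q(1), of x]] lim[of x] by simp
    qed
  qed
qed

end

text \<open>For an idempotent, \<open>sqnorm p\<close> is the trace of the projection given by
  convolution with \<open>p\<close>, hence its rank. The bound 1 follows by integrating the
  pointwise estimate of \<open>p\<close>.\<close>

lemma idempotent_ge_1:
  fixes p :: "'a \<Rightarrow> complex"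
  assumes p: "continuous_on UNIV p" "hermitian p" "conv p p = p" "p \<noteq> (\<lambda>x. 0)"
  shows "p 0 = complex_of_real (sqnorm p)" "sqnorm p \<ge> 1"
proof -
  show p0: "p 0 = complex_of_real (sqnorm p)"
    using conv_hermitian_self_0[OF cpt p(2)] p(3) by simp
  have pos: "sqnorm p > 0"
    using sqnorm_nonneg[OF cpt, of p] sqnorm_eq_0[OF cpt p(1)] p(4) by (auto simp: less_le)
  have "(cmod (p x))\<^sup>2 \<le> (sqnorm p)\<^sup>2" for x
    using conv_bound[OF cpt p(1) p(1), of x] p(3) by (simp add: power2_eq_square)
  then have "sqnorm p \<le> integral\<^sup>L haar_measure (\<lambda>x::'a. (sqnorm p)\<^sup>2)"
    unfolding sqnorm_def[of p] using p(1)
    by (intro integral_mono haar_integrable[OF cpt] continuous_intros) (auto simp: sqnorm_def)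
  then have "sqnorm p \<le> (sqnorm p)\<^sup>2" by (simp only: haar_const[OF cpt])
  then show "sqnorm p \<ge> 1" using pos by (simp add: power2_eq_square)
qed

subsection \<open>Characters\<close>

text \<open>The square norm of a nonzero idempotent is at least 1 and is additive under
  \<open>p = q + (p - q)\<close>. So an idempotent whose square norm is within 1/2 of the infimum is
  already minimal: a proper splitting would leave a part of square norm below 1.\<close>

lemma minimal_idempotent:
  fixes p0 :: "'a \<Rightarrow> complex"
  assumes p0: "continuous_on UNIV p0" "hermitian p0" "conv p0 p0 = p0" "p0 \<noteq> (\<lambda>x. 0)"
  obtains p where "continuous_on UNIV p" "hermitian p" "conv p p = p" "p \<noteq> (\<lambda>x. 0)" "conv p p0 = p"
    "\<And>q. continuous_on UNIV q \<Longrightarrow> hermitian q \<Longrightarrow> conv q q = q \<Longrightarrow> q \<noteq> (\<lambda>x. 0) \<Longrightarrow> conv q p = q \<Longrightarrow> q = p"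
proof -
  define S where "S = {p. continuous_on UNIV p \<and> hermitian p \<and> conv p p = p \<and> p \<noteq> (\<lambda>x. 0) \<and> conv p p0 = p}"
  have p0S: "p0 \<in> S" using p0 by (simp add: S_def)
  have low: "sqnorm p \<ge> 1" if "p \<in> S" for p
    using that idempotent_ge_1(2) by (auto simp: S_def)
  define i where "i = (INF p\<in>S. sqnorm p)"
  have bdd: "bdd_below (sqnorm ` S)" using low by (intro bdd_belowI[of _ 1]) auto
  have "\<exists>p\<in>S. sqnorm p < i + 1 / 2"
    using cINF_less_iff[OF _ bdd, of "i + 1/2"] p0S unfolding i_def by auto
  then obtain p where p: "p \<in> S" "sqnorm p < i + 1 / 2" by blast
  have pS: "continuous_on UNIV p" "hermitian p" "conv p p = p" "p \<noteq> (\<lambda>x. 0)" "conv p p0 = p"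
    using p(1) by (auto simp: S_def)
  show ?thesis
  proof (rule that[OF pS])
    fix q assume q: "continuous_on UNIV q" "hermitian q" "conv q q = q" "q \<noteq> (\<lambda>x. 0)" "conv q p = q"
    show "q = p"
    proof (rule ccontr)
      assume ne: "q \<noteq> p"
      have qp0: "conv q p0 = q"
        using conv_assoc[OF cpt q(1) pS(1) p0(1)] q(5) pS(5) by simp
      have pq: "conv p q = q" using conv_commute[OF cpt pS(1) q(1)] q(5) by simp
      define d where "d = (\<lambda>x. 1 * p x + (- 1) * q x)"
      have dc: "continuous_on UNIV d" unfolding d_def by (intro continuous_intros pS q)
      have dl: "conv d f = (\<lambda>x. conv p f x - conv q f x)" if "continuous_on UNIV f" for f
        unfolding d_def by (rule ext) (simp only: conv_linear_left[OF cpt that pS(1) q(1)], simp)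
      have dr: "conv f d = (\<lambda>x. conv f p x - conv f q x)" if "continuous_on UNIV f" for f
        unfolding d_def by (rule ext) (simp only: conv_linear_right[OF cpt that pS(1) q(1)], simp)
      have "conv d d = d"
        unfolding dl[OF dc] dr[OF pS(1)] dr[OF q(1)] pS(3) q(3) q(5) pq by (auto simp: d_def)
      moreover have "conv d p0 = d"
        unfolding dl[OF p0(1)] pS(5) qp0 by (auto simp: d_def)
      moreover have "hermitian d" using pS(2) q(2) by (simp add: hermitian_def d_def)
      moreover have "d \<noteq> (\<lambda>x. 0)" using ne[symmetric] by (auto simp: d_def fun_eq_iff)
      ultimately have d: "d \<in> S" using dc by (simp add: S_def)
      have "q \<in> S" using q qp0 by (simp add: S_def)
      have "complex_of_real (sqnorm d) = complex_of_real (sqnorm p - sqnorm q)"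
        using idempotent_ge_1(1)[of d] idempotent_ge_1(1)[of p] idempotent_ge_1(1)[of q] d p(1) \<open>q \<in> S\<close>
        by (simp add: S_def) (simp add: d_def)
      then have "sqnorm d = sqnorm p - sqnorm q" by (simp only: of_real_eq_iff)
      moreover have "i \<le> sqnorm q" unfolding i_def using \<open>q \<in> S\<close> bdd by (intro cINF_lower) auto
      ultimately show False using low[OF d] p(2) by linarith
    qed
  qed
qed

text \<open>Below a minimal idempotent \<open>p\<close> the only Hermitian functions are real
  multiples of \<open>p\<close>. A translate of \<open>p\<close> is a combination of two such
  functions, hence a multiple of \<open>p\<close>; normalising at 0 then makes \<open>p\<close>
  multiplicative.\<close>

lemma idempotent_character:
  fixes p0 :: "'a \<Rightarrow> complex"
  assumes p0: "continuous_on UNIV p0" "hermitian p0" "conv p0 p0 = p0" "p0 \<noteq> (\<lambda>x. 0)"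
  obtains \<xi> :: "'a character" where "conv (eval_character \<xi>) p0 = eval_character \<xi>"
proof -
  obtain p where p: "continuous_on UNIV p" "hermitian p" "conv p p = p" "p \<noteq> (\<lambda>x. 0)" "conv p p0 = p"
    and pmin: "\<And>q. continuous_on UNIV q \<Longrightarrow> hermitian q \<Longrightarrow> conv q q = q \<Longrightarrow> q \<noteq> (\<lambda>x. 0) \<Longrightarrow> conv q p = q \<Longrightarrow> q = p"
    using minimal_idempotent[OF p0] by blast
  \<comment> \<open>The spectral idempotent of \<open>h\<close> lies below \<open>p\<close> and so
    equals \<open>p\<close> by minimality. Hence \<open>p\<close> is an eigenvector of
    \<open>conv h h\<close>, on which it also acts as the identity.\<close>
  have sq: "\<exists>s. conv h h = (\<lambda>x. complex_of_real s * p x)"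
    if h: "continuous_on UNIV h" "hermitian h" "conv h p = h" for h
  proof (cases "h = (\<lambda>x. 0)")
    case True
    then have "conv h h = (\<lambda>x. complex_of_real 0 * p x)" by (auto simp: conv_def)
    then show ?thesis by blast
  next
    case False
    obtain q s where q: "continuous_on UNIV q" "hermitian q" "conv q q = q" "q \<noteq> (\<lambda>x. 0)"
      and s: "conv (conv h h) q = (\<lambda>x. complex_of_real s * q x)"
      and qq: "\<And>f. continuous_on UNIV f \<Longrightarrow> conv f h = h \<Longrightarrow> conv f q = q"
      using spectral_idempotent[OF h(1,2) False] by metis
    have "conv p h = h" using h(3) conv_commute[OF cpt h(1) p(1)] by simp
    then have "conv p q = q" by (rule qq[OF p(1)])
    then have "conv q p = q" using conv_commute[OF cpt q(1) p(1)] by simp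
    then have "q = p" by (intro pmin q)
    with s have "conv (conv h h) p = (\<lambda>x. complex_of_real s * p x)" by simp
    moreover have "conv (conv h h) p = conv h h"
      using conv_assoc[OF cpt h(1) h(1) p(1)] h(3) by simp
    ultimately show ?thesis by metis
  qed
  have mult: "\<exists>s. h = (\<lambda>x. complex_of_real s * p x)"
    if h: "continuous_on UNIV h" "hermitian h" "conv h p = h" for h
  proof -
    \<comment> \<open>Polarisation: comparing the convolution squares of \<open>h + p\<close> and of
      \<open>h\<close> isolates \<open>2 * h\<close>.\<close>
    define g where "g = (\<lambda>x. 1 * h x + 1 * p x)"
    have gc: "continuous_on UNIV g" unfolding g_def by (intro continuous_intros h p)
    have ph: "conv p h = h" using h(3) conv_commute[OF cpt h(1) p(1)] by simp
    have gl: "conv g f = (\<lambda>x. conv h f x + conv p f x)" if "continuous_on UNIV f" for f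
      unfolding g_def using conv_linear_left[OF cpt that h(1) p(1), of 1 1] by auto
    have gr: "conv f g = (\<lambda>x. conv f h x + conv f p x)" if "continuous_on UNIV f" for f
      unfolding g_def using conv_linear_right[OF cpt that h(1) p(1), of 1 1] by auto
    have "hermitian g" using h(2) p(2) by (simp add: hermitian_def g_def)
    moreover have "conv g p = g" unfolding gl[OF p(1)] h(3) p(3) by (auto simp: g_def)
    ultimately obtain s where s: "conv g g = (\<lambda>x. complex_of_real s * p x)" using sq[OF gc] by blast
    obtain s' where s': "conv h h = (\<lambda>x. complex_of_real s' * p x)" using sq[OF h] by blast
    have "conv g g = (\<lambda>x. (conv h h x + h x) + (h x + p x))"
      by (simp only: gl[OF gc] gr[OF h(1)] gr[OF p(1)] h(3) p(3) ph)
    then have "(conv h h x + h x) + (h x + p x) = complex_of_real s * p x" for x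
      using s by metis
    then have "2 * h x = complex_of_real (s - s' - 1) * p x" for x
      using s' by (simp add: algebra_simps)
    then have "h = (\<lambda>x. complex_of_real ((s - s' - 1) / 2) * p x)"
      by (auto simp: fun_eq_iff field_simps)
    then show ?thesis by blast
  qed
  have p_real: "p 0 = complex_of_real (sqnorm p)" "sqnorm p \<ge> 1"
    using idempotent_ge_1[OF p(1-4)] by auto
  have tc: "continuous_on UNIV (\<lambda>x. p (x + a))" for a
    by (intro continuous_on_compose2[OF p(1)] continuous_intros) auto
  have tp: "conv (\<lambda>x. p (x + a)) p x = p (x + a)" for a x
    using conv_translate[OF cpt, of p a p x] p(3) by simp
  have ph: "p (- x) = cnj (p x)" for x using p(2) by (simp add: hermitian_def)
  have trans: "\<exists>\<theta>. \<forall>x. p (x + a) = \<theta> * p x" for a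
  proof -
    \<comment> \<open>The sum of two opposite translates, and \<open>\<i>\<close> times their
      difference, are Hermitian; together they recover \<open>p (x + a)\<close>.\<close>
    have "\<exists>s. (\<lambda>x. 1 * p (x + a) + 1 * p (x + (- a))) = (\<lambda>x. complex_of_real s * p x)"
    proof (rule mult)
      show "hermitian (\<lambda>x. 1 * p (x + a) + 1 * p (x + (- a)))"
        unfolding hermitian_def
        using ph[of "_ - a"] ph[of "_ + a"] by (simp add: algebra_simps)
      show "conv (\<lambda>x. 1 * p (x + a) + 1 * p (x + (- a))) p = (\<lambda>x. 1 * p (x + a) + 1 * p (x + (- a)))"
        by (rule ext) (simp only: conv_linear_left[OF cpt p(1) tc tc] tp)
    qed (intro continuous_intros tc)
    then obtain s where s: "\<And>x. p (x + a) + p (x - a) = complex_of_real s * p x"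
      by (auto simp: fun_eq_iff)
    have "\<exists>s. (\<lambda>x. \<i> * p (x + a) + (- \<i>) * p (x + (- a))) = (\<lambda>x. complex_of_real s * p x)"
    proof (rule mult)
      show "hermitian (\<lambda>x. \<i> * p (x + a) + (- \<i>) * p (x + (- a)))"
        unfolding hermitian_def
        using ph[of "_ - a"] ph[of "_ + a"] by (simp add: algebra_simps)
      show "conv (\<lambda>x. \<i> * p (x + a) + (- \<i>) * p (x + (- a))) p = (\<lambda>x. \<i> * p (x + a) + (- \<i>) * p (x + (- a)))"
        by (rule ext) (simp only: conv_linear_left[OF cpt p(1) tc tc] tp)
    qed (intro continuous_intros tc)
    then obtain s' where s': "\<And>x. \<i> * p (x + a) - \<i> * p (x - a) = complex_of_real s' * p x"
      by (auto simp: fun_eq_iff)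
    have "p (x + a) = (complex_of_real s - \<i> * complex_of_real s') / 2 * p x" for x
    proof -
      have "(complex_of_real s - \<i> * complex_of_real s') * p x =
          (p (x + a) + p (x - a)) - \<i> * (\<i> * p (x + a) - \<i> * p (x - a))"
        unfolding s s' by (simp add: algebra_simps)
      also have "\<dots> = 2 * p (x + a)" by (simp add: algebra_simps)
      finally show ?thesis by simp
    qed
    then show ?thesis by blast
  qed
  have p0ne: "p 0 \<noteq> 0" using p_real by auto
  have pm: "p (x + a) * p 0 = p x * p a" for x a
  proof -
    obtain \<theta> where \<theta>: "\<And>x. p (x + a) = \<theta> * p x" using trans by blast
    have "p a = \<theta> * p 0" using \<theta>[of 0] by simp
    then show ?thesis using \<theta>[of x] by simp
  qed
  define ch where "ch x = p x / p 0" for x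
  have chm: "ch (x + y) = ch x * ch y" for x y
    unfolding ch_def using pm[of x y] p0ne by (simp add: field_simps)
  have chc: "continuous_on UNIV ch" unfolding ch_def using p0ne by (intro continuous_intros p) auto
  have "cmod (ch x) = 1" for x
  proof -
    have "ch (- x) = cnj (ch x)" unfolding ch_def using p_real(1) by (simp add: ph)
    moreover have "ch 0 = 1" using p0ne by (simp add: ch_def)
    ultimately have "ch x * cnj (ch x) = 1" using chm[of x "- x"] by simp
    then have "complex_of_real ((cmod (ch x))\<^sup>2) = 1"
      by (simp only: complex_norm_square)
    then have "(cmod (ch x))\<^sup>2 = 1" using of_real_eq_1_iff by blast
    then show ?thesis by (simp add: power2_eq_1_iff) (metis norm_ge_zero le_minus_one_simps(3))
  qed
  then have ev: "eval_character (Character ch) = ch"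
    using chm chc by (intro Character_inverse) auto
  have "conv ch p0 = ch"
  proof
    fix x
    have *: "ch = (\<lambda>x. (1 / p 0) * p x)" by (auto simp: ch_def)
    have "conv (\<lambda>x. (1 / p 0) * p x) p0 x = (1 / p 0) * conv p p0 x" by (rule conv_scale_left[OF cpt])
    then show "conv ch p0 x = ch x" by (simp only: * p(5))
  qed
  then show ?thesis using that[of "Character ch"] ev by simp
qed

text \<open>\<open>k\<close> is the convolution of \<open>g\<close> with its adjoint, and it is
  nonzero because \<open>k 0\<close> is the square norm of \<open>g\<close>. A character below the
  spectral idempotent of \<open>k\<close> is an eigenvector of \<open>conv k k\<close> with positive
  eigenvalue, whereas a vanishing coefficient would let convolution with \<open>g\<close>, and hence
  with \<open>k\<close>, annihilate it.\<close>

lemma fourier_coefficient_nonzero: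
  fixes g :: "'a \<Rightarrow> complex"
  assumes g: "continuous_on UNIV g" and g0: "g \<noteq> (\<lambda>x. 0)"
  obtains \<xi> :: "'a character" where "integral\<^sup>L haar_measure (\<lambda>x. g x * cnj (eval_character \<xi> x)) \<noteq> 0"
proof -
  define h where "h x = cnj (g (- x))" for x
  define k where "k = conv g h"
  have hc: "continuous_on UNIV h"
    unfolding h_def by (intro continuous_intros continuous_on_compose2[OF g]) auto
  have kc: "continuous_on UNIV k" unfolding k_def by (rule conv_continuous[OF cpt g hc])
  have "hermitian k"
    unfolding hermitian_def
  proof
    fix x
    have "cnj (k x) = integral\<^sup>L haar_measure (\<lambda>y. cnj (g (x - y) * h y))"
      by (simp only: k_def conv_def Bochner_Integration.integral_cnj)
    also have "\<dots> = integral\<^sup>L haar_measure (\<lambda>y. cnj (g (x - (y + x)) * h (y + x)))"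
      by (rule haar_shift[OF cpt, symmetric])
        (intro continuous_intros continuous_on_compose2[OF g] continuous_on_compose2[OF hc]; simp)
    also have "\<dots> = k (- x)"
    proof -
      have "x - (y + x) = - y" "- (y + x) = - x - y" for y by (simp_all add: algebra_simps)
      then show ?thesis by (simp only: k_def conv_def h_def complex_cnj_mult complex_cnj_cnj mult.commute)
    qed
    finally show "k (- x) = cnj (k x)" by simp
  qed
  moreover have "k \<noteq> (\<lambda>x. 0)"
  proof
    assume "k = (\<lambda>x. 0)"
    have "k 0 = integral\<^sup>L haar_measure (\<lambda>y. complex_of_real ((cmod (g (0 - y)))\<^sup>2))"
      unfolding k_def conv_def h_def by (simp only: complex_norm_square diff_0)
    also have "\<dots> = complex_of_real (integral\<^sup>L haar_measure (\<lambda>y. (cmod (g (0 - y)))\<^sup>2))"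
      by (rule integral_complex_of_real)
    also have "integral\<^sup>L haar_measure (\<lambda>y. (cmod (g (0 - y)))\<^sup>2) = sqnorm g"
      unfolding sqnorm_def by (rule haar_reflect[OF cpt, where f = "\<lambda>x. (cmod (g x))\<^sup>2"]) (intro continuous_intros g)
    finally have "sqnorm g = 0" using \<open>k = (\<lambda>x. 0)\<close> by simp
    then show False using sqnorm_eq_0[OF cpt g] g0 by auto
  qed
  ultimately obtain p s where p: "continuous_on UNIV p" "hermitian p" "conv p p = p" "p \<noteq> (\<lambda>x. 0)"
    and s: "s > 0" "conv (conv k k) p = (\<lambda>x. complex_of_real s * p x)"
    using spectral_idempotent[OF kc] by metis
  obtain \<xi> :: "'a character" where \<xi>: "conv (eval_character \<xi>) p = eval_character \<xi>"
    using idempotent_character[OF p] by blast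
  define ch where "ch = eval_character \<xi>"
  have ch: "continuous_on UNIV ch" "\<And>x. cmod (ch x) = 1" "\<And>x y. ch (x + y) = ch x * ch y"
    using eval_character[of \<xi>] by (auto simp: ch_def)
  have chp: "conv p ch = ch" using \<xi> conv_commute[OF cpt p(1) ch(1)] by (simp add: ch_def)
  note cc = conv_continuous[OF cpt]
  have eig: "conv (conv k k) ch = (\<lambda>x. complex_of_real s * ch x)"
  proof -
    have "conv (conv k k) ch = conv (conv k k) (conv p ch)" by (simp add: chp)
    also have "\<dots> = conv (conv (conv k k) p) ch"
      by (rule conv_assoc[OF cpt cc[OF kc kc] p(1) ch(1), symmetric])
    also have "\<dots> = (\<lambda>x. complex_of_real s * ch x)"
      unfolding s(2) by (rule ext) (simp add: conv_scale_left[OF cpt] chp)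
    finally show ?thesis .
  qed
  have "integral\<^sup>L haar_measure (\<lambda>x. g x * cnj (ch x)) \<noteq> 0"
  proof
    assume int0: "integral\<^sup>L haar_measure (\<lambda>x. g x * cnj (ch x)) = 0"
    have cnjch: "ch (x - y) = ch x * cnj (ch y)" for x y
    proof -
      have "ch (x - y) * ch y = ch x" using ch(3)[of "x - y" y] by simp
      moreover have "ch y * cnj (ch y) = 1" using ch(2)[of y] by (simp add: complex_norm_square[symmetric])
      ultimately show ?thesis by (metis mult.assoc mult.right_neutral)
    qed
    have "conv ch g = (\<lambda>x. 0)"
    proof
      fix x
      have "conv ch g x = integral\<^sup>L haar_measure (\<lambda>y. ch x * (g y * cnj (ch y)))"
        unfolding conv_def cnjch by (simp add: mult_ac)
      also have "\<dots> = ch x * integral\<^sup>L haar_measure (\<lambda>y. g y * cnj (ch y))"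
        by (rule integral_mult_right_zero)
      finally show "conv ch g x = 0" unfolding int0 by simp
    qed
    then have "conv (conv ch g) h = (\<lambda>x. 0)" by (simp add: conv_def[abs_def])
    then have "conv ch k = (\<lambda>x. 0)" unfolding k_def conv_assoc[OF cpt ch(1) g hc] .
    then have "conv k ch = (\<lambda>x. 0)" using conv_commute[OF cpt kc ch(1)] by simp
    then have "conv (conv k k) ch = (\<lambda>x. 0)"
      unfolding conv_assoc[OF cpt kc kc ch(1)] by (simp add: conv_def[abs_def])
    with eig have "complex_of_real s * ch 0 = 0" by metis
    then show False using s(1) ch(2)[of 0] by auto
  qed
  then show ?thesis using that[of \<xi>] by (simp add: ch_def)
qed

text \<open>If \<open>eval_character \<xi> x = 1\<close>, a function and its translate by
  \<open>x\<close> have the same coefficient at \<open>\<xi>\<close>, so their difference has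
  coefficient 0 there. The distance to 0 does differ from its translate.\<close>

lemma character_separates:
  fixes x :: 'a
  assumes "x \<noteq> 0"
  obtains \<xi> :: "'a character" where "eval_character \<xi> x \<noteq> 1"
proof -
  define f where "f y = complex_of_real (dist y 0)" for y :: 'a
  have fc: "continuous_on UNIV f" unfolding f_def by (intro continuous_intros)
  have fxc: "continuous_on UNIV (\<lambda>y. f (y + x))" by (intro continuous_on_compose2[OF fc] continuous_intros) auto
  have "(\<lambda>y. f (y + x) - f y) \<noteq> (\<lambda>y. 0)"
  proof
    assume "(\<lambda>y. f (y + x) - f y) = (\<lambda>y. 0)"
    then have "f (0 + x) - f 0 = 0" by metis
    then show False using assms by (simp add: f_def)
  qed
  then obtain \<xi> :: "'a character" where
    \<xi>: "integral\<^sup>L haar_measure (\<lambda>y. (f (y + x) - f y) * cnj (eval_character \<xi> y)) \<noteq> 0"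
    using fourier_coefficient_nonzero[of "\<lambda>y. f (y + x) - f y"] fc fxc by (metis continuous_on_diff)
  have ch: "continuous_on UNIV (eval_character \<xi>)" "\<And>x y. eval_character \<xi> (x + y) = eval_character \<xi> x * eval_character \<xi> y"
    using eval_character[of \<xi>] by auto
  have "eval_character \<xi> x \<noteq> 1"
  proof
    assume one: "eval_character \<xi> x = 1"
    have c: "continuous_on UNIV (\<lambda>y. f y * cnj (eval_character \<xi> y))" by (intro continuous_intros fc ch)
    have c': "continuous_on UNIV (\<lambda>y. f (y + x) * cnj (eval_character \<xi> y))" by (intro continuous_intros fxc ch)
    have "integral\<^sup>L haar_measure (\<lambda>y. (f (y + x) - f y) * cnj (eval_character \<xi> y)) =
        integral\<^sup>L haar_measure (\<lambda>y. f (y + x) * cnj (eval_character \<xi> y)) - integral\<^sup>L haar_measure (\<lambda>y. f y * cnj (eval_character \<xi> y))"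
      unfolding left_diff_distrib using haar_integrable[OF cpt c] haar_integrable[OF cpt c'] by (rule Bochner_Integration.integral_diff[rotated])
    also have "(\<lambda>y. f (y + x) * cnj (eval_character \<xi> y)) = (\<lambda>y. f (y + x) * cnj (eval_character \<xi> (y + x)))"
      by (simp add: ch(2) one)
    also have "integral\<^sup>L haar_measure \<dots> = integral\<^sup>L haar_measure (\<lambda>y. f y * cnj (eval_character \<xi> y))"
      by (rule haar_shift[OF cpt c])
    finally show False using \<xi> by simp
  qed
  then show ?thesis by (rule that)
qed

end

section \<open>Continuous maps into the circle\<close>

lemma eval_character_props:
  fixes \<xi> :: "'a::topological_ab_group_add character"
  shows "continuous_on UNIV (eval_character \<xi>)" "cmod (eval_character \<xi> x) = 1"
    "eval_character \<xi> (x + y) = eval_character \<xi> x * eval_character \<xi> y"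
    "eval_character \<xi> 0 = 1"
    "eval_character \<xi> (- x) = cnj (eval_character \<xi> x)"
    "eval_character \<xi> x * cnj (eval_character \<xi> x) = 1"
proof -
  show 1: "continuous_on UNIV (eval_character \<xi>)" "\<And>x. cmod (eval_character \<xi> x) = 1"
    "\<And>x y. eval_character \<xi> (x + y) = eval_character \<xi> x * eval_character \<xi> y"
    using eval_character[of \<xi>] by auto
  show 2: "eval_character \<xi> 0 = 1" using 1(3)[of 0 0] by simp
  show 3: "eval_character \<xi> x * cnj (eval_character \<xi> x) = 1" for x
    using 1(2)[of x] by (simp add: complex_norm_square[symmetric])
  have "eval_character \<xi> x * eval_character \<xi> (- x) = 1" using 1(3)[of x "- x"] 2 by simp
  with 3[of x] show "eval_character \<xi> (- x) = cnj (eval_character \<xi> x)"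
    by (metis eval_character_nonzero mult_left_cancel)
qed

lemma eval_character_diff:
  "eval_character \<xi> (x - y) = eval_character \<xi> x * cnj (eval_character \<xi> y)"
  using eval_character_props(3)[of \<xi> x "- y"] eval_character_props(5)[of \<xi> y] by simp

lemma eval_character_uminus: "eval_character (- \<xi>) x = cnj (eval_character \<xi> x)"
proof -
  have "eval_character (- \<xi>) x = inverse (eval_character \<xi> x)" by transfer simp
  also have "\<dots> = cnj (eval_character \<xi> x)"
    using eval_character_props(6)[of \<xi> x] by (metis inverse_unique)
  finally show ?thesis .
qed

text \<open>Any two values of \<open>k\<close> differ by a multiple of \<open>2 * pi\<close>, so the
  range is discrete.\<close>

lemma exp_i_eq_const:
  fixes k :: "'a::topological_space \<Rightarrow> real"
  assumes conn: "connected (UNIV :: 'a set)" and k: "continuous_on UNIV k"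
    and w: "\<And>x. exp (\<i> * of_real (k x)) = w"
  shows "k x = k y"
proof -
  have "k constant_on UNIV"
  proof (rule continuous_discrete_range_constant[OF conn k])
    fix x
    have "2 * pi \<le> norm (k y - k x)" if "k y \<noteq> k x" for y
    proof -
      have "exp (\<i> * of_real (k y)) = exp (\<i> * of_real (k x))" by (simp only: w)
      then obtain n :: int where "\<i> * of_real (k y) = \<i> * of_real (k x) + of_int (2 * n) * pi * \<i>"
        by (auto simp: exp_eq)
      then have "\<i> * of_real (k y) = \<i> * (of_real (k x + of_int (2 * n) * pi))"
        by (simp add: algebra_simps)
      then have n: "k y = k x + of_int (2 * n) * pi" unfolding mult_cancel_left of_real_eq_iff by simp
      then have "n \<noteq> 0" using that by auto
      then have "1 \<le> \<bar>real_of_int n\<bar>" by linarith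
      then show ?thesis using n by (simp add: abs_mult)
    qed
    then show "\<exists>e>0. \<forall>y. y \<in> UNIV \<and> k y \<noteq> k x \<longrightarrow> e \<le> norm (k y - k x)"
      by (intro exI[of _ "2 * pi"]) auto
  qed
  then show ?thesis by (auto simp: constant_on_def)
qed

lemma unit_phase:
  assumes "cmod z = 1"
  shows "exp (\<i> * of_real (Im (Ln z))) = z"
proof -
  have z: "z \<noteq> 0" using assms by auto
  have "Re (Ln z) = 0" using assms z by simp
  then have "\<i> * of_real (Im (Ln z)) = Ln z" by (simp add: complex_eq_iff)
  then show ?thesis using z by simp
qed

text \<open>\<open>G\<close> is open because it absorbs sums with \<open>V\<close>. Its complement
  is open because \<open>a = x + (a - x)\<close>: a point \<open>x\<close> of \<open>G\<close> with
  \<open>a - x\<close> in \<open>V\<close> would put \<open>a\<close> into \<open>G\<close>.\<close>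

lemma open_subsemigroup_UNIV:
  fixes G :: "'a::topological_ab_group_add set"
  assumes conn: "connected (UNIV :: 'a set)" and V: "open V" "0 \<in> V" "V \<subseteq> G"
    and add: "\<And>a b. a \<in> G \<Longrightarrow> b \<in> G \<Longrightarrow> a + b \<in> G"
  shows "G = UNIV"
proof -
  have "open G"
  proof (subst open_subopen, intro ballI)
    fix a assume a: "a \<in> G"
    have "open ((\<lambda>x. x - a) -` V)" by (intro open_vimage V continuous_intros)
    moreover have "(\<lambda>x. x - a) -` V \<subseteq> G"
    proof
      fix x assume "x \<in> (\<lambda>x. x - a) -` V"
      then have "a + (x - a) \<in> G" using V a by (intro add) auto
      then show "x \<in> G" by simp
    qed
    ultimately show "\<exists>T. open T \<and> a \<in> T \<and> T \<subseteq> G" using V(2) by (intro exI[of _ "(\<lambda>x. x - a) -` V"]) auto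
  qed
  moreover have "open (- G)"
  proof (subst open_subopen, intro ballI)
    fix a assume a: "a \<in> - G"
    have "open ((\<lambda>x. a - x) -` V)" by (intro open_vimage V continuous_intros)
    moreover have "(\<lambda>x. a - x) -` V \<subseteq> - G"
    proof
      fix x assume x: "x \<in> (\<lambda>x. a - x) -` V"
      show "x \<in> - G"
      proof
        assume "x \<in> G"
        then have "x + (a - x) \<in> G" using V x by (intro add) auto
        then show False using a by simp
      qed
    qed
    ultimately show "\<exists>T. open T \<and> a \<in> T \<and> T \<subseteq> - G" using V(2) by (intro exI[of _ "(\<lambda>x. a - x) -` V"]) auto
  qed
  ultimately have "G = {} \<or> G = UNIV" 
    using connectedD[OF conn, of G "- G"] by auto
  then show ?thesis using V by auto
qed

context
  fixes ty :: "'a::{topological_ab_group_add, metric_space} itself"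
  assumes cpt: "compact (UNIV :: 'a set)" and conn: "connected (UNIV :: 'a set)"
begin

context
  fixes u :: "'a \<Rightarrow> complex"
  assumes uc: "continuous_on UNIV u" and u1: "\<And>x. cmod (u x) = 1"
begin

text \<open>\<open>h\<close> is a real logarithm of the quotient of a translate of \<open>u\<close>
  by \<open>u\<close>, normalised to mean 0. The constant \<open>w\<close> absorbs the normalisation
  and the value at \<open>a\<close> of the character contained in \<open>u\<close>.\<close>

private definition "increment a h \<longleftrightarrow> continuous_on UNIV h \<and> integral\<^sup>L haar_measure h = 0 \<and>
  (\<exists>w. w \<noteq> 0 \<and> (\<forall>x. exp (\<i> * of_real (h x)) = w * (u (x + a) / u x)))" for a :: 'a and h :: "'a \<Rightarrow> real"

private lemma u_nz: "u x \<noteq> 0" using u1[of x] by auto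

text \<open>Two candidates differ by a constant because the group is connected, and the mean makes
  it 0. Uniqueness is what later turns the increments into an exact cocycle.\<close>

private lemma increment_unique:
  assumes h: "increment a h" and k: "increment a k"
  shows "h x = k x"
proof -
  obtain v w where vw: "v \<noteq> 0" "\<And>x. exp (\<i> * of_real (h x)) = v * (u (x + a) / u x)"
     "w \<noteq> 0" "\<And>x. exp (\<i> * of_real (k x)) = w * (u (x + a) / u x)"
    using h k by (auto simp: increment_def)
  have hc: "continuous_on UNIV h" and kc: "continuous_on UNIV k"
    using h k by (auto simp: increment_def)
  have const: "h x - k x = h y - k y" for x y
  proof (rule exp_i_eq_const[OF conn, of "\<lambda>x. h x - k x" "v / w"])
    show "continuous_on UNIV (\<lambda>x. h x - k x)" by (intro continuous_intros hc kc)
    show "exp (\<i> * of_real (h x - k x)) = v / w" for x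
      using u_nz vw by (simp add: right_diff_distrib exp_diff)
  qed
  have "integral\<^sup>L haar_measure (\<lambda>y. h y - k y) = 0"
    using h k haar_integrable[OF cpt hc] haar_integrable[OF cpt kc] by (simp add: increment_def)
  moreover have "(\<lambda>y. h y - k y) = (\<lambda>y. h x - k x)" using const by auto
  ultimately have "integral\<^sup>L haar_measure (\<lambda>y::'a. h x - k x) = 0" by simp
  then show ?thesis by (simp only: haar_const[OF cpt])
qed

private lemma increment_mean:
  assumes gc: "continuous_on UNIV g" and g: "\<And>x. exp (\<i> * of_real (g x)) = u (x + a) / u x"
  shows "increment a (\<lambda>x. g x - integral\<^sup>L haar_measure g)"
proof -
  have "integral\<^sup>L haar_measure (\<lambda>x. g x - integral\<^sup>L haar_measure g) = 0"
    using haar_integrable[OF cpt gc] haar_const[OF cpt, of "integral\<^sup>L haar_measure g"]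
      haar_integrable[OF cpt continuous_on_const[of _ "integral\<^sup>L haar_measure g"]]
    by (simp only: Bochner_Integration.integral_diff diff_self)
  moreover have "exp (\<i> * of_real (g x - integral\<^sup>L haar_measure g)) =
      exp (- \<i> * of_real (integral\<^sup>L haar_measure g)) * (u (x + a) / u x)" for x
    by (simp add: right_diff_distrib exp_diff g exp_minus field_simps)
  ultimately show ?thesis unfolding increment_def
    by (intro conjI exI[of _ "exp (- \<i> * of_real (integral\<^sup>L haar_measure g))"]) (auto intro!: continuous_intros gc)
qed

text \<open>For \<open>a\<close> near 0 the quotients lie within distance 1 of 1, hence off the
  negative axis, so the principal logarithm is a continuous lift. Half of \<open>e\<close> bounds
  the lift, the other half its mean.\<close>

private lemma small_increment:
  assumes "e > 0"
  obtains V where "open V" "0 \<in> V" "\<And>a. a \<in> V \<Longrightarrow> \<exists>h. increment a h \<and> (\<forall>x. \<bar>h x\<bar> \<le> e)"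
proof -
  have "isCont (\<lambda>z. Im (Ln z)) 1" by (intro continuous_Im continuous_at_Ln) auto
  then obtain d where d: "d > 0" "\<And>z. dist z 1 < d \<Longrightarrow> dist (Im (Ln z)) (Im (Ln 1)) < e / 2"
    using assms unfolding continuous_at_eps_delta by (meson half_gt_zero)
  obtain V where V: "open V" "0 \<in> V" "\<And>x v. v \<in> V \<Longrightarrow> dist (u (x + v)) (u x) < min d 1"
    using translation_uniformly_continuous[OF cpt uc, of "min d 1"] d(1) by auto
  show ?thesis
  proof (rule that[OF V(1,2)])
    fix a assume a: "a \<in> V"
    define z where "z x = u (x + a) / u x" for x
    have z1: "cmod (z x) = 1" for x by (simp add: z_def norm_divide u1)
    have zd: "dist (z x) 1 < min d 1" for x
    proof -
      have "z x - 1 = (u (x + a) - u x) / u x" using u_nz[of x] by (simp add: z_def field_simps)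
      then have "dist (z x) 1 = dist (u (x + a)) (u x)" by (simp add: dist_norm norm_divide u1)
      then show ?thesis using V(3)[OF a, of x] by simp
    qed
    define g where "g x = Im (Ln (z x))" for x
    have "z x \<notin> \<real>\<^sub>\<le>\<^sub>0" for x
    proof
      assume "z x \<in> \<real>\<^sub>\<le>\<^sub>0"
      then have "Re (z x) \<le> 0" by (auto simp: complex_nonpos_Reals_iff)
      then have "1 \<le> \<bar>Re (z x - 1)\<bar>" by simp
      also have "\<dots> \<le> dist (z x) 1" unfolding dist_norm by (rule abs_Re_le_cmod)
      finally show False using zd[of x] by simp
    qed
    moreover have zc: "continuous_on UNIV z"
      unfolding z_def using u_nz by (intro continuous_intros uc continuous_on_compose2[OF uc]) auto
    ultimately have gc: "continuous_on UNIV g"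
      unfolding g_def by (intro continuous_intros zc) auto
    have ge: "exp (\<i> * of_real (g x)) = u (x + a) / u x" for x
      using unit_phase[OF z1] by (simp add: g_def z_def)
    have gb: "\<bar>g x\<bar> \<le> e / 2" for x
      using d(2)[of "z x"] zd[of x] by (simp add: g_def dist_real_def)
    have "\<bar>integral\<^sup>L haar_measure g\<bar> \<le> integral\<^sup>L haar_measure (\<lambda>x. \<bar>g x\<bar>)"
      by (rule integral_abs_bound)
    also have "\<dots> \<le> integral\<^sup>L haar_measure (\<lambda>x::'a. e / 2)"
      using gb by (intro integral_mono haar_integrable[OF cpt] continuous_intros gc)
    also have "\<dots> = e / 2" by (rule haar_const[OF cpt])
    finally have "\<bar>g x - integral\<^sup>L haar_measure g\<bar> \<le> e" for x using gb[of x] by linarith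
    then show "\<exists>h. increment a h \<and> (\<forall>x. \<bar>h x\<bar> \<le> e)"
      using increment_mean[OF gc ge] by blast
  qed
qed

private lemma increment_add:
  assumes "increment a h" "increment b k"
  shows "increment (a + b) (\<lambda>x. h (x + b) + k x)"
proof -
  have hc: "continuous_on UNIV h" and kc: "continuous_on UNIV k" and int: "integral\<^sup>L haar_measure h = 0" "integral\<^sup>L haar_measure k = 0"
    using assms by (auto simp: increment_def)
  have hbc: "continuous_on UNIV (\<lambda>x. h (x + b))"
    by (intro continuous_on_compose2[OF hc] continuous_intros) auto
  obtain v w where vw: "v \<noteq> 0" "\<And>x. exp (\<i> * of_real (h x)) = v * (u (x + a) / u x)"
     "w \<noteq> 0" "\<And>x. exp (\<i> * of_real (k x)) = w * (u (x + b) / u x)"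
    using assms by (auto simp: increment_def)
  have "integral\<^sup>L haar_measure (\<lambda>x. h (x + b) + k x) = 0"
    using haar_integrable[OF cpt hbc] haar_integrable[OF cpt kc] haar_shift[OF cpt hc, of b] int by simp
  moreover have "exp (\<i> * of_real (h (x + b) + k x)) = (v * w) * (u (x + (a + b)) / u x)" for x
    using u_nz[of "x + b"] by (simp add: distrib_left exp_add vw add_ac)
  ultimately show ?thesis
    unfolding increment_def using vw(1,3) by (intro conjI exI[of _ "v * w"]) (auto intro!: continuous_intros hbc kc)
qed

private lemma increment_exists: "\<exists>h. increment a h"
proof -
  obtain V where V: "open V" "0 \<in> V" "\<And>a. a \<in> V \<Longrightarrow> \<exists>h. increment a h \<and> (\<forall>x. \<bar>h x\<bar> \<le> 1)"
    using small_increment[of 1] by auto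
  have "{a. \<exists>h. increment a h} = UNIV"
    by (rule open_subsemigroup_UNIV[OF conn V(1,2)]) (use V(3) increment_add in blast)+
  then show ?thesis by auto
qed

text \<open>The increments \<open>h a\<close> of the sought phase \<open>F\<close>, normalised to have mean zero, form an
  exact cocycle, so \<open>F x = h x 0\<close>.\<close>

lemma circle_map_decomposition:
  obtains c \<xi> and F :: "'a \<Rightarrow> real" where "continuous_on UNIV F" "integral\<^sup>L haar_measure F = 0"
    "\<And>x. u x = c * eval_character \<xi> x * exp (\<i> * of_real (F x))"
proof -
  obtain h where h: "\<And>a. increment a (h a)" using increment_exists by metis
  have coc: "h (a + b) x = h a (x + b) + h b x" for a b x
    by (rule increment_unique[OF h increment_add[OF h h]])
  define F where "F x = h x 0" for x
  have Fa: "F (a + x) = h a x + F x" for a x using coc[of a x 0] by (simp add: F_def)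
  have Fc: "continuous_on UNIV F"
    unfolding continuous_on_iff
  proof (intro ballI allI impI)
    fix x :: 'a and e :: real assume e: "e > 0"
    obtain V where V: "open V" "0 \<in> V" "\<And>a. a \<in> V \<Longrightarrow> \<exists>h. increment a h \<and> (\<forall>x. \<bar>h x\<bar> \<le> e / 2)"
      using small_increment[of "e / 2"] e by auto
    have "open ((\<lambda>y. y - x) -` V)" by (intro open_vimage V continuous_intros)
    moreover have "x \<in> (\<lambda>y. y - x) -` V" using V(2) by simp
    ultimately obtain d where d: "d > 0" "ball x d \<subseteq> (\<lambda>y. y - x) -` V" by (meson open_contains_ball)
    have "dist (F y) (F x) < e" if "dist y x < d" for y
    proof -
      have "y - x \<in> V" using d(2) that by (auto simp: dist_commute)
      then obtain k where k: "increment (y - x) k" "\<And>x. \<bar>k x\<bar> \<le> e / 2" using V(3) by blast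
      have "F y - F x = k x" using Fa[of "y - x" x] increment_unique[OF h k(1)] by simp
      then show ?thesis using k(2)[of x] e by (simp add: dist_real_def)
    qed
    then show "\<exists>d>0. \<forall>y\<in>UNIV. dist y x < d \<longrightarrow> dist (F y) (F x) < e" using d(1) by blast
  qed
  \<comment> \<open>Once the phase is removed, each translation multiplies \<open>v\<close> by a
    constant, so \<open>v\<close> is a constant times a character.\<close>
  define v where "v x = u x * exp (- \<i> * of_real (F x))" for x
  have vc: "continuous_on UNIV v" unfolding v_def by (intro continuous_intros uc Fc)
  have v1: "cmod (v x) = 1" for x by (simp add: v_def norm_mult u1)
  have vnz: "v x \<noteq> 0" for x using v1[of x] by auto
  have "\<exists>w. \<forall>x. v (x + a) = w * v x" for a
  proof -
    obtain w where w: "w \<noteq> 0" "\<And>x. exp (\<i> * of_real (h a x)) = w * (u (x + a) / u x)"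
      using h[of a] by (auto simp: increment_def)
    have "v (x + a) = (1 / w) * v x" for x
    proof -
      have "u (x + a) = (1 / w) * u x * exp (\<i> * of_real (h a x))" using w u_nz[of x] by simp
      then show ?thesis
        using Fa[of a x] by (simp add: v_def add.commute distrib_left exp_add exp_diff exp_minus field_simps)
    qed
    then show ?thesis by blast
  qed
  then have vm: "v (x + a) * v 0 = v x * v a" for x a
    by (metis add_0 mult.assoc mult.commute)
  define e where "e x = v x / v 0" for x
  have "e \<in> {e. continuous_on UNIV e \<and> (\<forall>x. cmod (e x) = 1) \<and> (\<forall>x y. e (x + y) = e x * e y)}"
    using vm vnz v1 by (auto simp: e_def norm_divide field_simps intro!: continuous_intros vc)
  then have ev: "eval_character (Character e) = e" by (rule Character_inverse)
  define m where "m = integral\<^sup>L haar_measure F"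
  show ?thesis
  proof (rule that[of "\<lambda>x. F x - m" "v 0 * exp (\<i> * of_real m)" "Character e"])
    show "continuous_on UNIV (\<lambda>x. F x - m)" by (intro continuous_intros Fc)
    show "integral\<^sup>L haar_measure (\<lambda>x. F x - m) = 0"
      using haar_integrable[OF cpt Fc] haar_const[OF cpt, of m] haar_integrable[OF cpt continuous_on_const[of _ m]]
      by (simp only: Bochner_Integration.integral_diff m_def diff_self)
    show "u x = v 0 * exp (\<i> * of_real m) * eval_character (Character e) x * exp (\<i> * of_real (F x - m))" for x
      unfolding ev e_def v_def using u_nz[of 0]
      by (simp add: right_diff_distrib exp_diff exp_minus field_simps)
  qed
qed

end

text \<open>The exponential of the difference \<open>K\<close> is a constant times a character, so
  \<open>K (x + y) - K x\<close> is constant in \<open>x\<close>, and its mean is 0 by invariance.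
  Thus \<open>K\<close> is constant and its mean makes it 0, after which the characters agree as
  well.\<close>

lemma circle_map_decomposition_unique:
  fixes F G :: "'a \<Rightarrow> real"
  assumes F: "continuous_on UNIV F" "integral\<^sup>L haar_measure F = 0"
    and G: "continuous_on UNIV G" "integral\<^sup>L haar_measure G = 0"
    and c: "c \<noteq> 0"
    and eq: "\<And>x. c * eval_character \<xi> x * exp (\<i> * of_real (F x)) = d * eval_character \<eta> x * exp (\<i> * of_real (G x))"
  shows "\<xi> = \<eta>" "F = G"
proof -
  define K where "K x = F x - G x" for x
  have d: "d \<noteq> 0" using eq[of 0] c by auto
  have Kc: "continuous_on UNIV K" unfolding K_def by (intro continuous_intros F G)
  have Kint: "integral\<^sup>L haar_measure K = 0"
    unfolding K_def using F G haar_integrable[OF cpt F(1)] haar_integrable[OF cpt G(1)] by simp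
  have expK: "exp (\<i> * of_real (K x)) = (d / c) * eval_character (\<eta> - \<xi>) x" for x
  proof -
    have "eval_character \<eta> x = eval_character (\<eta> - \<xi>) x * eval_character \<xi> x"
      using eval_character_add[of "\<eta> - \<xi>" \<xi> x] by simp
    then have "eval_character \<xi> x * (c * exp (\<i> * of_real (F x))) =
        eval_character \<xi> x * (d * eval_character (\<eta> - \<xi>) x * exp (\<i> * of_real (G x)))"
      using eq[of x] by (simp add: mult_ac)
    then have "c * exp (\<i> * of_real (F x)) = d * eval_character (\<eta> - \<xi>) x * exp (\<i> * of_real (G x))"
      by simp
    then show ?thesis using c by (simp add: K_def right_diff_distrib exp_diff field_simps)
  qed
  have K0: "K y = K 0" for y
  proof -
    have Kyc: "continuous_on UNIV (\<lambda>x. K (x + y))" by (intro continuous_on_compose2[OF Kc] continuous_intros) auto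
    have const: "K (x + y) - K x = K (0 + y) - K 0" for x
    proof (rule exp_i_eq_const[OF conn, of "\<lambda>x. K (x + y) - K x" "eval_character (\<eta> - \<xi>) y"])
      show "continuous_on UNIV (\<lambda>x. K (x + y) - K x)" by (intro continuous_intros Kyc Kc)
      show "exp (\<i> * of_real (K (x + y) - K x)) = eval_character (\<eta> - \<xi>) y" for x
        using c d by (simp only: of_real_diff right_diff_distrib exp_diff expK eval_character_props(3)) simp
    qed
    have "integral\<^sup>L haar_measure (\<lambda>x. K (x + y) - K x) = 0"
      using haar_integrable[OF cpt Kyc] haar_integrable[OF cpt Kc] haar_shift[OF cpt Kc, of y] by simp
    moreover have "integral\<^sup>L haar_measure (\<lambda>x. K (x + y) - K x) = integral\<^sup>L haar_measure (\<lambda>x::'a. K (0 + y) - K 0)"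
      by (rule Bochner_Integration.integral_cong[OF refl]) (rule const)
    ultimately have "integral\<^sup>L haar_measure (\<lambda>x::'a. K (0 + y) - K 0) = 0" by (metis (no_types))
    then show ?thesis by (simp only: haar_const[OF cpt]) simp
  qed
  have "integral\<^sup>L haar_measure K = integral\<^sup>L haar_measure (\<lambda>x::'a. K 0)"
    by (rule Bochner_Integration.integral_cong[OF refl]) (rule K0)
  then have "integral\<^sup>L haar_measure (\<lambda>x::'a. K 0) = 0" unfolding Kint by (rule sym)
  then have "K 0 = 0" by (simp only: haar_const[OF cpt])
  then have K: "K x = 0" for x using K0 by simp
  then show "F = G" by (auto simp: K_def)
  have "1 = (d / c) * eval_character (\<eta> - \<xi>) x" for x using expK[of x] K by simp
  moreover from this[of 0] have "d / c = 1" by (simp add: eval_character_props(4))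
  ultimately have "eval_character (\<eta> - \<xi>) x = 1" for x by simp
  then have "\<eta> - \<xi> = 0" by (intro character_eqI) simp
  then show "\<xi> = \<eta>" by simp
qed

end

section \<open>Fourier coefficients\<close>

definition fourier :: "('a::topological_ab_group_add \<Rightarrow> complex) \<Rightarrow> 'a character \<Rightarrow> complex" where
  "fourier f \<xi> = integral\<^sup>L haar_measure (\<lambda>x. f x * cnj (eval_character \<xi> x))"

context
  fixes ty :: "'a::{topological_ab_group_add, metric_space} itself"
  assumes cpt: "compact (UNIV :: 'a set)"
begin

lemma character_integral:
  fixes \<xi> :: "'a character"
  shows "integral\<^sup>L haar_measure (eval_character \<xi>) = (if \<xi> = 0 then 1 else 0)"
proof (cases "\<xi> = 0")
  case True
  then have "eval_character \<xi> = (\<lambda>x. 1)" by auto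
  then show ?thesis using True by (simp only: haar_const[OF cpt]) simp
next
  case False
  then obtain a where a: "eval_character \<xi> a \<noteq> 1" using character_eqI[of \<xi> 0] by auto
  have "integral\<^sup>L haar_measure (\<lambda>x. eval_character \<xi> (x + a)) = integral\<^sup>L haar_measure (eval_character \<xi>)"
    by (rule haar_shift[OF cpt eval_character_props(1)])
  then show ?thesis using a False by (simp add: eval_character_props(3))
qed

lemma character_orthogonal:
  fixes \<xi> \<eta> :: "'a character"
  shows "integral\<^sup>L haar_measure (\<lambda>x. eval_character \<xi> x * cnj (eval_character \<eta> x)) = (if \<xi> = \<eta> then 1 else 0)"
proof -
  have "(\<lambda>x. eval_character \<xi> x * cnj (eval_character \<eta> x)) = eval_character (\<xi> + - \<eta>)"
    
    by (auto simp: eval_character_add eval_character_uminus simp del: add_uminus_conv_diff)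
  then show ?thesis using character_integral[of "\<xi> + - \<eta>"] by (simp add: add_eq_0_iff2)
qed

lemma Bessel:
  fixes f :: "'a \<Rightarrow> complex"
  assumes f: "continuous_on UNIV f" and J: "finite J"
  shows "(\<Sum>\<xi>\<in>J. (cmod (fourier f \<xi>))\<^sup>2) \<le> sqnorm f"
proof -
  define s where "s x = (\<Sum>\<xi>\<in>J. fourier f \<xi> * eval_character \<xi> x)" for x
  have sc: "continuous_on UNIV s" unfolding s_def by (intro continuous_intros eval_character_props)
  define S where "S = (\<Sum>\<xi>\<in>J. (cmod (fourier f \<xi>))\<^sup>2)"
  have fc: "integrable haar_measure (\<lambda>x. f x * cnj (eval_character \<xi> x))" for \<xi>
    by (intro haar_integrable[OF cpt] continuous_intros f eval_character_props)
  have cc: "integrable haar_measure (\<lambda>x. eval_character \<xi> x * cnj (eval_character \<eta> x))" for \<xi> \<eta> :: "'a character"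
    by (intro haar_integrable[OF cpt] continuous_intros f eval_character_props)
  have "integral\<^sup>L haar_measure (\<lambda>x. f x * cnj (s x)) =
      integral\<^sup>L haar_measure (\<lambda>x. \<Sum>\<xi>\<in>J. cnj (fourier f \<xi>) * (f x * cnj (eval_character \<xi> x)))"
    by (simp add: s_def sum_distrib_left mult_ac)
  also have "\<dots> = (\<Sum>\<xi>\<in>J. cnj (fourier f \<xi>) * fourier f \<xi>)"
    using fc by (simp add: fourier_def)
  also have "\<dots> = of_real S" by (simp only: S_def of_real_sum complex_norm_square mult.commute)
  finally have fs: "integral\<^sup>L haar_measure (\<lambda>x. f x * cnj (s x)) = of_real S" .
  have "integral\<^sup>L haar_measure (\<lambda>x. s x * cnj (f x)) = integral\<^sup>L haar_measure (\<lambda>x. cnj (f x * cnj (s x)))"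
    by (simp add: mult.commute)
  also have "\<dots> = of_real S" by (simp only: Bochner_Integration.integral_cnj fs complex_cnj_complex_of_real)
  finally have sf: "integral\<^sup>L haar_measure (\<lambda>x. s x * cnj (f x)) = of_real S" .
  have "s x * cnj (s x) = (\<Sum>\<xi>\<in>J. \<Sum>\<eta>\<in>J. (fourier f \<xi> * cnj (fourier f \<eta>)) * (eval_character \<xi> x * cnj (eval_character \<eta> x)))" for x
    unfolding s_def cnj_sum sum_product by (simp add: mult_ac)
  then have "integral\<^sup>L haar_measure (\<lambda>x. s x * cnj (s x)) =
      (\<Sum>\<xi>\<in>J. \<Sum>\<eta>\<in>J. (fourier f \<xi> * cnj (fourier f \<eta>)) * (if \<xi> = \<eta> then 1 else 0))"
    using cc by (simp add: character_orthogonal)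
  also have "\<dots> = (\<Sum>\<xi>\<in>J. fourier f \<xi> * cnj (fourier f \<xi>))"
    using J by (simp add: if_distrib sum.delta cong: if_cong)
  also have "\<dots> = of_real S" by (simp only: S_def of_real_sum complex_norm_square)
  finally have ss: "integral\<^sup>L haar_measure (\<lambda>x. s x * cnj (s x)) = of_real S" .
  have ff: "integral\<^sup>L haar_measure (\<lambda>x. f x * cnj (f x)) = of_real (sqnorm f)"
    by (simp only: sqnorm_def complex_norm_square[symmetric] integral_complex_of_real)
  have i: "integrable haar_measure (\<lambda>x. f x * cnj (f x))" "integrable haar_measure (\<lambda>x. f x * cnj (s x))"
    "integrable haar_measure (\<lambda>x. s x * cnj (f x))" "integrable haar_measure (\<lambda>x. s x * cnj (s x))"
    by (intro haar_integrable[OF cpt] continuous_intros f sc)+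
  have "complex_of_real (sqnorm (\<lambda>x. f x - s x)) = integral\<^sup>L haar_measure (\<lambda>x. (f x - s x) * cnj (f x - s x))"
    by (simp only: sqnorm_def complex_norm_square[symmetric] integral_complex_of_real)
  also have "\<dots> = integral\<^sup>L haar_measure (\<lambda>x. f x * cnj (f x) - f x * cnj (s x) - s x * cnj (f x) + s x * cnj (s x))"
    by (simp add: algebra_simps)
  also have "\<dots> = of_real (sqnorm f) - of_real S - of_real S + of_real S"
    using i by (simp add: ff fs sf ss)
  also have "\<dots> = of_real (sqnorm f - S)" by simp
  finally have "sqnorm (\<lambda>x. f x - s x) = sqnorm f - S" by (simp only: of_real_eq_iff)
  then show ?thesis using sqnorm_nonneg[OF cpt, of "\<lambda>x. f x - s x"] by (simp add: S_def)
qed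

end

section \<open>Square summable solutions of difference equations\<close>

definition weight :: "('d::finite \<Rightarrow> int) \<Rightarrow> int ^ 'd \<Rightarrow> int" where
  "weight w n = (\<Sum>i\<in>UNIV. w i * n $ i)"

lemma weight_add: "weight w (m + n) = weight w m + weight w n"
  by (simp add: weight_def distrib_left sum.distrib)

lemma weight_diff: "weight w (m - n) = weight w m - weight w n"
  by (simp add: weight_def right_diff_distrib sum_subtractf)

text \<open>The weights \<open>t ^ e i\<close> turn a vector into the value at \<open>t\<close> of a
  nonzero polynomial, and some integer is a root of none of finitely many nonzero
  polynomials.\<close>

lemma weight_nonzero:
  fixes D :: "(int ^ 'd) set"
  assumes "finite D" "0 \<notin> D"
  obtains w where "\<And>v. v \<in> D \<Longrightarrow> weight w v \<noteq> 0"
proof -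
  obtain e :: "'d \<Rightarrow> nat" where e: "inj e"
    using finite_imp_inj_to_nat_seg[of "UNIV :: 'd set"] by auto
  define p where "p v = (\<Sum>i\<in>UNIV. monom (v $ i) (e i))" for v :: "int ^ 'd"
  have "p v \<noteq> 0" if "v \<in> D" for v
  proof -
    have "v \<noteq> 0" using assms(2) that by auto
    then obtain i where i: "v $ i \<noteq> 0" by (auto simp: vec_eq_iff)
    have "coeff (p v) (e i) = (\<Sum>j\<in>UNIV. if e j = e i then v $ j else 0)"
      by (simp add: p_def coeff_sum)
    also have "\<dots> = (\<Sum>j\<in>UNIV. if j = i then v $ j else 0)"
      using e by (intro sum.cong) (auto dest: injD)
    also have "\<dots> = v $ i" by simp
    finally show ?thesis using i by auto
  qed
  then have "finite (\<Union>v\<in>D. {x. poly (p v) x = 0})" using assms(1) poly_roots_finite by blast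
  then obtain t where t: "t \<notin> (\<Union>v\<in>D. {x. poly (p v) x = 0})"
    using ex_new_if_finite[OF infinite_UNIV_int] by blast
  show ?thesis
  proof (rule that)
    fix v assume "v \<in> D"
    then have "poly (p v) t \<noteq> 0" using t by blast
    moreover have "poly (p v) t = weight (\<lambda>i. t ^ e i) v"
      by (simp add: p_def weight_def poly_sum poly_monom mult.commute)
    ultimately show "weight (\<lambda>i. t ^ e i) v \<noteq> 0" by simp
  qed
qed

text \<open>A weight that separates all exponents has a unique maximum on the support. It plays the
  part of a monomial order and makes the translates of \<open>f\<close> triangular.\<close>

lemma leading_exponent:
  fixes f :: "'d::finite laurent"
  assumes "f \<noteq> 0"
  obtains w n where "n \<in> Poly_Mapping.keys f"
    "\<And>m. m \<in> Poly_Mapping.keys f \<Longrightarrow> m \<noteq> n \<Longrightarrow> weight w m < weight w n"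
proof -
  let ?K = "Poly_Mapping.keys f"
  have K: "finite ?K" "?K \<noteq> {}" using assms by auto
  have "finite ((\<lambda>(m, n). m - n) ` (?K \<times> ?K) - {0})" using K by auto
  then obtain w where w: "\<And>v. v \<in> (\<lambda>(m, n). m - n) ` (?K \<times> ?K) - {0} \<Longrightarrow> weight w v \<noteq> 0"
    using weight_nonzero[of "(\<lambda>(m, n). m - n) ` (?K \<times> ?K) - {0}"] by auto
  have "Max (weight w ` ?K) \<in> weight w ` ?K" using K by (intro Max_in) auto
  then obtain n where n1: "n \<in> ?K" "weight w n = Max (weight w ` ?K)" by auto
  have n: "n \<in> ?K" "\<And>m. m \<in> ?K \<Longrightarrow> weight w m \<le> weight w n"
    using n1 K by auto
  show ?thesis
  proof (rule that[OF n(1)])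
    fix m assume m: "m \<in> ?K" "m \<noteq> n"
    have "m - n \<in> (\<lambda>(m, n). m - n) ` (?K \<times> ?K) - {0}"
      using m n(1) by (auto intro!: image_eqI[of _ _ "(m, n)"])
    then have "weight w m \<noteq> weight w n" using w weight_diff[of w m n] by fastforce
    then show "weight w m < weight w n" using n(2)[OF m(1)] by simp
  qed
qed

section \<open>Orthonormal families and a rank count in finite dimension\<close>

definition orthonormal_on :: "'b set \<Rightarrow> ('b \<Rightarrow> real) set \<Rightarrow> bool" where
  "orthonormal_on B E \<longleftrightarrow> (\<forall>e\<in>E. \<forall>e'\<in>E. (\<Sum>b\<in>B. e b * e' b) = (if e = e' then 1 else 0))"

lemma orthonormal_on_insert:
  assumes B: "finite B" and E: "orthonormal_on B E"
    and r: "(\<Sum>b\<in>B. (r b)\<^sup>2) > 0" "\<And>e. e \<in> E \<Longrightarrow> (\<Sum>b\<in>B. r b * e b) = 0"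
  defines "e' \<equiv> (\<lambda>b. r b / sqrt (\<Sum>b\<in>B. (r b)\<^sup>2))"
  shows "orthonormal_on B (insert e' E)" "e' \<notin> E"
proof -
  define s where "s = (\<Sum>b\<in>B. (r b)\<^sup>2)"
  have s: "s > 0" using r(1) by (simp add: s_def)
  have ee: "(\<Sum>b\<in>B. e' b * e' b) = 1"
  proof -
    have "(e' b)\<^sup>2 = (r b)\<^sup>2 / s" for b
      unfolding e'_def s_def[symmetric] power_divide using s by simp
    then have "e' b * e' b = (r b)\<^sup>2 / s" for b by (simp only: power2_eq_square)
    then have "(\<Sum>b\<in>B. e' b * e' b) = (\<Sum>b\<in>B. (r b)\<^sup>2 / s)" by (simp only:)
    also have "\<dots> = s / s" unfolding s_def by (rule sum_divide_distrib[symmetric])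
    finally show ?thesis using s by simp
  qed
  have eE: "(\<Sum>b\<in>B. e' b * e b) = 0" "(\<Sum>b\<in>B. e b * e' b) = 0" if "e \<in> E" for e
  proof -
    have "(\<Sum>b\<in>B. e' b * e b) = (\<Sum>b\<in>B. r b * e b) / sqrt s"
      by (simp add: e'_def s_def sum_divide_distrib)
    then show "(\<Sum>b\<in>B. e' b * e b) = 0" using r(2)[OF that] by simp
    then show "(\<Sum>b\<in>B. e b * e' b) = 0" by (simp add: mult.commute)
  qed
  show nE: "e' \<notin> E" using eE ee by force
  show "orthonormal_on B (insert e' E)"
    unfolding orthonormal_on_def
  proof (intro ballI)
    fix x y assume xy: "x \<in> insert e' E" "y \<in> insert e' E"
    show "(\<Sum>b\<in>B. x b * y b) = (if x = y then 1 else 0)"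
    proof (cases "x = e'")
      case True
      then show ?thesis using xy ee eE nE by auto
    next
      case False
      then show ?thesis using xy eE E nE by (auto simp: orthonormal_on_def)
    qed
  qed
qed

text \<open>Expand the square norm of the indicator of \<open>n\<close> minus its projection onto
  the span of \<open>E\<close>.\<close>

lemma orthonormal_on_Bessel:
  assumes B: "finite B" "n \<in> B" and E: "finite E" "orthonormal_on B E"
  shows "(\<Sum>e\<in>E. (e n)\<^sup>2) \<le> 1"
proof -
  define S where "S = (\<Sum>e\<in>E. (e n)\<^sup>2)"
  define s where "s b = (\<Sum>e\<in>E. e n * e b)" for b
  define d where "d b = (if b = n then 1 else 0 :: real)" for b
  have ds: "(\<Sum>b\<in>B. d b * s b) = S"
    using B by (simp add: d_def s_def S_def power2_eq_square if_distrib[of "\<lambda>x. x * _"] cong: if_cong)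
  have dd: "(\<Sum>b\<in>B. d b * d b) = 1"
    using B by (simp add: d_def if_distrib[of "\<lambda>x. x * _"] cong: if_cong)
  have "(\<Sum>b\<in>B. s b * s b) = (\<Sum>b\<in>B. \<Sum>e\<in>E. \<Sum>e'\<in>E. (e n * e' n) * (e b * e' b))"
    unfolding s_def sum_product by (simp add: mult_ac)
  also have "\<dots> = (\<Sum>e\<in>E. \<Sum>e'\<in>E. \<Sum>b\<in>B. (e n * e' n) * (e b * e' b))"
    by (subst sum.swap, intro sum.cong refl, subst sum.swap) (rule refl)
  also have "\<dots> = (\<Sum>e\<in>E. \<Sum>e'\<in>E. (e n * e' n) * (if e = e' then 1 else 0))"
    using E(2) unfolding orthonormal_on_def
    by (intro sum.cong refl) (simp add: sum_distrib_left[symmetric])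
  also have "\<dots> = S"
    using E(1) by (simp add: S_def power2_eq_square if_distrib cong: if_cong)
  finally have ss: "(\<Sum>b\<in>B. s b * s b) = S" .
  have "0 \<le> (\<Sum>b\<in>B. (d b - s b) * (d b - s b))" by (intro sum_nonneg) simp
  also have "\<dots> = (\<Sum>b\<in>B. d b * d b) - 2 * (\<Sum>b\<in>B. d b * s b) + (\<Sum>b\<in>B. s b * s b)"
    by (simp add: sum_distrib_left algebra_simps flip: sum.distrib sum_subtractf)
  finally show ?thesis unfolding ds dd ss S_def by simp
qed

text \<open>An index of least rank is added last: no vector of the earlier span sees its leading
  coordinate, so the residual keeps the nonzero entry there. The expansions in \<open>v\<close> are
  recorded so that a function orthogonal to all \<open>v i\<close> is orthogonal to
  \<open>E\<close>.\<close>

lemma triangular_Gram_Schmidt: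
  fixes v :: "'i \<Rightarrow> 'b \<Rightarrow> real" and rank :: "'i \<Rightarrow> int"
  assumes B: "finite B" and I: "finite I"
    and lead: "\<And>i. i \<in> I \<Longrightarrow> lead i \<in> B" "\<And>i. i \<in> I \<Longrightarrow> v i (lead i) \<noteq> 0"
    and tri: "\<And>i j. i \<in> I \<Longrightarrow> j \<in> I \<Longrightarrow> rank i \<le> rank j \<Longrightarrow> i \<noteq> j \<Longrightarrow> v j (lead i) = 0"
  shows "\<exists>E. finite E \<and> card E = card I \<and> orthonormal_on B E \<and>
    (\<forall>e\<in>E. \<exists>c. \<forall>b. e b = (\<Sum>j\<in>I. c j * v j b))"
  using I lead tri
proof (induction I rule: finite_ranking_induct[where f = "\<lambda>i. - rank i"])
  case empty
  then show ?case by (intro exI[of _ "{}"]) (auto simp: orthonormal_on_def)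
next
  case (insert x S)
  show ?case
  proof (cases "x \<in> S")
    case True
    then show ?thesis using insert by (simp add: insert_absorb)
  next
    case False
    have "\<exists>E. finite E \<and> card E = card S \<and> orthonormal_on B E \<and>
        (\<forall>e\<in>E. \<exists>c. \<forall>b. e b = (\<Sum>j\<in>S. c j * v j b))"
      by (rule insert.IH) (use insert.prems in auto)
    then obtain E where E: "finite E" "card E = card S" "orthonormal_on B E"
      "\<forall>e\<in>E. \<exists>c. \<forall>b. e b = (\<Sum>j\<in>S. c j * v j b)"
      by blast
    from bchoice[OF E(4)] obtain c where c: "\<And>e b. e \<in> E \<Longrightarrow> e b = (\<Sum>j\<in>S. c e j * v j b)"
      by blast
    define a where "a e = (\<Sum>b\<in>B. v x b * e b)" for e
    define r where "r b = v x b - (\<Sum>e\<in>E. a e * e b)" for b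
    have e0: "e (lead x) = 0" if "e \<in> E" for e
      unfolding c[OF that, of "lead x"]
    proof (intro sum.neutral ballI)
      fix j assume j: "j \<in> S"
      then have "v j (lead x) = 0" using insert(2)[of j] False by (intro insert.prems(3)) auto
      then show "c e j * v j (lead x) = 0" by simp
    qed
    have "r (lead x) = v x (lead x)" by (simp add: r_def e0)
    then have "(r (lead x))\<^sup>2 > 0" using insert.prems(2)[of x] by simp
    moreover have "(r (lead x))\<^sup>2 \<le> (\<Sum>b\<in>B. (r b)\<^sup>2)"
      using insert.prems(1)[of x] B by (intro member_le_sum) auto
    ultimately have pos: "(\<Sum>b\<in>B. (r b)\<^sup>2) > 0" by linarith
    have orth: "(\<Sum>b\<in>B. r b * e' b) = 0" if e': "e' \<in> E" for e'
    proof -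
      have "(\<Sum>b\<in>B. r b * e' b) = a e' - (\<Sum>b\<in>B. \<Sum>e\<in>E. a e * (e b * e' b))"
        by (simp add: r_def a_def left_diff_distrib sum_subtractf sum_distrib_right mult.assoc)
      also have "(\<Sum>b\<in>B. \<Sum>e\<in>E. a e * (e b * e' b)) = (\<Sum>e\<in>E. a e * (\<Sum>b\<in>B. e b * e' b))"
        by (subst sum.swap) (simp add: sum_distrib_left)
      also have "\<dots> = (\<Sum>e\<in>E. a e * (if e = e' then 1 else 0))"
        using E(3) e' by (intro sum.cong) (auto simp: orthonormal_on_def)
      also have "\<dots> = a e'" using E(1) e' by (simp add: if_distrib cong: if_cong)
      finally show ?thesis by simp
    qed
    define q where "q = sqrt (\<Sum>b\<in>B. (r b)\<^sup>2)"
    define e' where "e' = (\<lambda>b. r b / q)"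
    have new: "orthonormal_on B (insert e' E)" "e' \<notin> E"
      using orthonormal_on_insert[OF B E(3) pos orth] by (simp_all add: e'_def q_def)
    have span: "\<exists>c. \<forall>b. e b = (\<Sum>j\<in>insert x S. c j * v j b)" if "e \<in> insert e' E" for e
    proof (cases "e = e'")
      case True
      define c' where "c' j = (if j = x then 1 / q else - (\<Sum>e\<in>E. a e * c e j) / q)" for j
      have "e b = (\<Sum>j\<in>insert x S. c' j * v j b)" for b
      proof -
        have "(\<Sum>e\<in>E. a e * e b) = (\<Sum>e\<in>E. \<Sum>j\<in>S. a e * c e j * v j b)"
          using c by (intro sum.cong refl) (metis (no_types, lifting) mult.assoc sum.cong sum_distrib_left)
        also have "\<dots> = (\<Sum>j\<in>S. (\<Sum>e\<in>E. a e * c e j) * v j b)"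
          by (subst sum.swap) (simp add: sum_distrib_right)
        finally have "r b = v x b - (\<Sum>j\<in>S. (\<Sum>e\<in>E. a e * c e j) * v j b)" by (simp add: r_def)
        then have "e b = v x b / q - (\<Sum>j\<in>S. (\<Sum>e\<in>E. a e * c e j) / q * v j b)"
          by (simp only: True e'_def diff_divide_distrib sum_divide_distrib[of _ S] times_divide_eq_left)
        also have "\<dots> = c' x * v x b + (\<Sum>j\<in>S. c' j * v j b)"
        proof -
          have "(\<Sum>j\<in>S. c' j * v j b) = (\<Sum>j\<in>S. - ((\<Sum>e\<in>E. a e * c e j) / q * v j b))"
            using False by (intro sum.cong refl) (auto simp: c'_def)
          then show ?thesis by (simp add: c'_def sum_negf)
        qed
        also have "\<dots> = (\<Sum>j\<in>insert x S. c' j * v j b)" using insert(1) False by simp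
        finally show ?thesis .
      qed
      then show ?thesis by blast
    next
      case False': False
      then have eE: "e \<in> E" using that by simp
      have "e b = (\<Sum>j\<in>insert x S. (if j = x then 0 else c e j) * v j b)" for b
      proof -
        have "(\<Sum>j\<in>S. c e j * v j b) = (\<Sum>j\<in>S. (if j = x then 0 else c e j) * v j b)"
          using False by (intro sum.cong) auto
        then show ?thesis using insert(1) False c[OF eE, of b] by simp
      qed
      then show ?thesis by (intro exI[of _ "\<lambda>j. if j = x then 0 else c e j"]) blast
    qed
    show ?thesis
      using new E(1,2) insert(1) False span by (intro exI[of _ "insert e' E"]) auto
  qed
qed

text \<open>A rank count: if every coordinate of \<open>B\<close> is seen by a vector orthogonal to the independent
  family \<open>v\<close>, the family leaves a positive proportion of the dimension free.\<close>

lemma rank_bound: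
  fixes v :: "'i \<Rightarrow> 'b \<Rightarrow> real" and rank :: "'i \<Rightarrow> int" and h :: "'b \<Rightarrow> 'b \<Rightarrow> real"
  assumes B: "finite B" and I: "finite I"
    and lead: "\<And>i. i \<in> I \<Longrightarrow> lead i \<in> B" "\<And>i. i \<in> I \<Longrightarrow> v i (lead i) \<noteq> 0"
    and tri: "\<And>i j. i \<in> I \<Longrightarrow> j \<in> I \<Longrightarrow> rank i \<le> rank j \<Longrightarrow> i \<noteq> j \<Longrightarrow> v j (lead i) = 0"
    and a: "a \<noteq> 0" and h: "\<And>n. n \<in> B \<Longrightarrow> h n n = a"
      "\<And>n. n \<in> B \<Longrightarrow> (\<Sum>b\<in>B. (h n b)\<^sup>2) \<le> C"
      "\<And>n i. n \<in> B \<Longrightarrow> i \<in> I \<Longrightarrow> (\<Sum>b\<in>B. h n b * v i b) = 0"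
  shows "real (card B) * (a\<^sup>2 / C) \<le> real (card B) - real (card I)"
proof -
  obtain E where E: "finite E" "card E = card I" "orthonormal_on B E"
      "\<And>e. e \<in> E \<Longrightarrow> \<exists>c. \<forall>b. e b = (\<Sum>j\<in>I. c j * v j b)"
    using triangular_Gram_Schmidt[of B I lead v rank, OF B I lead tri] by auto
  have "(\<Sum>e\<in>E. (e n)\<^sup>2) \<le> 1 - a\<^sup>2 / C" if n: "n \<in> B" for n
  proof -
    define s where "s = (\<Sum>b\<in>B. (h n b)\<^sup>2)"
    have "(h n n)\<^sup>2 \<le> s" unfolding s_def using n B by (intro member_le_sum) auto
    then have s: "s > 0" "s \<le> C" using a h(1)[OF n] h(2)[OF n] by (auto simp: s_def intro: less_le_trans[of 0 "a\<^sup>2"])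
    have orth: "(\<Sum>b\<in>B. h n b * e b) = 0" if eE: "e \<in> E" for e
    proof -
      obtain c where c: "\<And>b. e b = (\<Sum>j\<in>I. c j * v j b)" using E(4)[OF eE] by blast
      have "(\<Sum>b\<in>B. h n b * e b) = (\<Sum>b\<in>B. \<Sum>j\<in>I. c j * (h n b * v j b))"
        by (simp add: c sum_distrib_left mult_ac)
      also have "\<dots> = (\<Sum>j\<in>I. c j * (\<Sum>b\<in>B. h n b * v j b))"
        by (subst sum.swap) (simp add: sum_distrib_left)
      finally show ?thesis using h(3)[OF n] by simp
    qed
    \<comment> \<open>Adding the normalised \<open>h n\<close> to \<open>E\<close> uses up at least
      \<open>a\<^sup>2 / C\<close> of Bessel's bound at \<open>n\<close>.\<close>
    define e' where "e' = (\<lambda>b. h n b / sqrt s)"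
    have new: "orthonormal_on B (insert e' E)" "e' \<notin> E"
      using orthonormal_on_insert[OF B E(3), of "h n"] orth s(1) by (simp_all add: e'_def s_def)
    have "(\<Sum>e\<in>insert e' E. (e n)\<^sup>2) \<le> 1"
      by (rule orthonormal_on_Bessel[OF B n _ new(1)]) (use E in simp)
    then have "a\<^sup>2 / s + (\<Sum>e\<in>E. (e n)\<^sup>2) \<le> 1"
      using E(1) new(2) s(1) h(1)[OF n] by (simp add: e'_def power_divide)
    moreover have "a\<^sup>2 / C \<le> a\<^sup>2 / s" using s by (intro divide_left_mono) auto
    ultimately show ?thesis by linarith
  qed
  then have "(\<Sum>n\<in>B. \<Sum>e\<in>E. (e n)\<^sup>2) \<le> (\<Sum>n\<in>B. 1 - a\<^sup>2 / C)" by (rule sum_mono)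
  \<comment> \<open>The trace of the projection onto the span of \<open>E\<close>, computed by
    summing over \<open>n\<close> first.\<close>
  moreover have "(\<Sum>n\<in>B. \<Sum>e\<in>E. (e n)\<^sup>2) = real (card I)"
  proof -
    have "(\<Sum>n\<in>B. \<Sum>e\<in>E. (e n)\<^sup>2) = (\<Sum>e\<in>E. \<Sum>n\<in>B. e n * e n)"
      by (subst sum.swap) (simp add: power2_eq_square)
    also have "\<dots> = (\<Sum>e\<in>E. 1)" using E(3) by (intro sum.cong) (auto simp: orthonormal_on_def)
    finally show ?thesis using E(2) by simp
  qed
  ultimately show ?thesis by (simp add: algebra_simps)
qed

section \<open>Cubes in the lattice, and vanishing of square summable solutions\<close>

definition cube :: "int \<Rightarrow> int \<Rightarrow> (int ^ 'd) set" where
  "cube a b = {n. \<forall>i. a \<le> n $ i \<and> n $ i < b}"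

lemma cube_image: "cube a b = vec_lambda ` (UNIV \<rightarrow>\<^sub>E {a..<b})"
proof (intro set_eqI iffI)
  fix n :: "int ^ 'd" assume "n \<in> cube a b"
  then show "n \<in> vec_lambda ` (UNIV \<rightarrow>\<^sub>E {a..<b})"
    by (intro image_eqI[of _ _ "vec_nth n"]) (auto simp: cube_def)
qed (auto simp: cube_def PiE_iff)

lemma finite_cube: "finite (cube a b)"
  unfolding cube_image by (intro finite_imageI finite_PiE) auto

lemma card_cube: "card (cube a b :: (int ^ 'd) set) = nat (b - a) ^ CARD('d)"
proof -
  have "inj_on (vec_lambda :: ('d \<Rightarrow> int) \<Rightarrow> _) X" for X by (rule inj_onI) (simp add: vec_lambda_inject)
  then have "card (cube a b :: (int ^ 'd) set) = card ((UNIV :: 'd set) \<rightarrow>\<^sub>E {a..<b})"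
    unfolding cube_image by (rule card_image)
  then show ?thesis by (simp add: card_PiE)
qed

lemma keys_bounded:
  fixes K :: "(int ^ 'd) set"
  assumes "finite K"
  obtains \<rho> :: nat where "\<And>n i. n \<in> K \<Longrightarrow> \<bar>n $ i\<bar> \<le> int \<rho>"
proof -
  define \<rho> where "\<rho> = nat (\<Sum>n\<in>K. \<Sum>i\<in>UNIV. \<bar>n $ i\<bar>)"
  have "\<bar>n $ i\<bar> \<le> int \<rho>" if "n \<in> K" for n i
  proof -
    have "\<bar>n $ i\<bar> \<le> (\<Sum>i\<in>UNIV. \<bar>n $ i\<bar>)" by (rule member_le_sum) auto
    also have "\<dots> \<le> (\<Sum>n\<in>K. \<Sum>i\<in>UNIV. \<bar>n $ i\<bar>)"
      using assms that by (intro member_le_sum) (auto intro: sum_nonneg)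
    also have "\<dots> = int \<rho>" by (simp add: \<rho>_def sum_nonneg)
    finally show ?thesis .
  qed
  then show ?thesis by (rule that)
qed

text \<open>Among the functions on a cube of side \<open>k\<close>, the reflected translates of
  \<open>f\<close> with index in the inner cube are triangular and orthogonal to all translates of
  \<open>h\<close>. The rank count bounds \<open>(h z)\<^sup>2 / C\<close> by the proportion of the
  boundary layer, which tends to 0.\<close>

lemma square_summable_kernel_real:
  fixes f :: "'d::finite laurent" and h :: "int ^ 'd \<Rightarrow> real"
  assumes f: "f \<noteq> 0"
    and C: "\<And>J. finite J \<Longrightarrow> (\<Sum>n\<in>J. (h n)\<^sup>2) \<le> C"
    and eq: "\<And>m. (\<Sum>n\<in>Poly_Mapping.keys f. of_int (Poly_Mapping.lookup f n) * h (m - n)) = 0"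
  shows "h z = 0"
proof (rule ccontr)
  assume hz: "h z \<noteq> 0"
  let ?K = "Poly_Mapping.keys f" and ?f = "\<lambda>n. real_of_int (Poly_Mapping.lookup f n)"
  have Cpos: "C > 0" using C[of "{z}"] hz by (smt (verit) finite.emptyI finite.insertI sum.empty sum.insert zero_less_power2 empty_iff)
  obtain w l where l: "l \<in> ?K" "\<And>m. m \<in> ?K \<Longrightarrow> m \<noteq> l \<Longrightarrow> weight w m < weight w l"
    using leading_exponent[OF f] by metis
  obtain \<rho> where \<rho>: "\<And>n i. n \<in> ?K \<Longrightarrow> \<bar>n $ i\<bar> \<le> int \<rho>" using keys_bounded[OF finite_keys] by metis
  have bound: "(h z)\<^sup>2 / C \<le> 1 - (1 - 2 * real \<rho> / real k) ^ CARD('d)" if k: "k > 2 * \<rho>" for k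
  proof -
    define B :: "(int ^ 'd) set" where "B = cube 0 (int k)"
    define I :: "(int ^ 'd) set" where "I = cube (int \<rho>) (int k - int \<rho>)"
    have BI: "finite B" "finite I" by (simp_all add: B_def I_def finite_cube)
    have sub: "i - n \<in> B" if "i \<in> I" "n \<in> ?K" for i n
      unfolding B_def cube_def
    proof (intro CollectI allI)
      fix j
      have "int \<rho> \<le> i $ j" "i $ j < int k - int \<rho>" using that(1) by (auto simp: I_def cube_def)
      then show "0 \<le> (i - n) $ j \<and> (i - n) $ j < int k" using \<rho>[OF that(2), of j] by (auto simp: abs_le_iff)
    qed
    \<comment> \<open>Translating \<open>h\<close> by \<open>z - n\<close> puts the value
      \<open>h z\<close> on the diagonal for every \<open>n\<close>.\<close>
    have "real (card B) * ((h z)\<^sup>2 / C) \<le> real (card B) - real (card I)"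
    proof (rule rank_bound[where lead = "\<lambda>i. i - l" and v = "\<lambda>i b. ?f (i - b)" and rank = "weight w"
          and h = "\<lambda>n b. h (b - n + z)", OF BI])
      show "?f (j - (i - l)) = 0" if "weight w i \<le> weight w j" "i \<noteq> j" for i j
      proof (rule ccontr)
        assume "?f (j - (i - l)) \<noteq> 0"
        then have "j - (i - l) \<in> ?K" by (simp add: in_keys_iff)
        moreover have "j - (i - l) \<noteq> l" using that(2) by (simp add: algebra_simps)
        ultimately have "weight w (j - (i - l)) < weight w l" using l(2) by blast
        then show False using that(1) by (simp add: weight_diff)
      qed
      show "(\<Sum>b\<in>B. (h (b - n + z))\<^sup>2) \<le> C" for n
      proof -
        have "(\<Sum>b\<in>B. (h (b - n + z))\<^sup>2) = (\<Sum>b\<in>(\<lambda>b. b - n + z) ` B. (h b)\<^sup>2)"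
          by (subst sum.reindex) (auto intro: inj_onI)
        also have "\<dots> \<le> C" by (rule C) (use BI in simp)
        finally show ?thesis .
      qed
      show "(\<Sum>b\<in>B. h (b - n + z) * ?f (i - b)) = 0" if i: "i \<in> I" for n i
      proof -
        have "(\<Sum>b\<in>B. h (b - n + z) * ?f (i - b)) = (\<Sum>b\<in>(\<lambda>m. i - m) ` ?K. h (b - n + z) * ?f (i - b))"
        proof (rule sum.mono_neutral_right[OF BI(1)])
          show "(\<lambda>m. i - m) ` ?K \<subseteq> B" using sub[OF i] by auto
          show "\<forall>b\<in>B - (\<lambda>m. i - m) ` ?K. h (b - n + z) * ?f (i - b) = 0"
          proof
            fix b assume b: "b \<in> B - (\<lambda>m. i - m) ` ?K"
            then have "i - b \<notin> ?K" by (auto simp: image_iff)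
            then show "h (b - n + z) * ?f (i - b) = 0" by (simp add: in_keys_iff)
          qed
        qed
        also have "\<dots> = (\<Sum>m\<in>?K. ?f m * h ((i - n + z) - m))"
          by (subst sum.reindex) (auto intro: inj_onI simp: algebra_simps)
        also have "\<dots> = 0" by (rule eq)
        finally show ?thesis .
      qed
      show "i - l \<in> B" if "i \<in> I" for i using sub[OF that l(1)] .
      show "?f (i - (i - l)) \<noteq> 0" for i using l(1) by (simp add: in_keys_iff)
    qed (use hz in simp_all)
    moreover have cB: "real (card B) = real k ^ CARD('d)" by (simp add: B_def card_cube)
    moreover have "real (card I) = (real k - 2 * real \<rho>) ^ CARD('d)"
    proof -
      have "real (nat (int k - int \<rho> - int \<rho>)) = real k - 2 * real \<rho>" using k by linarith
      then show ?thesis by (simp add: I_def card_cube)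
    qed
    ultimately have "real k ^ CARD('d) * ((h z)\<^sup>2 / C) \<le> real k ^ CARD('d) - (real k - 2 * real \<rho>) ^ CARD('d)" by simp
    also have "real k - 2 * real \<rho> = real k * (1 - 2 * real \<rho> / real k)" using k by (simp add: field_simps)
    also have "real k ^ CARD('d) - (real k * (1 - 2 * real \<rho> / real k)) ^ CARD('d) =
        real k ^ CARD('d) * (1 - (1 - 2 * real \<rho> / real k) ^ CARD('d))"
      
      unfolding power_mult_distrib by (simp only: right_diff_distrib mult_1_right)
    finally show ?thesis using k by (subst (asm) mult_le_cancel_left_pos) auto
  qed
  have "(\<lambda>k. 1 - (1 - 2 * real \<rho> / real k) ^ CARD('d)) \<longlonglongrightarrow> 1 - (1 - 0) ^ CARD('d)"
    by (intro tendsto_intros real_tendsto_divide_at_top filterlim_real_sequentially)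
  then have "(\<lambda>k. 1 - (1 - 2 * real \<rho> / real k) ^ CARD('d)) \<longlonglongrightarrow> 0" by simp
  then have "(h z)\<^sup>2 / C \<le> 0"
    by (rule tendsto_lowerbound) (auto intro!: exI[of _ "Suc (2 * \<rho>)"] bound simp: eventually_sequentially)
  then show False using hz Cpos by (simp add: divide_le_0_iff)
qed

lemma square_summable_kernel:
  fixes f :: "'d::finite laurent" and h :: "int ^ 'd \<Rightarrow> complex"
  assumes f: "f \<noteq> 0"
    and C: "\<And>J. finite J \<Longrightarrow> (\<Sum>n\<in>J. (cmod (h n))\<^sup>2) \<le> C"
    and eq: "\<And>m. (\<Sum>n\<in>Poly_Mapping.keys f. of_int (Poly_Mapping.lookup f n) * h (m - n)) = 0"
  shows "h z = 0"
proof -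
  have "Re (h z) = 0"
  proof (rule square_summable_kernel_real[OF f, of "\<lambda>n. Re (h n)" C])
    show "(\<Sum>n\<in>J. (Re (h n))\<^sup>2) \<le> C" if "finite J" for J
      by (rule order_trans[OF sum_mono C[OF that]]) (simp add: cmod_power2)
    show "(\<Sum>n\<in>Poly_Mapping.keys f. of_int (Poly_Mapping.lookup f n) * Re (h (m - n))) = 0" for m
      using arg_cong[OF eq[of m], of Re] by simp
  qed
  moreover have "Im (h z) = 0"
  proof (rule square_summable_kernel_real[OF f, of "\<lambda>n. Im (h n)" C])
    show "(\<Sum>n\<in>J. (Im (h n))\<^sup>2) \<le> C" if "finite J" for J
      by (rule order_trans[OF sum_mono C[OF that]]) (simp add: cmod_power2)
    show "(\<Sum>n\<in>Poly_Mapping.keys f. of_int (Poly_Mapping.lookup f n) * Im (h (m - n))) = 0" for m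
      using arg_cong[OF eq[of m], of Im] by simp
  qed
  ultimately show ?thesis by (simp add: complex_eq_iff)
qed

section \<open>Rigidity for torsion dual modules\<close>

lemma action_props:
  fixes \<alpha> :: "int ^ 'd \<Rightarrow> 'a::{topological_ab_group_add, metric_space} \<Rightarrow> 'a"
  assumes "algebraic_action \<alpha>"
  shows "compact (UNIV :: 'a set)" "continuous_automorphism (\<alpha> n)" "continuous_on UNIV (\<alpha> n)"
    "\<alpha> n (x + y) = \<alpha> n x + \<alpha> n y" "\<alpha> (m + n) x = \<alpha> m (\<alpha> n x)" "\<alpha> 0 x = x"
    "\<alpha> n (\<alpha> (- n) x) = x" "\<alpha> (- n) (\<alpha> n x) = x" "surj (\<alpha> n)"
proof -
  show c: "compact (UNIV :: 'a set)" "\<And>n. continuous_automorphism (\<alpha> n)"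
    using assms by (auto simp: algebraic_action_def)
  show "continuous_on UNIV (\<alpha> n)" "\<alpha> n (x + y) = \<alpha> n x + \<alpha> n y" "surj (\<alpha> n)"
    using c(2)[of n] by (auto simp: continuous_automorphism_def homeomorphism_def Modules.additive_def)
  show add: "\<And>m n x. \<alpha> (m + n) x = \<alpha> m (\<alpha> n x)" using assms by (auto simp: algebraic_action_def)
  show z: "\<And>x. \<alpha> 0 x = x" by (rule algebraic_action_0[OF assms])
  show "\<alpha> n (\<alpha> (- n) x) = x" "\<alpha> (- n) (\<alpha> n x) = x"
    using add[of n "- n" x] add[of "- n" n x] z by auto
qed

text \<open>If a nonzero \<open>n\<close> fixed \<open>\<xi>\<close>, preimages of open sets under
  \<open>\<xi>\<close> would be invariant under the infinitely many multiples of \<open>n\<close>,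
  and mixing would force their measure to be 0 or 1. But disjoint discs around 1 and around another
  value of \<open>\<xi>\<close> both have preimages of positive measure.\<close>

lemma mixing_stabilizer:
  fixes \<alpha> :: "int ^ 'd \<Rightarrow> 'a::{topological_ab_group_add, metric_space} \<Rightarrow> 'a"
  assumes \<alpha>: "algebraic_action \<alpha>" and mix: "mixing \<alpha>" and \<xi>: "\<xi> \<noteq> 0"
    and inv: "\<And>x. eval_character \<xi> (\<alpha> n x) = eval_character \<xi> x"
  shows "n = 0"
proof (rule ccontr)
  assume n: "n \<noteq> 0"
  note ap = action_props[OF \<alpha>]
  note cpt = ap(1)
  interpret prob_space "haar_measure :: 'a measure" by (rule haar_prob[OF cpt])
  define m where "m k = (\<chi> i. int k * n $ i)" for k
  have mS: "m (Suc k) = n + m k" for k by (simp add: m_def vec_eq_iff algebra_simps)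
  have m0: "m 0 = 0" by (simp add: m_def vec_eq_iff)
  have "inj m"
  proof (rule injI)
    fix j k assume "m j = m k"
    moreover obtain i where "n $ i \<noteq> 0" using n by (auto simp: vec_eq_iff)
    ultimately show "j = k" by (auto simp: m_def vec_eq_iff)
  qed
  then have inf: "infinite (range m)" using finite_imageD[of m UNIV] by auto
  have invm: "eval_character \<xi> (\<alpha> (m k) x) = eval_character \<xi> x" for k x
    by (induction k) (simp_all add: m0 mS ap(5,6) inv)
  have zero_one: "prob A = prob A * prob A" if S: "open S" and A: "A = eval_character \<xi> -` S" for S A
  proof (rule ccontr)
    assume ne: "prob A \<noteq> prob A * prob A"
    have "open A" unfolding A by (intro open_vimage S eval_character_props)
    then have "A \<in> sets borel" by simp
    then have lim: "((\<lambda>k. prob (A \<inter> \<alpha> k ` A)) \<longlongrightarrow> prob A * prob A) cofinite"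
      using mix unfolding mixing_def by blast
    have im: "\<alpha> (m k) ` A = A" for k
    proof (intro set_eqI iffI)
      fix x assume "x \<in> A"
      then have "\<alpha> (- m k) x \<in> A" using invm[of k "\<alpha> (- m k) x"] by (simp add: A ap(7))
      then show "x \<in> \<alpha> (m k) ` A" by (intro image_eqI[of _ _ "\<alpha> (- m k) x"]) (simp_all add: ap(7))
    qed (auto simp: A invm)
    have "\<forall>\<^sub>F k in cofinite. dist (prob (A \<inter> \<alpha> k ` A)) (prob A * prob A) < dist (prob A) (prob A * prob A)"
      using ne by (intro tendstoD[OF lim]) simp
    then have "finite {k. \<not> dist (prob (A \<inter> \<alpha> k ` A)) (prob A * prob A) < dist (prob A) (prob A * prob A)}"
      by (simp add: eventually_cofinite)
    moreover have "range m \<subseteq> {k. \<not> dist (prob (A \<inter> \<alpha> k ` A)) (prob A * prob A) < dist (prob A) (prob A * prob A)}"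
      using im by auto
    ultimately show False using inf finite_subset by blast
  qed
  obtain a where a: "eval_character \<xi> a \<noteq> 1" using \<xi> character_eqI[of \<xi> 0] by auto
  define z where "z = eval_character \<xi> a"
  define d where "d = dist z 1 / 2"
  have d: "d > 0" using a by (simp add: d_def z_def)
  define A where "A w = eval_character \<xi> -` ball w d" for w
  have Ao: "open (A w)" for w unfolding A_def by (intro open_vimage eval_character_props) simp
  have "0 \<in> A 1" "a \<in> A z" using d by (auto simp: A_def z_def eval_character_props(4))
  then have pos: "prob (A 1) > 0" "prob (A z) > 0" using haar_open_pos[OF cpt Ao] by auto
  have "A 1 \<inter> A z = {}"
  proof (rule ccontr)
    assume "A 1 \<inter> A z \<noteq> {}"
    then obtain x where "dist 1 (eval_character \<xi> x) < d" "dist z (eval_character \<xi> x) < d" by (auto simp: A_def)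
    then have "dist z 1 < d + d" using dist_triangle2[of z 1 "eval_character \<xi> x"] by linarith
    then show False by (simp add: d_def)
  qed
  then have "prob (A 1) + prob (A z) = prob (A 1 \<union> A z)"
    using Ao by (intro finite_measure_Union[symmetric]) (auto simp: haar_sets[OF cpt])
  also have "\<dots> \<le> 1" by simp
  finally have "prob (A 1) < 1" using pos by simp
  moreover have "prob (A 1) = prob (A 1) * prob (A 1)" by (rule zero_one[of "ball 1 d"]) (simp_all add: A_def)
  ultimately show False using pos by simp
qed

lemma mixing_orbit_inj:
  fixes \<alpha> :: "int ^ 'd \<Rightarrow> 'a::{topological_ab_group_add, metric_space} \<Rightarrow> 'a"
  assumes \<alpha>: "algebraic_action \<alpha>" and mix: "mixing \<alpha>" and \<xi>: "\<xi> \<noteq> 0"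
  shows "inj (\<lambda>n. dual_map (\<alpha> n) \<xi>)"
proof (rule injI)
  note ap = action_props[OF \<alpha>]
  fix m n assume eq: "dual_map (\<alpha> m) \<xi> = dual_map (\<alpha> n) \<xi>"
  have eq': "eval_character \<xi> (\<alpha> m x) = eval_character \<xi> (\<alpha> n x)" for x
    using arg_cong[OF eq, of "\<lambda>\<xi>. eval_character \<xi> x"] by (simp add: eval_dual_map ap(2))
  have "eval_character \<xi> (\<alpha> (m - n) x) = eval_character \<xi> x" for x
    using eq'[of "\<alpha> (- n) x"] ap(5)[of m "- n" x] by (simp add: ap(7))
  then have "m - n = 0" by (rule mixing_stabilizer[OF \<alpha> mix \<xi>])
  then show "m = n" by simp
qed

text \<open>Once the mean of \<open>F\<close> is subtracted, integration shows that the constant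
  becomes 0. Mean zero also excludes the trivial character, whose orbit is a single point. Besides
  rigidity, this shows that the map built from a free element is not affine.\<close>

lemma difference_operator_constant:
  fixes \<alpha> :: "int ^ 'd \<Rightarrow> 'a::{topological_ab_group_add, metric_space} \<Rightarrow> 'a" and F :: "'a \<Rightarrow> real"
  assumes \<alpha>: "algebraic_action \<alpha>" and mix: "mixing \<alpha>" and F: "continuous_on UNIV F" and f: "f \<noteq> 0"
    and const: "\<And>x. (\<Sum>n\<in>Poly_Mapping.keys f. of_int (Poly_Mapping.lookup f n) * F (\<alpha> n x)) = c"
  shows "F x = F y"
proof -
  note ap = action_props[OF \<alpha>]
  note cpt = ap(1)
  define M where "M = integral\<^sup>L haar_measure F"
  define G where "G x = complex_of_real (F x - M)" for x
  have Gc: "continuous_on UNIV G" unfolding G_def by (intro continuous_intros F)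
  have Gac: "continuous_on UNIV (\<lambda>x. G (\<alpha> n x))" for n
    by (rule continuous_on_compose2[OF Gc ap(3)]) simp
  have G0: "integral\<^sup>L haar_measure G = 0"
  proof -
    have "integral\<^sup>L haar_measure (\<lambda>x. F x - M) = 0"
      using haar_integrable[OF cpt F] haar_const[OF cpt, of M] haar_integrable[OF cpt continuous_on_const[of _ M]]
      by (simp only: Bochner_Integration.integral_diff M_def diff_self)
    then show ?thesis unfolding G_def integral_complex_of_real by simp
  qed
  define k where "k = (\<Sum>n\<in>Poly_Mapping.keys f. of_int (Poly_Mapping.lookup f n) * M)"
  have sumG: "(\<Sum>n\<in>Poly_Mapping.keys f. of_int (Poly_Mapping.lookup f n) * G (\<alpha> n x)) = complex_of_real (c - k)" for x
  proof -
    have "(\<Sum>n\<in>Poly_Mapping.keys f. of_int (Poly_Mapping.lookup f n) * G (\<alpha> n x)) =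
        complex_of_real (\<Sum>n\<in>Poly_Mapping.keys f. of_int (Poly_Mapping.lookup f n) * (F (\<alpha> n x) - M))"
      by (simp add: G_def)
    also have "(\<Sum>n\<in>Poly_Mapping.keys f. of_int (Poly_Mapping.lookup f n) * (F (\<alpha> n x) - M)) = c - k"
      using const[of x] by (simp add: k_def right_diff_distrib sum_subtractf)
    finally show ?thesis .
  qed
  have Ga0: "integral\<^sup>L haar_measure (\<lambda>x. G (\<alpha> n x)) = 0" for n
    using haar_epimorphism[OF cpt ap(3) ap(4) ap(9) Gc] G0 by simp
  have ck: "complex_of_real (c - k) = 0"
  proof -
    have "complex_of_real (c - k) = integral\<^sup>L haar_measure (\<lambda>x::'a. complex_of_real (c - k))"
      by (rule haar_const[OF cpt, symmetric])
    also have "\<dots> = (\<Sum>n\<in>Poly_Mapping.keys f. of_int (Poly_Mapping.lookup f n) * integral\<^sup>L haar_measure (\<lambda>x. G (\<alpha> n x)))"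
    proof -
      have "integral\<^sup>L haar_measure (\<lambda>x::'a. complex_of_real (c - k)) = integral\<^sup>L haar_measure
          (\<lambda>x. \<Sum>n\<in>Poly_Mapping.keys f. of_int (Poly_Mapping.lookup f n) * G (\<alpha> n x))"
        by (rule Bochner_Integration.integral_cong[OF refl]) (rule sumG[symmetric])
      then show ?thesis using haar_integrable[OF cpt Gac] by simp
    qed
    finally show ?thesis by (simp add: Ga0)
  qed
  have "G = (\<lambda>x. 0)"
  proof (rule ccontr)
    assume "G \<noteq> (\<lambda>x. 0)"
    then obtain \<xi> :: "'a character" where
        "integral\<^sup>L haar_measure (\<lambda>x. G x * cnj (eval_character \<xi> x)) \<noteq> 0"
      by (rule fourier_coefficient_nonzero[OF cpt Gc])
    then have \<xi>: "fourier G \<xi> \<noteq> 0" by (simp add: fourier_def)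
    have "\<xi> \<noteq> 0" using \<xi> G0 by (auto simp: fourier_def)
    note inj = mixing_orbit_inj[OF \<alpha> mix this]
    define h where "h m = fourier G (dual_map (\<alpha> m) \<xi>)" for m
    have h_eq: "h m = integral\<^sup>L haar_measure (\<lambda>x. G x * cnj (eval_character \<xi> (\<alpha> m x)))" for m
      by (simp add: h_def fourier_def eval_dual_map ap(2))
    have xc: "continuous_on UNIV (\<lambda>x. eval_character \<xi> (\<alpha> m x))" for m
      by (rule continuous_on_compose2[OF eval_character_props(1) ap(3)]) simp
    have "h 0 = 0"
    proof (rule square_summable_kernel[OF f, of h "sqnorm G"])
      fix J :: "(int ^ 'd) set" assume J: "finite J"
      have "(\<Sum>n\<in>J. (cmod (h n))\<^sup>2) = (\<Sum>\<eta>\<in>(\<lambda>n. dual_map (\<alpha> n) \<xi>) ` J. (cmod (fourier G \<eta>))\<^sup>2)"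
        by (subst sum.reindex) (auto intro: inj_on_subset[OF inj] simp: h_def)
      also have "\<dots> \<le> sqnorm G" by (rule Bessel[OF cpt Gc]) (use J in simp)
      finally show "(\<Sum>n\<in>J. (cmod (h n))\<^sup>2) \<le> sqnorm G" .
    next
      fix m
      \<comment> \<open>Invariance of Haar measure under \<open>\<alpha> n\<close> moves the
        translation from the function to the index.\<close>
      have shift: "h (m - n) = integral\<^sup>L haar_measure (\<lambda>x. G (\<alpha> n x) * cnj (eval_character \<xi> (\<alpha> m x)))" for n
      proof -
        have "h (m - n) = integral\<^sup>L haar_measure (\<lambda>x. G (\<alpha> n x) * cnj (eval_character \<xi> (\<alpha> (m - n) (\<alpha> n x))))"
          unfolding h_eq
          by (rule haar_epimorphism[OF cpt ap(3) ap(4) ap(9), symmetric]) (intro continuous_intros Gc xc)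
        moreover have "\<alpha> (m - n) (\<alpha> n x) = \<alpha> m x" for x using ap(5)[of "m - n" n x] by simp
        ultimately show ?thesis by simp
      qed
      have i: "integrable haar_measure (\<lambda>x. G (\<alpha> n x) * cnj (eval_character \<xi> (\<alpha> m x)))" for n
        by (intro haar_integrable[OF cpt] continuous_intros Gac xc)
      have "(\<Sum>n\<in>Poly_Mapping.keys f. of_int (Poly_Mapping.lookup f n) * h (m - n)) =
          integral\<^sup>L haar_measure (\<lambda>x. \<Sum>n\<in>Poly_Mapping.keys f. of_int (Poly_Mapping.lookup f n) * (G (\<alpha> n x) * cnj (eval_character \<xi> (\<alpha> m x))))"
        unfolding shift using i by simp
      also have "\<dots> = integral\<^sup>L haar_measure (\<lambda>x. (\<Sum>n\<in>Poly_Mapping.keys f. of_int (Poly_Mapping.lookup f n) * G (\<alpha> n x)) * cnj (eval_character \<xi> (\<alpha> m x)))"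
        by (simp add: sum_distrib_right mult.assoc)
      also have "\<dots> = 0" unfolding sumG ck by simp
      finally show "(\<Sum>n\<in>Poly_Mapping.keys f. of_int (Poly_Mapping.lookup f n) * h (m - n)) = 0" .
    qed
    then show False using \<xi> by (simp add: h_eq fourier_def ap(6))
  qed
  then have "F x = M" for x unfolding G_def by (simp add: fun_eq_iff)
  then show ?thesis by simp
qed

definition torsion_dual :: "(int ^ 'd \<Rightarrow> 'a::topological_ab_group_add \<Rightarrow> 'a) \<Rightarrow> bool" where
  "torsion_dual \<alpha> \<longleftrightarrow> (\<forall>a. \<exists>f. f \<noteq> 0 \<and> dual_scale \<alpha> f a = 0)"

lemma eval_dual_scale:
  assumes "algebraic_action \<alpha>"
  shows "eval_character (dual_scale \<alpha> f a) x =
    (\<Prod>n\<in>Poly_Mapping.keys f. eval_character a (\<alpha> n x) powi Poly_Mapping.lookup f n)"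
  by (rule eval_dual_scale_superset[OF assms]) auto

text \<open>Inserting the decomposition of \<open>a\<close> composed with \<open>\<phi>\<close> into
  the relation \<open>dual_scale \<alpha>2 f a = 0\<close> writes 1 as a constant times a character
  times \<open>exp (\<i> * G)\<close> with \<open>G\<close> of mean 0. Uniqueness gives
  \<open>G = 0\<close>, which is a difference equation for \<open>F\<close>.\<close>

lemma character_of_equivariant_map:
  fixes \<alpha>1 :: "int ^ 'd \<Rightarrow> 'a::{topological_ab_group_add, metric_space} \<Rightarrow> 'a"
    and \<alpha>2 :: "int ^ 'd \<Rightarrow> 'b::{topological_ab_group_add, metric_space} \<Rightarrow> 'b"
  assumes \<alpha>1: "algebraic_action \<alpha>1" and \<alpha>2: "algebraic_action \<alpha>2"
    and conn: "connected (UNIV :: 'a set)" and mix: "mixing \<alpha>1"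
    and \<phi>: "continuous_on UNIV \<phi>" "equivariant \<alpha>1 \<alpha>2 \<phi>"
    and f: "f \<noteq> 0" "dual_scale \<alpha>2 f a = 0"
  obtains c \<xi> where "\<And>x. eval_character a (\<phi> x) = c * eval_character \<xi> x"
proof -
  note ap = action_props[OF \<alpha>1]
  note cpt = ap(1)
  have "continuous_on UNIV (\<lambda>x. eval_character a (\<phi> x))"
    by (rule continuous_on_compose2[OF eval_character_props(1) \<phi>(1)]) simp
  then obtain c \<xi> and F :: "'a \<Rightarrow> real" where F: "continuous_on UNIV F" "integral\<^sup>L haar_measure F = 0"
    and dec: "\<And>x. eval_character a (\<phi> x) = c * eval_character \<xi> x * exp (\<i> * of_real (F x))"
    by (rule circle_map_decomposition[OF cpt conn _ eval_character_props(2)]) (rule that)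
  let ?K = "Poly_Mapping.keys f" and ?f = "Poly_Mapping.lookup f"
  define C where "C = (\<Prod>n\<in>?K. c powi ?f n)"
  define G where "G x = (\<Sum>n\<in>?K. of_int (?f n) * F (\<alpha>1 n x))" for x
  have Fac: "continuous_on UNIV (\<lambda>x. F (\<alpha>1 n x))" for n
    by (rule continuous_on_compose2[OF F(1) ap(3)]) simp
  have Gc: "continuous_on UNIV G" unfolding G_def by (intro continuous_intros Fac)
  have "integral\<^sup>L haar_measure G = (\<Sum>n\<in>?K. of_int (?f n) * integral\<^sup>L haar_measure (\<lambda>x. F (\<alpha>1 n x)))"
    unfolding G_def using haar_integrable[OF cpt Fac] by simp
  also have "\<dots> = 0" using haar_epimorphism[OF cpt ap(3) ap(4) ap(9) F(1)] F(2) by simp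
  finally have G0: "integral\<^sup>L haar_measure G = 0" .
  have eq: "C * eval_character (dual_scale \<alpha>1 f \<xi>) x * exp (\<i> * of_real (G x)) = 1" for x
  proof -
    have "1 = eval_character (dual_scale \<alpha>2 f a) (\<phi> x)" unfolding f(2) by simp
    also have "\<dots> = (\<Prod>n\<in>?K. eval_character a (\<alpha>2 n (\<phi> x)) powi ?f n)"
      by (rule eval_dual_scale[OF \<alpha>2])
    also have "\<dots> = (\<Prod>n\<in>?K. eval_character a (\<phi> (\<alpha>1 n x)) powi ?f n)"
      using \<phi>(2) by (simp add: equivariant_def fun_eq_iff)
    also have "\<dots> = (\<Prod>n\<in>?K. c powi ?f n * eval_character \<xi> (\<alpha>1 n x) powi ?f n *
        exp (\<i> * of_real (of_int (?f n) * F (\<alpha>1 n x))))"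
      unfolding dec by (simp add: power_int_mult_distrib exp_power_int mult_ac)
    also have "\<dots> = C * eval_character (dual_scale \<alpha>1 f \<xi>) x * exp (\<i> * of_real (G x))"
      by (simp add: prod.distrib C_def eval_dual_scale[OF \<alpha>1] G_def exp_sum sum_distrib_left)
    finally show ?thesis by simp
  qed
  have "G = (\<lambda>x. 0)"
  proof (rule circle_map_decomposition_unique(2)[OF cpt conn Gc G0])
    show "C \<noteq> 0" using eq[of 0] by auto
    show "C * eval_character (dual_scale \<alpha>1 f \<xi>) x * exp (\<i> * of_real (G x)) =
        1 * eval_character 0 x * exp (\<i> * of_real 0)" for x using eq[of x] by simp
  qed auto
  then have "(\<Sum>n\<in>?K. of_int (?f n) * F (\<alpha>1 n x)) = 0" for x by (simp add: G_def fun_eq_iff)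
  then have "F x = F 0" for x by (rule difference_operator_constant[OF \<alpha>1 mix F(1) f(1)])
  then have F0: "F x = F 0" for x .
  have "eval_character a (\<phi> x) = (c * exp (\<i> * of_real (F 0))) * eval_character \<xi> x" for x
    using dec[of x] unfolding F0[of x] by simp
  then show ?thesis by (rule that)
qed

lemma torsion_dual_imp_affine:
  fixes \<alpha>1 :: "int ^ 'd \<Rightarrow> 'a::{topological_ab_group_add, metric_space} \<Rightarrow> 'a"
    and \<alpha>2 :: "int ^ 'd \<Rightarrow> 'b::{topological_ab_group_add, metric_space} \<Rightarrow> 'b"
  assumes \<alpha>1: "algebraic_action \<alpha>1" and \<alpha>2: "algebraic_action \<alpha>2"
    and conn: "connected (UNIV :: 'a set)" and mix: "mixing \<alpha>1"
    and \<phi>: "continuous_on UNIV \<phi>" "equivariant \<alpha>1 \<alpha>2 \<phi>"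
    and tors: "torsion_dual \<alpha>2"
  shows "affine_map \<phi>"
proof -
  note cpt = action_props(1)[OF \<alpha>2]
  \<comment> \<open>The second difference of \<open>\<phi>\<close>. A constant of modulus 1 times a
    character has trivial second difference, and characters separate points.\<close>
  have "\<phi> (x + y) - \<phi> x - (\<phi> y - \<phi> 0) = 0" for x y
  proof (rule ccontr)
    assume "\<phi> (x + y) - \<phi> x - (\<phi> y - \<phi> 0) \<noteq> 0"
    then obtain a :: "'b character" where a: "eval_character a (\<phi> (x + y) - \<phi> x - (\<phi> y - \<phi> 0)) \<noteq> 1"
      using character_separates[OF cpt] by blast
    obtain f where f: "f \<noteq> 0" "dual_scale \<alpha>2 f a = 0" using tors by (auto simp: torsion_dual_def)
    obtain c \<xi> where c: "\<And>x. eval_character a (\<phi> x) = c * eval_character \<xi> x"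
      using character_of_equivariant_map[OF \<alpha>1 \<alpha>2 conn mix \<phi> f] by blast
    have unit: "c * cnj c = 1"
      using eval_character_props(6)[of a "\<phi> 0"] c[of 0] by (simp add: eval_character_props(4))
    have "eval_character a (\<phi> (x + y) - \<phi> x - (\<phi> y - \<phi> 0)) =
        (c * cnj c) * (c * cnj c) * (eval_character \<xi> x * cnj (eval_character \<xi> x)) *
        (eval_character \<xi> y * cnj (eval_character \<xi> y))"
      by (simp add: eval_character_diff c eval_character_props(3,4) mult_ac)
    also have "\<dots> = 1" by (simp add: unit eval_character_props(6))
    finally show False using a by simp
  qed
  then have add: "\<phi> (x + y) - \<phi> 0 = (\<phi> x - \<phi> 0) + (\<phi> y - \<phi> 0)" for x y
    by (metis (no_types, lifting) add.commute diff_add_cancel diff_diff_eq2 eq_iff_diff_eq_0 add_diff_eq)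
  show ?thesis
    unfolding affine_map_def
  proof (intro exI conjI allI)
    show "continuous_on UNIV (\<lambda>x. \<phi> x - \<phi> 0)" by (intro continuous_intros \<phi>)
    show "Modules.additive (\<lambda>x. \<phi> x - \<phi> 0)" by (rule Modules.additive.intro) (rule add)
    show "\<phi> x = (\<phi> x - \<phi> 0) + \<phi> 0" for x by simp
  qed
qed

section \<open>Simultaneous values of characters\<close>

text \<open>On the unit circle the squared modulus of \<open>1 + w\<close> is
  \<open>(1 + w)\<^sup>2 / w\<close>, so its powers are Laurent polynomials in \<open>w\<close> with
  positive coefficients.\<close>

lemma squared_kernel_expansion:
  assumes w: "cmod w = 1"
  shows "complex_of_real (((cmod (1 + w))\<^sup>2) ^ s) =
    (\<Sum>j\<le>2 * s. of_nat ((2 * s) choose j) * w powi (int j - int s))"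
proof -
  have w0: "w \<noteq> 0" using w by auto
  have "w * cnj w = 1" using w by (simp add: complex_norm_square[symmetric])
  then have cw: "cnj w = inverse w" by (metis inverse_unique)
  have "complex_of_real ((cmod (1 + w))\<^sup>2) = (1 + w)\<^sup>2 * inverse w"
    unfolding complex_norm_square complex_cnj_add complex_cnj_one cw
    using w0 by (simp add: field_simps power2_eq_square)
  then have "complex_of_real (((cmod (1 + w))\<^sup>2) ^ s) = ((1 + w)\<^sup>2 * inverse w) ^ s"
    by (simp only: of_real_power)
  also have "\<dots> = (w + 1) ^ (2 * s) * inverse w ^ s"
    by (simp add: power_mult_distrib power_mult add.commute)
  also have "\<dots> = (\<Sum>j\<le>2 * s. of_nat ((2 * s) choose j) * (w ^ j * inverse w ^ s))"
    unfolding binomial_ring by (simp add: sum_distrib_right mult.assoc)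
  also have "\<dots> = (\<Sum>j\<le>2 * s. of_nat ((2 * s) choose j) * w powi (int j - int s))"
    using w0 by (intro sum.cong refl) (simp add: power_int_diff power_inverse divide_inverse)
  finally show ?thesis .
qed

text \<open>On the unit circle the squared distances from \<open>w\<close> to 1 and to -1 add up to
  4.\<close>

lemma squared_kernel_bounds:
  assumes w: "cmod w = 1"
  shows "(cmod (1 + w))\<^sup>2 / 4 \<le> 1" "dist w 1 \<ge> e \<Longrightarrow> e \<ge> 0 \<Longrightarrow> (cmod (1 + w))\<^sup>2 / 4 \<le> 1 - e\<^sup>2 / 4"
proof -
  have "(Re w)\<^sup>2 + (Im w)\<^sup>2 = 1" using w cmod_power2[of w] by simp
  then have eq: "(cmod (1 + w))\<^sup>2 = 4 - (dist w 1)\<^sup>2"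
    unfolding dist_norm cmod_power2 by (simp add: power2_eq_square algebra_simps)
  show "(cmod (1 + w))\<^sup>2 / 4 \<le> 1" unfolding eq by simp
  show "(cmod (1 + w))\<^sup>2 / 4 \<le> 1 - e\<^sup>2 / 4" if "dist w 1 \<ge> e" "e \<ge> 0"
    unfolding eq using power_mono[OF that, of 2] by simp
qed

lemma poly_exp_limit:
  fixes \<rho> :: real
  assumes "0 \<le> \<rho>" "\<rho> < 1" "m > 0"
  shows "(\<lambda>s. (2 * real s) ^ m * \<rho> ^ s) \<longlonglongrightarrow> 0"
proof -
  define r where "r = root m \<rho>"
  have r: "0 \<le> r" "r < 1" "r ^ m = \<rho>" using assms by (auto simp: r_def)
  have "(\<lambda>s. (2 * (real s * r ^ s)) ^ m) \<longlonglongrightarrow> (2 * 0) ^ m"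
    using r by (intro tendsto_intros powser_times_n_limit_0) auto
  moreover have "(2 * (real s * r ^ s)) ^ m = (2 * real s) ^ m * \<rho> ^ s" for s
  proof -
    have "(2 * (real s * r ^ s)) ^ m = (2 * real s) ^ m * (r ^ m) ^ s"
      by (simp add: power_mult_distrib power_mult[symmetric] mult.commute)
    then show ?thesis by (simp add: r)
  qed
  ultimately have "(\<lambda>s. (2 * real s) ^ m * \<rho> ^ s) \<longlonglongrightarrow> (2 * 0) ^ m" by (simp only:)
  moreover have "(2 * 0 :: real) ^ m = 0" using assms(3) by simp
  ultimately show ?thesis by (simp only:)
qed

text \<open>The product of the kernels \<open>\<bar>(1 + w) / 2\<bar>\<^sup>2\<^sup>s\<close> concentrates at the target values, while its
  mean decays only polynomially in \<open>s\<close>.\<close>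

lemma character_values_dense:
  fixes b :: "'i \<Rightarrow> 'a::{topological_ab_group_add, metric_space} character"
  assumes cpt: "compact (UNIV :: 'a set)" and I: "finite I" and z: "\<And>i. i \<in> I \<Longrightarrow> cmod (z i) = 1"
    and compat: "\<And>k. (\<Sum>i\<in>I. int_scale (k i) (b i)) = 0 \<Longrightarrow> (\<Prod>i\<in>I. z i powi k i) = 1"
    and e: "e > 0"
  obtains x where "\<And>i. i \<in> I \<Longrightarrow> dist (eval_character (b i) x) (z i) < e"
proof (rule ccontr)
  assume "\<not> thesis"
  then have far: "\<exists>i\<in>I. e \<le> dist (eval_character (b i) x) (z i)" for x using that by (meson not_le)
  then have I0: "card I > 0" using I by (auto simp: card_gt_0_iff)
  define w where "w i x = eval_character (b i) x * cnj (z i)" for i x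
  have w1: "cmod (w i x) = 1" if "i \<in> I" for i x using z[OF that] by (simp add: w_def norm_mult eval_character_props(2))
  have wz: "dist (w i x) 1 = dist (eval_character (b i) x) (z i)" if "i \<in> I" for i x
  proof -
    have "z i * cnj (z i) = 1" using z[OF that] by (simp add: complex_norm_square[symmetric])
    then have "w i x - 1 = (eval_character (b i) x - z i) * cnj (z i)" by (simp add: w_def algebra_simps)
    then show ?thesis using z[OF that] by (simp add: dist_norm norm_mult)
  qed
  \<comment> \<open>Off the target, one factor divided by 4 is at most \<open>\<rho>\<close>. The
    maximum keeps \<open>\<rho>\<close> nonnegative when \<open>e\<close> is large.\<close>
  define \<rho> where "\<rho> = max 0 (1 - e\<^sup>2 / 4)"
  have \<rho>: "0 \<le> \<rho>" "\<rho> < 1" using e by (auto simp: \<rho>_def)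
  have bound: "1 \<le> (2 * real s) ^ card I * \<rho> ^ s" if s: "s > 0" for s
  proof -
    define G where "G x = (\<Prod>i\<in>I. ((cmod (1 + w i x))\<^sup>2) ^ s)" for x
    have Gc: "continuous_on UNIV G"
      unfolding G_def w_def by (intro continuous_intros eval_character_props)
    have "G x \<le> 4 ^ (s * card I) * \<rho> ^ s" for x
    proof -
      obtain i where i: "i \<in> I" "e \<le> dist (w i x) 1" using far[of x] wz by auto
      have "(cmod (1 + w i x))\<^sup>2 / 4 \<le> \<rho>"
        using squared_kernel_bounds(2)[OF w1[OF i(1)] i(2) less_imp_le[OF e]]
        by (rule order_trans) (simp add: \<rho>_def)
      then have 1: "((cmod (1 + w i x))\<^sup>2) ^ s \<le> (4 * \<rho>) ^ s" by (intro power_mono) auto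
      have "(cmod (1 + w j x))\<^sup>2 \<le> 4" if "j \<in> I" for j
        using squared_kernel_bounds(1)[OF w1[OF that]] by simp
      then have "(\<Prod>j\<in>I - {i}. ((cmod (1 + w j x))\<^sup>2) ^ s) \<le> (\<Prod>j\<in>I - {i}. 4 ^ s)"
        by (intro prod_mono conjI power_mono) auto
      then have "G x \<le> (4 * \<rho>) ^ s * (4 ^ s) ^ card (I - {i})"
        unfolding G_def prod.remove[OF I i(1)] 
        using 1 \<rho> by (intro mult_mono) (auto intro!: prod_nonneg)
      also have "\<dots> = (4 ^ s) ^ Suc (card (I - {i})) * \<rho> ^ s" by (simp add: power_mult_distrib)
      also have "Suc (card (I - {i})) = card I" using I i(1) I0 by simp
      finally show ?thesis by (simp add: power_mult)
    qed
    then have "integral\<^sup>L haar_measure G \<le> integral\<^sup>L haar_measure (\<lambda>x::'a. 4 ^ (s * card I) * \<rho> ^ s)"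
      by (intro integral_mono haar_integrable[OF cpt] Gc continuous_intros)
    then have up: "integral\<^sup>L haar_measure G \<le> 4 ^ (s * card I) * \<rho> ^ s" by (simp only: haar_const[OF cpt])
    define P where "P = I \<rightarrow>\<^sub>E {..2 * s}"
    have P: "finite P" unfolding P_def using I by (intro finite_PiE) auto
    define B where "B g = (\<Prod>i\<in>I. real ((2 * s) choose (g i)))" for g
    define k where "k g i = int (g i) - int s" for g :: "'i \<Rightarrow> nat" and i
    define c where "c g = (\<Sum>i\<in>I. int_scale (k g i) (b i))" for g
    define Z where "Z g = (\<Prod>i\<in>I. cnj (z i) powi k g i)" for g
    have G_exp: "complex_of_real (G x) = (\<Sum>g\<in>P. of_real (B g) * Z g * eval_character (c g) x)" for x
    proof -
      have "complex_of_real (G x) = (\<Prod>i\<in>I. \<Sum>j\<le>2 * s. of_nat ((2 * s) choose j) * w i x powi (int j - int s))"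
        unfolding G_def of_real_prod by (intro prod.cong refl squared_kernel_expansion w1)
      also have "\<dots> = (\<Sum>g\<in>P. \<Prod>i\<in>I. of_nat ((2 * s) choose (g i)) * w i x powi (int (g i) - int s))"
        unfolding P_def by (rule prod_sum_PiE) (use I in auto)
      also have "\<dots> = (\<Sum>g\<in>P. of_real (B g) * Z g * eval_character (c g) x)"
        by (intro sum.cong refl)
          (simp add: B_def Z_def c_def k_def w_def eval_character_sum eval_character_int_scale
            power_int_mult_distrib prod.distrib mult_ac)
      finally show ?thesis .
    qed
    \<comment> \<open>Only exponents forming a relation among the \<open>b i\<close> survive
      integration. Compatibility of \<open>z\<close> makes their phases trivial, so the surviving
      terms are nonnegative and any one of them bounds the integral from below.\<close>
    have Z1: "Z g = 1" if "c g = 0" for g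
    proof -
      have "(\<Prod>i\<in>I. z i powi k g i) = 1" using compat that unfolding c_def by blast
      then have "cnj (\<Prod>i\<in>I. z i powi k g i) = 1" by simp
      then show ?thesis by (simp add: Z_def)
    qed
    have "complex_of_real (integral\<^sup>L haar_measure G) = integral\<^sup>L haar_measure (\<lambda>x. complex_of_real (G x))" by simp
    also have "\<dots> = (\<Sum>g\<in>P. of_real (B g) * Z g * (if c g = 0 then 1 else 0))"
      unfolding G_exp using haar_integrable[OF cpt eval_character_props(1)]
      by (simp add: character_integral[OF cpt])
    also have "\<dots> = (\<Sum>g\<in>P. of_real (if c g = 0 then B g else 0))"
      using Z1 by (intro sum.cong refl) auto
    finally have Gint: "integral\<^sup>L haar_measure G = (\<Sum>g\<in>P. if c g = 0 then B g else 0)"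
      by (simp only: of_real_sum[symmetric] of_real_eq_iff)
    \<comment> \<open>The term with all exponents 0: it is a power of the central binomial
      coefficient, which is only polynomially smaller than \<open>4 ^ s\<close>.\<close>
    define g0 where "g0 = restrict (\<lambda>_. s) I"
    have g0: "g0 \<in> P" by (auto simp: P_def g0_def)
    have c0: "c g0 = 0"
      unfolding c_def by (intro sum.neutral ballI character_eqI) (simp add: k_def g0_def eval_character_int_scale)
    have "(4 ^ s / (2 * real s)) ^ card I \<le> (real ((2 * s) choose s)) ^ card I"
      by (intro power_mono central_binomial_lower_bound s) auto
    also have "\<dots> = (if c g0 = 0 then B g0 else 0)" using c0 by (simp add: B_def g0_def)
    also have "\<dots> \<le> integral\<^sup>L haar_measure G"
      unfolding Gint using g0 P by (intro member_le_sum) (auto simp: B_def intro: prod_nonneg)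
    also note up
    finally have "(4 ^ s) ^ card I / (2 * real s) ^ card I \<le> (4 ^ s) ^ card I * \<rho> ^ s"
      by (simp add: power_divide power_mult)
    then show ?thesis using s by (simp add: field_simps)
  qed
  have "(\<lambda>s. (2 * real s) ^ card I * \<rho> ^ s) \<longlonglongrightarrow> 0" by (rule poly_exp_limit[OF \<rho> I0])
  then have "(1::real) \<le> 0"
    by (rule tendsto_lowerbound[OF _ eventually_sequentiallyI[of 1]]) (simp_all only: bound sequentially_bot less_le_trans[OF zero_less_one] not_False_eq_True)
  then show False by simp
qed

section \<open>Topological entropy\<close>

lemma min_subcover_card_le:
  assumes V: "finite V" "\<Union>V = UNIV" and ref: "\<And>v. v \<in> V \<Longrightarrow> \<exists>w\<in>W. v \<subseteq> w"
  shows "min_subcover_card W \<le> card V"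
proof -
  obtain g where g: "\<And>v. v \<in> V \<Longrightarrow> g v \<in> W \<and> v \<subseteq> g v" using ref by metis
  have "\<Union>(g ` V) = UNIV" using V(2) g by blast
  then have "min_subcover_card W \<le> card (g ` V)"
    unfolding min_subcover_card_def using V(1) g by (intro Least_le exI[of _ "g ` V"]) auto
  also have "\<dots> \<le> card V" by (rule card_image_le[OF V(1)])
  finally show ?thesis .
qed

lemma min_subcover_card_attained:
  assumes "finite W" "\<Union>W = UNIV"
  obtains V where "V \<subseteq> W" "finite V" "\<Union>V = UNIV" "card V = min_subcover_card W"
proof -
  have "\<exists>V\<subseteq>W. finite V \<and> \<Union>V = UNIV \<and> card V = min_subcover_card W"
    unfolding min_subcover_card_def
    by (rule LeastI[of "\<lambda>k. \<exists>V\<subseteq>W. finite V \<and> \<Union>V = UNIV \<and> card V = k" "card W"]) (use assms in blast)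
  then show ?thesis using that by blast
qed

text \<open>Arbitrary index sets in place of boxes, for the subadditivity estimates over unions of
  translates.\<close>

definition join_over ::
    "(int ^ 'd \<Rightarrow> 'a \<Rightarrow> 'a) \<Rightarrow> (int ^ 'd) set \<Rightarrow> 'a set set \<Rightarrow> 'a set set" where
  "join_over \<alpha> S U = {(\<Inter>n\<in>S. \<alpha> (- n) ` c n) | c. \<forall>n\<in>S. c n \<in> U}"

lemma box_index_cube: "box_index k = cube 0 (int k)"
  by (simp add: box_index_def cube_def)

lemma join_cover_eq: "join_cover \<alpha> k U = join_over \<alpha> (cube 0 (int k)) U"
  unfolding join_cover_def join_over_def box_index_cube ..

context
  fixes \<alpha> :: "int ^ 'd \<Rightarrow> 'a::{topological_ab_group_add, metric_space} \<Rightarrow> 'a"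
    and U :: "'a set set"
  assumes \<alpha>: "algebraic_action \<alpha>" and U: "finite_open_cover U"
begin

lemma mem_image_action: "x \<in> \<alpha> (- n) ` A \<longleftrightarrow> \<alpha> n x \<in> A"
proof
  assume "\<alpha> n x \<in> A"
  then show "x \<in> \<alpha> (- n) ` A" by (intro image_eqI[of _ _ "\<alpha> n x"]) (simp_all add: action_props(8)[OF \<alpha>])
qed (auto simp: action_props(7)[OF \<alpha>])

lemma join_over_covers: "\<Union>(join_over \<alpha> S U) = UNIV"
proof -
  have "\<exists>u\<in>U. y \<in> u" for y using U by (auto simp: finite_open_cover_def)
  then obtain u where u: "\<And>y. u y \<in> U" "\<And>y. y \<in> u y" by metis
  have "x \<in> \<Union>(join_over \<alpha> S U)" for x
    unfolding join_over_def using u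
    by (intro UnionI[of "\<Inter>n\<in>S. \<alpha> (- n) ` u (\<alpha> n x)"]) (auto simp: mem_image_action)
  then show ?thesis by blast
qed

lemma join_over_finite:
  assumes S: "finite S"
  shows "finite (join_over \<alpha> S U)"
proof -
  have "join_over \<alpha> S U \<subseteq> (\<lambda>c. \<Inter>n\<in>S. \<alpha> (- n) ` c n) ` (S \<rightarrow>\<^sub>E U)"
  proof
    fix w assume "w \<in> join_over \<alpha> S U"
    then obtain c where c: "w = (\<Inter>n\<in>S. \<alpha> (- n) ` c n)" "\<forall>n\<in>S. c n \<in> U" by (auto simp: join_over_def)
    then show "w \<in> (\<lambda>c. \<Inter>n\<in>S. \<alpha> (- n) ` c n) ` (S \<rightarrow>\<^sub>E U)"
      by (intro image_eqI[of _ _ "restrict c S"]) auto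
  qed
  moreover have "finite (S \<rightarrow>\<^sub>E U)" using S U by (intro finite_PiE) (auto simp: finite_open_cover_def)
  ultimately show ?thesis by (meson finite_imageI finite_subset)
qed

definition complexity :: "(int ^ 'd) set \<Rightarrow> nat" where
  "complexity S = min_subcover_card (join_over \<alpha> S U)"

lemma complexity_subcover:
  assumes "finite S"
  obtains V where "V \<subseteq> join_over \<alpha> S U" "finite V" "\<Union>V = UNIV" "card V = complexity S"
  by (rule min_subcover_card_attained[OF join_over_finite[OF assms] join_over_covers])
    (auto intro: that simp: complexity_def)

lemma complexity_pos:
  assumes "finite S"
  shows "complexity S > 0"
proof -
  obtain V where V: "V \<subseteq> join_over \<alpha> S U" "finite V" "\<Union>V = UNIV" "card V = complexity S"
    by (rule complexity_subcover[OF assms])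
  then have "V \<noteq> {}" by auto
  then show ?thesis using V by (metis card_gt_0_iff)
qed

lemma complexity_mono:
  assumes "finite T" "S \<subseteq> T"
  shows "complexity S \<le> complexity T"
proof -
  obtain V where V: "V \<subseteq> join_over \<alpha> T U" "finite V" "\<Union>V = UNIV" "card V = complexity T"
    by (rule complexity_subcover[OF assms(1)])
  have "complexity S \<le> card V"
    unfolding complexity_def
  proof (rule min_subcover_card_le[OF V(2,3)])
    fix v assume "v \<in> V"
    then obtain c where c: "v = (\<Inter>n\<in>T. \<alpha> (- n) ` c n)" "\<forall>n\<in>T. c n \<in> U" using V(1) by (auto simp: join_over_def)
    have "(\<Inter>n\<in>S. \<alpha> (- n) ` c n) \<in> join_over \<alpha> S U" using c(2) assms(2) by (auto simp: join_over_def)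
    moreover have "v \<subseteq> (\<Inter>n\<in>S. \<alpha> (- n) ` c n)" using c(1) assms(2) by auto
    ultimately show "\<exists>w\<in>join_over \<alpha> S U. v \<subseteq> w" by blast
  qed
  then show ?thesis using V(4) by simp
qed

lemma complexity_Un:
  assumes "finite S" "finite T"
  shows "complexity (S \<union> T) \<le> complexity S * complexity T"
proof -
  obtain V where V: "V \<subseteq> join_over \<alpha> S U" "finite V" "\<Union>V = UNIV" "card V = complexity S"
    by (rule complexity_subcover[OF assms(1)])
  obtain W where W: "W \<subseteq> join_over \<alpha> T U" "finite W" "\<Union>W = UNIV" "card W = complexity T"
    by (rule complexity_subcover[OF assms(2)])
  define X where "X = (\<lambda>(v, w). v \<inter> w) ` (V \<times> W)"
  have "complexity (S \<union> T) \<le> card X"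
    unfolding complexity_def
  proof (rule min_subcover_card_le)
    show "finite X" using V W by (simp add: X_def)
    show "\<Union>X = UNIV"
    proof (intro set_eqI iffI UNIV_I)
      fix x
      obtain v w where "v \<in> V" "x \<in> v" "w \<in> W" "x \<in> w" using V(3) W(3) by (metis UNIV_I UnionE)
      then show "x \<in> \<Union>X" unfolding X_def by (intro UnionI[of "v \<inter> w"]) (auto intro!: image_eqI[of _ _ "(v, w)"])
    qed
    fix y assume "y \<in> X"
    then obtain v w where vw: "v \<in> V" "w \<in> W" "y = v \<inter> w" by (auto simp: X_def)
    obtain c where c: "v = (\<Inter>n\<in>S. \<alpha> (- n) ` c n)" "\<forall>n\<in>S. c n \<in> U" using V(1) vw by (auto simp: join_over_def)
    obtain c' where c': "w = (\<Inter>n\<in>T. \<alpha> (- n) ` c' n)" "\<forall>n\<in>T. c' n \<in> U" using W(1) vw by (auto simp: join_over_def)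
    define b where "b n = (if n \<in> S then c n else c' n)" for n
    have "(\<Inter>n\<in>S \<union> T. \<alpha> (- n) ` b n) \<in> join_over \<alpha> (S \<union> T) U"
      unfolding join_over_def using c(2) c'(2) by (auto simp: b_def)
    moreover have "y \<subseteq> (\<Inter>n\<in>S \<union> T. \<alpha> (- n) ` b n)" using c(1) c'(1) vw(3) by (auto simp: b_def)
    ultimately show "\<exists>w\<in>join_over \<alpha> (S \<union> T) U. y \<subseteq> w" by blast
  qed
  also have "card X \<le> card (V \<times> W)" unfolding X_def using V W by (intro card_image_le) simp
  finally show ?thesis using V W by (simp add: card_cartesian_product)
qed

lemma complexity_translate:
  assumes "finite S"
  shows "complexity ((\<lambda>n. n + t) ` S) \<le> complexity S"
proof -
  obtain V where V: "V \<subseteq> join_over \<alpha> S U" "finite V" "\<Union>V = UNIV" "card V = complexity S"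
    by (rule complexity_subcover[OF assms(1)])
  have "complexity ((\<lambda>n. n + t) ` S) \<le> card ((\<lambda>v. \<alpha> (- t) ` v) ` V)"
    unfolding complexity_def
  proof (rule min_subcover_card_le)
    show "finite ((\<lambda>v. \<alpha> (- t) ` v) ` V)" using V by simp
    show "\<Union>((\<lambda>v. \<alpha> (- t) ` v) ` V) = UNIV"
    proof (intro set_eqI iffI UNIV_I)
      fix x
      obtain v where "v \<in> V" "\<alpha> t x \<in> v" using V(3) by (metis UNIV_I UnionE)
      then have "x \<in> \<alpha> (- t) ` v" by (simp add: mem_image_action)
      then show "x \<in> \<Union>((\<lambda>v. \<alpha> (- t) ` v) ` V)" using \<open>v \<in> V\<close> by blast
    qed
    fix y assume "y \<in> (\<lambda>v. \<alpha> (- t) ` v) ` V"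
    then obtain v where v: "v \<in> V" "y = \<alpha> (- t) ` v" by blast
    obtain c where c: "v = (\<Inter>n\<in>S. \<alpha> (- n) ` c n)" "\<forall>n\<in>S. c n \<in> U" using V(1) v by (auto simp: join_over_def)
    define w where "w = (\<Inter>n\<in>(\<lambda>n. n + t) ` S. \<alpha> (- n) ` c (n - t))"
    have "w \<in> join_over \<alpha> ((\<lambda>n. n + t) ` S) U" unfolding join_over_def w_def using c(2)
      by (intro CollectI exI[of _ "\<lambda>n. c (n - t)"]) auto
    moreover have "y \<subseteq> w"
    proof
      fix x assume "x \<in> y"
      then have "\<alpha> t x \<in> v" using v(2) by (simp add: mem_image_action)
      then have "\<alpha> n (\<alpha> t x) \<in> c n" if "n \<in> S" for n using that c(1) by (auto simp: mem_image_action)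
      then show "x \<in> w" by (auto simp: w_def mem_image_action action_props(5)[OF \<alpha>] simp del: minus_add_distrib)
    qed
    ultimately show "\<exists>w\<in>join_over \<alpha> ((\<lambda>n. n + t) ` S) U. y \<subseteq> w" by blast
  qed
  also have "\<dots> \<le> card V" using V by (intro card_image_le)
  finally show ?thesis using V by simp
qed

lemma complexity_UN_translates:
  assumes "finite S" "finite J"
  shows "complexity (\<Union>j\<in>J. (\<lambda>n. n + t j) ` S) \<le> complexity S ^ card J"
  using assms(2)
proof (induction J)
  case empty
  have "complexity {} \<le> card {UNIV :: 'a set}"
    unfolding complexity_def by (rule min_subcover_card_le) (auto simp: join_over_def)
  then show ?case by simp
next
  case (insert j J)
  have "complexity (\<Union>j\<in>insert j J. (\<lambda>n. n + t j) ` S) \<le>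
      complexity ((\<lambda>n. n + t j) ` S) * complexity (\<Union>j\<in>J. (\<lambda>n. n + t j) ` S)"
    using complexity_Un[of "(\<lambda>n. n + t j) ` S" "\<Union>j\<in>J. (\<lambda>n. n + t j) ` S"] assms(1) insert(1) by simp
  also have "\<dots> \<le> complexity S * complexity S ^ card J"
    by (intro mult_mono complexity_translate assms(1) insert) auto
  finally show ?case using insert by simp
qed

text \<open>In each direction \<open>k div m + 1\<close> translates of the box of side
  \<open>m\<close> cover the box of side \<open>k\<close>.\<close>

lemma complexity_cube_le:
  assumes m: "m > 0"
  shows "complexity (cube 0 (int k)) \<le> complexity (cube 0 (int m)) ^ ((k div m + 1) ^ CARD('d))"
proof -
  define J :: "(int ^ 'd) set" where "J = cube 0 (int (k div m + 1))"
  define t where "t j = (\<chi> i. int m * j $ i)" for j :: "int ^ 'd"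
  have sub: "cube 0 (int k) \<subseteq> (\<Union>j\<in>J. (\<lambda>n. n + t j) ` cube 0 (int m))"
  proof
    fix n :: "int ^ 'd" assume n: "n \<in> cube 0 (int k)"
    define j where "j = (\<chi> i. n $ i div int m)"
    define r where "r = (\<chi> i. n $ i mod int m)"
    have "(r + t j) $ i = n $ i" for i by (simp add: r_def t_def j_def)
    then have "n = r + t j" by (intro vec_eq_iff[THEN iffD2] allI) (rule sym)
    moreover have "r \<in> cube 0 (int m)" using m by (simp add: cube_def r_def)
    moreover have "j \<in> J"
      unfolding J_def cube_def
    proof (intro CollectI allI)
      fix i
      have "0 \<le> n $ i" "n $ i \<le> int k" using n by (auto simp: cube_def less_imp_le)
      then have "0 \<le> n $ i div int m" "n $ i div int m \<le> int k div int m"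
        using m by (auto intro: zdiv_mono1 simp: pos_imp_zdiv_nonneg_iff)
      then show "0 \<le> j $ i \<and> j $ i < int (k div m + 1)" by (simp add: j_def zdiv_int)
    qed
    ultimately show "n \<in> (\<Union>j\<in>J. (\<lambda>n. n + t j) ` cube 0 (int m))" by blast
  qed
  have "complexity (cube 0 (int k)) \<le> complexity (\<Union>j\<in>J. (\<lambda>n. n + t j) ` cube 0 (int m))"
    by (rule complexity_mono[OF _ sub]) (auto simp: J_def finite_cube)
  also have "\<dots> \<le> complexity (cube 0 (int m)) ^ card J"
    by (rule complexity_UN_translates) (auto simp: J_def finite_cube)
  also have "card J = (k div m + 1) ^ CARD('d)"
  proof -
    have "nat (int (k div m + 1) - 0) = k div m + 1" by simp
    then show ?thesis unfolding J_def card_cube by (simp only:)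
  qed
  finally show ?thesis .
qed

text \<open>\<open>cover_entropy\<close> is defined by \<open>lim\<close>, which carries no
  information without convergence. Fekete's argument: the bound \<open>le\<close> makes the limit
  superior at most each \<open>b m\<close>, so the sequence tends to its infimum over positive
  indices.\<close>

lemma cover_entropy_tendsto:
  "(\<lambda>k. ln (real (min_subcover_card (join_cover \<alpha> k U))) / real k ^ CARD('d)) \<longlonglongrightarrow> cover_entropy \<alpha> U"
proof -
  define a where "a k = ln (real (complexity (cube 0 (int k))))" for k
  define b where "b k = a k / real k ^ CARD('d)" for k
  have a0: "a k \<ge> 0" for k
    using complexity_pos[OF finite_cube, of 0 "int k"] by (simp add: a_def)
  have b0: "b k \<ge> 0" for k using a0 by (simp add: b_def)
  have le: "b k \<le> (1 / real m + 1 / real k) ^ CARD('d) * a m" if m: "m > 0" and k: "k > 0" for m k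
  proof -
    have "real (complexity (cube 0 (int k))) \<le> real (complexity (cube 0 (int m)) ^ ((k div m + 1) ^ CARD('d)))"
      using complexity_cube_le[OF m, of k] by (simp only: of_nat_le_iff)
    then have "a k \<le> ln (real (complexity (cube 0 (int m)) ^ ((k div m + 1) ^ CARD('d))))"
      unfolding a_def using complexity_pos[OF finite_cube, of 0 "int k"] by (intro ln_mono) auto
    also have "\<dots> = real (k div m + 1) ^ CARD('d) * a m"
      using complexity_pos[OF finite_cube, of 0 "int m"] unfolding of_nat_power by (subst ln_realpow) (auto simp: a_def)
    also have "\<dots> \<le> (real k / real m + 1) ^ CARD('d) * a m"
      using of_nat_div_le_of_nat[of k m, where 'a = real] by (intro mult_right_mono power_mono a0) auto
    finally have "b k \<le> (real k / real m + 1) ^ CARD('d) * a m / real k ^ CARD('d)"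
      unfolding b_def by (rule divide_right_mono) simp
    also have "\<dots> = ((real k / real m + 1) / real k) ^ CARD('d) * a m" by (simp add: power_divide)
    also have "(real k / real m + 1) / real k = 1 / real m + 1 / real k" using k by (simp add: add_divide_distrib)
    finally show ?thesis .
  qed
  define l where "l = (INF k\<in>{1..}. b k)"
  have bdd: "bdd_below (b ` {1..})" using b0 by (intro bdd_belowI[of _ 0]) auto
  have "b \<longlonglongrightarrow> l"
  proof (rule LIMSEQ_I)
    fix e :: real assume e: "e > 0"
    have "\<exists>m\<in>{1..}. b m < l + e"
      using cINF_less_iff[OF _ bdd, of "l + e"] e unfolding l_def by auto
    then obtain m where m: "m \<ge> 1" "b m < l + e" by auto
    have "(\<lambda>k. (1 / real m + 1 / real k) ^ CARD('d) * a m) \<longlonglongrightarrow> (1 / real m + 0) ^ CARD('d) * a m"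
      by (intro tendsto_intros lim_1_over_n)
    moreover have "(1 / real m + 0) ^ CARD('d) * a m = b m" by (simp add: b_def power_divide)
    ultimately have "\<forall>\<^sub>F k in sequentially. (1 / real m + 1 / real k) ^ CARD('d) * a m < l + e"
      using m(2) by (intro order_tendstoD(2)) auto
    then obtain N where N: "\<And>k. k \<ge> N \<Longrightarrow> (1 / real m + 1 / real k) ^ CARD('d) * a m < l + e"
      by (auto simp: eventually_sequentially)
    show "\<exists>N. \<forall>k\<ge>N. norm (b k - l) < e"
    proof (intro exI[of _ "max N 1"] allI impI)
      fix k assume k: "k \<ge> max N 1"
      have "l \<le> b k" unfolding l_def using k by (intro cINF_lower[OF bdd]) auto
      moreover have "b k < l + e" using le[of m k] N[of k] m k by (intro le_less_trans[OF le N]) auto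
      ultimately show "norm (b k - l) < e" by simp
    qed
  qed
  moreover have "b = (\<lambda>k. ln (real (min_subcover_card (join_cover \<alpha> k U))) / real k ^ CARD('d))"
    by (auto simp: b_def a_def complexity_def join_cover_eq)
  ultimately have "(\<lambda>k. ln (real (min_subcover_card (join_cover \<alpha> k U))) / real k ^ CARD('d)) \<longlonglongrightarrow> l" by simp
  then show ?thesis unfolding cover_entropy_def by (simp add: limI)
qed

end

subsection \<open>Free elements of the dual module create infinite entropy\<close>

lemma cover_entropy_ge:
  assumes \<alpha>: "algebraic_action \<alpha>" and U: "finite_open_cover U"
    and ge: "\<And>k. k \<ge> 1 \<Longrightarrow> q ^ (k ^ CARD('d)) \<le> min_subcover_card (join_cover \<alpha> k U)" and q: "q \<ge> 1"
  shows "ln (real q) \<le> cover_entropy (\<alpha> :: int ^ 'd \<Rightarrow> 'a::{topological_ab_group_add, metric_space} \<Rightarrow> 'a) U"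
proof (rule tendsto_lowerbound[OF cover_entropy_tendsto[OF \<alpha> U] eventually_sequentiallyI[of 1]])
  fix k :: nat assume k: "1 \<le> k"
  have "real q ^ (k ^ CARD('d)) \<le> real (min_subcover_card (join_cover \<alpha> k U))"
    using ge[OF k] by (metis of_nat_le_iff of_nat_power)
  moreover have "0 < real q ^ (k ^ CARD('d))" using q by simp
  ultimately have "ln (real q ^ (k ^ CARD('d))) \<le> ln (real (min_subcover_card (join_cover \<alpha> k U)))"
    by (intro ln_mono) auto
  also have "ln (real q ^ (k ^ CARD('d))) = real k ^ CARD('d) * ln (real q)"
    using q by (subst ln_realpow) auto
  finally show "ln (real q) \<le> ln (real (min_subcover_card (join_cover \<alpha> k U))) / real k ^ CARD('d)"
    using k by (simp add: field_simps)
qed simp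

lemma separated_unit_points:
  assumes "q \<ge> 1"
  obtains Z :: "complex set" and \<eta> :: real where "finite Z" "card Z = q" "\<And>z. z \<in> Z \<Longrightarrow> cmod z = 1"
    "\<eta> > 0" "\<And>z z'. z \<in> Z \<Longrightarrow> z' \<in> Z \<Longrightarrow> dist z z' \<le> 2 * \<eta> \<Longrightarrow> z = z'"
proof -
  define Z where "Z = {z :: complex. z ^ q = 1}"
  have card: "card Z = q" unfolding Z_def by (rule card_complex_roots_unity[OF assms])
  then have fin: "finite Z" using assms by (intro card_ge_0_finite) simp
  have unit: "cmod z = 1" if "z \<in> Z" for z
  proof -
    have "cmod z ^ q = 1" using that by (simp add: Z_def norm_power[symmetric])
    then show ?thesis using power_eq_iff_eq_base[of q "cmod z" 1] assms by simp
  qed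
  \<comment> \<open>Including 1 keeps the minimum meaningful when \<open>Z\<close> has a single
    point.\<close>
  define D where "D = insert 1 ((\<lambda>(z, z'). dist z z') ` {(z, z'). z \<in> Z \<and> z' \<in> Z \<and> z \<noteq> z'})"
  have "finite {(z, z'). z \<in> Z \<and> z' \<in> Z \<and> z \<noteq> z'}"
    by (rule finite_subset[of _ "Z \<times> Z"]) (use fin in auto)
  then have D: "finite D" unfolding D_def by simp
  have Dpos: "Min D > 0" using D by (subst Min_gr_iff) (auto simp: D_def)
  show ?thesis
  proof (rule that[OF fin card unit, of "Min D / 3"])
    show "Min D / 3 > 0" using Dpos by simp
    fix z z' assume z: "z \<in> Z" "z' \<in> Z" "dist z z' \<le> 2 * (Min D / 3)"
    show "z = z'"
    proof (rule ccontr)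
      assume "z \<noteq> z'"
      then have "dist z z' \<in> D" using z by (auto simp: D_def intro!: image_eqI[of _ _ "(z, z')"])
      then have "Min D \<le> dist z z'" using D by simp
      then show False using z(3) Dpos by simp
    qed
  qed
qed

lemma free_element_independent:
  fixes \<alpha> :: "int ^ 'd \<Rightarrow> 'a::{topological_ab_group_add, metric_space} \<Rightarrow> 'a"
  assumes \<alpha>: "algebraic_action \<alpha>" and free: "\<And>f. dual_scale \<alpha> f a = 0 \<Longrightarrow> f = 0"
    and S: "finite S" and k: "(\<Sum>n\<in>S. int_scale (k n) (dual_map (\<alpha> n) a)) = 0" and n: "n \<in> S"
  shows "k n = 0"
proof -
  define f where "f = Abs_poly_mapping (\<lambda>n. if n \<in> S then k n else 0)"
  have "finite {n. (if n \<in> S then k n else 0) \<noteq> 0}"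
    by (rule finite_subset[OF _ S]) auto
  then have lf: "Poly_Mapping.lookup f = (\<lambda>n. if n \<in> S then k n else 0)"
    unfolding f_def by (rule lookup_Abs_poly_mapping)
  then have keys: "Poly_Mapping.keys f \<subseteq> S" by (auto simp: in_keys_iff split: if_splits)
  have "dual_scale \<alpha> f a = (\<Sum>n\<in>S. int_scale (k n) (dual_map (\<alpha> n) a))"
    by (rule character_eqI)
      (simp add: eval_dual_scale_superset[OF \<alpha> S keys] eval_character_sum eval_character_int_scale
        eval_dual_map action_props(2)[OF \<alpha>] lf)
  then have "f = 0" using k by (intro free) simp
  then show ?thesis using n lf by (metis lookup_zero)
qed

lemma free_element_entropy_ge:
  fixes \<alpha> :: "int ^ 'd \<Rightarrow> 'a::{topological_ab_group_add, metric_space} \<Rightarrow> 'a"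
  assumes \<alpha>: "algebraic_action \<alpha>" and free: "\<And>f. dual_scale \<alpha> f a = 0 \<Longrightarrow> f = 0" and q: "q \<ge> 1"
  shows "ereal (ln (real q)) \<le> topological_entropy \<alpha>"
proof -
  note ap = action_props[OF \<alpha>]
  obtain Z \<eta> where Z: "finite Z" "card Z = q" "\<And>z. z \<in> Z \<Longrightarrow> cmod z = 1"
    "\<eta> > 0" "\<And>z z'. z \<in> Z \<Longrightarrow> z' \<in> Z \<Longrightarrow> dist z z' \<le> 2 * \<eta> \<Longrightarrow> z = z'"
    using separated_unit_points[OF q] by blast
  \<comment> \<open>A point whose value is within \<open>\<eta>\<close> of some \<open>z'\<close> in
    \<open>Z\<close> lies in no member of the cover other than \<open>u z'\<close>.\<close>
  define u where "u z = (\<Inter>z'\<in>Z - {z}. {x. \<eta> < dist (eval_character a x) z'})" for z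
  define U where "U = u ` Z"
  have cover: "finite_open_cover U"
    unfolding finite_open_cover_def
  proof (intro conjI ballI)
    show "finite U" using Z by (simp add: U_def)
    show "open v" if "v \<in> U" for v
      using that Z(1) unfolding U_def u_def
      by (auto intro!: open_INT open_Collect_less continuous_intros eval_character_props)
    show "\<Union>U = UNIV"
    proof (intro set_eqI iffI UNIV_I)
      fix x
      have "\<exists>z\<in>Z. \<forall>z'\<in>Z - {z}. \<eta> < dist (eval_character a x) z'"
      proof (cases "\<exists>z\<in>Z. dist (eval_character a x) z \<le> \<eta>")
        case True
        then obtain z where z: "z \<in> Z" "dist (eval_character a x) z \<le> \<eta>" by blast
        have "\<eta> < dist (eval_character a x) z'" if z': "z' \<in> Z - {z}" for z'
        proof (rule ccontr)
          assume "\<not> \<eta> < dist (eval_character a x) z'"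
          then have "dist z z' \<le> 2 * \<eta>" using z(2) dist_triangle3[of z z' "eval_character a x"] by simp
          then show False using Z(5)[OF z(1)] z' by auto
        qed
        then show ?thesis using z(1) by blast
      next
        case False
        have "Z \<noteq> {}" using Z q by auto
        then obtain z where "z \<in> Z" by blast
        then show ?thesis using False by (meson DiffD1 not_le)
      qed
      then show "x \<in> \<Union>U" by (auto simp: U_def u_def)
    qed
  qed
  have "q ^ (k ^ CARD('d)) \<le> min_subcover_card (join_cover \<alpha> k U)" for k
  proof -
    define S :: "(int ^ 'd) set" where "S = cube 0 (int k)"
    have S: "finite S" "card S = k ^ CARD('d)" by (simp_all add: S_def finite_cube card_cube)
    have "\<exists>x. \<forall>n\<in>S. dist (eval_character a (\<alpha> n x)) (g n) < \<eta>" if g: "g \<in> S \<rightarrow>\<^sub>E Z" for g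
    proof -
      obtain x where "\<And>n. n \<in> S \<Longrightarrow> dist (eval_character (dual_map (\<alpha> n) a) x) (g n) < \<eta>"
      proof (rule character_values_dense[OF ap(1) S(1), of g "\<lambda>n. dual_map (\<alpha> n) a" \<eta>])
        show "cmod (g n) = 1" if "n \<in> S" for n using g that Z(3) by auto
        show "(\<Prod>n\<in>S. g n powi k n) = 1" if "(\<Sum>n\<in>S. int_scale (k n) (dual_map (\<alpha> n) a)) = 0" for k
          using free_element_independent[OF \<alpha> free S(1) that] by simp
      qed (use Z(4) in auto)
      then show ?thesis by (auto simp: eval_dual_map ap(2))
    qed
    then obtain x where x: "\<And>g n. g \<in> S \<rightarrow>\<^sub>E Z \<Longrightarrow> n \<in> S \<Longrightarrow> dist (eval_character a (\<alpha> n (x g))) (g n) < \<eta>"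
      by metis
    obtain V where V: "V \<subseteq> join_over \<alpha> S U" "finite V" "\<Union>V = UNIV"
        "card V = min_subcover_card (join_over \<alpha> S U)"
      by (rule min_subcover_card_attained[OF join_over_finite[OF \<alpha> cover S(1)] join_over_covers[OF \<alpha> cover]])
    have "\<exists>v\<in>V. x g \<in> v" for g using V(3) by auto
    then obtain v where v: "\<And>g. v g \<in> V" "\<And>g. x g \<in> v g" by metis
    \<comment> \<open>A member of the join allows only one pattern value at each site, so distinct
      patterns need distinct members.\<close>
    have "inj_on v (S \<rightarrow>\<^sub>E Z)"
    proof (rule inj_onI)
      fix g h assume gh: "g \<in> S \<rightarrow>\<^sub>E Z" "h \<in> S \<rightarrow>\<^sub>E Z" "v g = v h"
      obtain c where c: "v g = (\<Inter>n\<in>S. \<alpha> (- n) ` c n)" "\<forall>n\<in>S. c n \<in> U"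
        using V(1) v(1)[of g] by (auto simp: join_over_def)
      show "g = h"
      proof (rule PiE_ext[OF gh(1,2)])
        fix n assume n: "n \<in> S"
        obtain z where z: "z \<in> Z" "c n = u z" using c(2) n by (auto simp: U_def)
        have "f n = z" if f: "f \<in> S \<rightarrow>\<^sub>E Z" "x f \<in> v g" for f
        proof (rule ccontr)
          assume "f n \<noteq> z"
          moreover have "f n \<in> Z" using f(1) n by auto
          moreover have "\<alpha> n (x f) \<in> u z" using f(2) n z(2) unfolding c(1) by (auto simp: mem_image_action[OF \<alpha> cover])
          ultimately have "\<eta> < dist (eval_character a (\<alpha> n (x f))) (f n)" by (auto simp: u_def)
          then show False using x[OF f(1) n] by simp
        qed
        then show "g n = h n" using gh v(2)[of g] v(2)[of h] by metis
      qed
    qed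
    then have "card (S \<rightarrow>\<^sub>E Z) \<le> card V" using v(1) V(2) by (intro card_inj_on_le[of v]) auto
    moreover have "card (S \<rightarrow>\<^sub>E Z) = q ^ (k ^ CARD('d))" using S Z by (simp add: card_PiE)
    ultimately show ?thesis using V(4) by (simp add: join_cover_eq S_def)
  qed
  then have "ln (real q) \<le> cover_entropy \<alpha> U" by (rule cover_entropy_ge[OF \<alpha> cover _ q])
  then show ?thesis unfolding topological_entropy_def using cover by (intro SUP_upper2[of U]) auto
qed

lemma finite_entropy_imp_torsion_dual:
  fixes \<alpha> :: "int ^ 'd \<Rightarrow> 'a::{topological_ab_group_add, metric_space} \<Rightarrow> 'a"
  assumes \<alpha>: "algebraic_action \<alpha>" and fin: "topological_entropy \<alpha> < \<infinity>"
  shows "torsion_dual \<alpha>"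
proof (rule ccontr)
  assume "\<not> torsion_dual \<alpha>"
  then obtain a where free: "\<And>f. dual_scale \<alpha> f a = 0 \<Longrightarrow> f = 0" by (auto simp: torsion_dual_def)
  have ge: "ereal (ln (real q)) \<le> topological_entropy \<alpha>" if "q \<ge> 1" for q
    by (rule free_element_entropy_ge[OF \<alpha> free that])
  then obtain r where r: "topological_entropy \<alpha> = ereal r"
    using fin ge[of 1] by (cases "topological_entropy \<alpha>") auto
  obtain q :: nat where q: "exp (r + 1) < real q" using reals_Archimedean2 by blast
  then have "q \<ge> 1" by (metis exp_gt_zero gr0I less_one linorder_not_less of_nat_0 order_less_asym)
  have "r + 1 < ln (real q)" using q \<open>q \<ge> 1\<close> by (metis exp_gt_zero less_trans ln_exp ln_less_cancel_iff)
  then show False using ge[OF \<open>q \<ge> 1\<close>] r by simp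
qed

subsection \<open>Torsion dual modules have finite entropy\<close>

lemma weight_bound:
  assumes "\<And>i. \<bar>n $ i\<bar> \<le> b"
  shows "\<bar>weight w n\<bar> \<le> (\<Sum>i\<in>UNIV. \<bar>w i\<bar>) * b"
proof -
  have "\<bar>weight w n\<bar> \<le> (\<Sum>i\<in>UNIV. \<bar>w i * n $ i\<bar>)" unfolding weight_def by (rule sum_abs)
  also have "\<dots> \<le> (\<Sum>i\<in>UNIV. \<bar>w i\<bar> * b)"
    using assms by (intro sum_mono) (simp add: abs_mult mult_left_mono)
  finally show ?thesis by (simp add: sum_distrib_right)
qed

lemma card_cube_boundary:
  assumes "real k \<ge> 2 * real \<rho>" "k > 0"
  shows "real k ^ d - (real k - 2 * real \<rho>) ^ d \<le> 2 * real \<rho> * real d * real k ^ (d - 1)"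
proof -
  define x where "x = 2 * real \<rho> / real k"
  have x: "0 \<le> x" "x \<le> 1" using assms by (auto simp: x_def)
  have "1 + real d * (- x) \<le> (1 + (- x)) ^ d" using x by (intro Bernoulli_inequality) auto
  then have "1 - (1 - x) ^ d \<le> real d * x" by simp
  then have "real k ^ d * (1 - (1 - x) ^ d) \<le> real k ^ d * (real d * x)" by (intro mult_left_mono) auto
  moreover have "real k ^ d * (1 - (1 - x) ^ d) = real k ^ d - (real k - 2 * real \<rho>) ^ d"
  proof -
    have "real k - 2 * real \<rho> = real k * (1 - x)" using assms(2) by (simp add: x_def field_simps)
    then show ?thesis by (simp only: power_mult_distrib right_diff_distrib[of "real k ^ d"] mult_1_right)
  qed
  moreover have "real k ^ d * (real d * x) = 2 * real \<rho> * real d * real k ^ (d - 1)"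
    using assms(2) by (cases d) (simp_all add: x_def)
  ultimately show ?thesis by simp
qed

text \<open>The lifts \<open>w\<close> of the difference of two orbits satisfy an exact difference equation, so an
  error on the boundary grows by a factor at most \<open>A\<close> per unit of weight.\<close>

lemma difference_equation_growth:
  fixes f :: "'d::finite laurent" and w :: "int ^ 'd \<Rightarrow> real"
  assumes l: "l \<in> Poly_Mapping.keys f"
      "\<And>m. m \<in> Poly_Mapping.keys f \<Longrightarrow> m \<noteq> l \<Longrightarrow> weight v m < weight v l"
    and JB: "\<And>j m. j \<in> J \<Longrightarrow> m \<in> Poly_Mapping.keys f \<Longrightarrow> m + j \<in> B"
    and low: "\<And>n. n \<in> B \<Longrightarrow> - b \<le> weight v n"
    and bdry: "\<And>n. n \<in> B - (\<lambda>j. l + j) ` J \<Longrightarrow> \<bar>w n\<bar> \<le> \<delta>"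
    and eq: "\<And>j. j \<in> J \<Longrightarrow> (\<Sum>m\<in>Poly_Mapping.keys f. of_int (Poly_Mapping.lookup f m) * w (m + j)) = 0"
    and A: "A = (\<Sum>m\<in>Poly_Mapping.keys f. \<bar>real_of_int (Poly_Mapping.lookup f m)\<bar>)" and \<delta>: "\<delta> \<ge> 0"
    and n: "n \<in> B"
  shows "\<bar>w n\<bar> \<le> \<delta> * A ^ nat (weight v n + b)"
  using n
proof (induction "nat (weight v n + b)" arbitrary: n rule: less_induct)
  case less
  let ?K = "Poly_Mapping.keys f" and ?f = "\<lambda>m. real_of_int (Poly_Mapping.lookup f m)"
  define r where "r = nat (weight v n + b)"
  \<comment> \<open>The leading coefficient is a nonzero integer, so solving for \<open>w n\<close>
    by dividing by it does not enlarge the error.\<close>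
  have fl: "1 \<le> \<bar>?f l\<bar>" using l(1) by (auto simp: in_keys_iff)
  also have "\<bar>?f l\<bar> \<le> A" unfolding A using l(1) by (intro member_le_sum) auto
  finally have A1: "1 \<le> A" .
  show ?case
  proof (cases "n \<in> (\<lambda>j. l + j) ` J")
    case False
    then have "\<bar>w n\<bar> \<le> \<delta>" using bdry less.prems by simp
    also have "\<dots> \<le> \<delta> * A ^ nat (weight v n + b)" using A1 \<delta> by (simp add: mult_le_cancel_left1 one_le_power)
    finally show ?thesis .
  next
    case True
    then obtain j where j: "j \<in> J" "n = l + j" by blast
    have "?f l * w n + (\<Sum>m\<in>?K - {l}. ?f m * w (m + j)) = 0"
      using eq[OF j(1)] unfolding j(2) by (subst (asm) sum.remove[of _ l]) (use l(1) in auto)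
    then have "\<bar>?f l * w n\<bar> = \<bar>\<Sum>m\<in>?K - {l}. ?f m * w (m + j)\<bar>" by linarith
    also have "\<dots> \<le> (\<Sum>m\<in>?K - {l}. \<bar>?f m * w (m + j)\<bar>)" by (rule sum_abs)
    also have "\<dots> \<le> (\<Sum>m\<in>?K - {l}. \<bar>?f m\<bar> * (\<delta> * A ^ (r - 1)))"
    proof (rule sum_mono)
      fix m assume m: "m \<in> ?K - {l}"
      have mB: "m + j \<in> B" using JB[OF j(1)] m by blast
      have "weight v (m + j) < weight v n" using l(2)[of m] m by (simp add: j(2) weight_add)
      then have lt: "nat (weight v (m + j) + b) < r" using low[OF mB] by (simp add: r_def)
      have "\<bar>w (m + j)\<bar> \<le> \<delta> * A ^ nat (weight v (m + j) + b)"
        using less.hyps[of "m + j"] lt mB by (simp add: r_def)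
      also have "\<dots> \<le> \<delta> * A ^ (r - 1)" using A1 \<delta> lt by (intro mult_left_mono power_increasing) auto
      finally show "\<bar>?f m * w (m + j)\<bar> \<le> \<bar>?f m\<bar> * (\<delta> * A ^ (r - 1))"
        by (simp add: abs_mult mult_left_mono)
    qed
    also have "\<dots> \<le> \<delta> * A ^ r"
    proof (cases "?K - {l} = {}")
      case True
      then show ?thesis using A1 \<delta> by (simp only: sum.empty) simp
    next
      case False
      then obtain m where m: "m \<in> ?K - {l}" by blast
      have mB: "m + j \<in> B" using JB[OF j(1)] m by blast
      have "weight v (m + j) < weight v n" using l(2)[of m] m by (simp add: j(2) weight_add)
      then have r: "r > 0" using low[OF mB] by (simp add: r_def)
      have "(\<Sum>m\<in>?K - {l}. \<bar>?f m\<bar>) \<le> A" unfolding A by (intro sum_mono2) auto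
      then have "(\<Sum>m\<in>?K - {l}. \<bar>?f m\<bar>) * (\<delta> * A ^ (r - 1)) \<le> A * (\<delta> * A ^ (r - 1))"
        using A1 \<delta> by (intro mult_right_mono) auto
      also have "\<dots> = \<delta> * A ^ r" using r by (cases r) auto
      finally show ?thesis by (simp add: sum_distrib_right)
    qed
    finally have "\<bar>?f l\<bar> * \<bar>w n\<bar> \<le> \<delta> * A ^ r" by (simp add: abs_mult)
    moreover have "1 * \<bar>w n\<bar> \<le> \<bar>?f l\<bar> * \<bar>w n\<bar>" using fl by (intro mult_right_mono) auto
    ultimately show ?thesis by (simp add: r_def)
  qed
qed

text \<open>A code of logarithmic size at most \<open>b\<close> that determines the orbit values of
  \<open>a\<close> up to \<open>e\<close> on the box of side \<open>k\<close> enlarged by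
  \<open>N\<close> on all sides. The enlargement makes room for the windows that test membership in
  a cover. The two components will hold integers in the interior and rounded angles on the
  boundary.\<close>

definition codable :: "(int ^ 'd \<Rightarrow> 'a::topological_ab_group_add \<Rightarrow> 'a) \<Rightarrow> 'a character \<Rightarrow> real \<Rightarrow> nat \<Rightarrow> nat \<Rightarrow> real \<Rightarrow> bool"
  where "codable \<alpha> a e N k b \<longleftrightarrow> (\<exists>code :: 'a \<Rightarrow> (int ^ 'd \<Rightarrow> int) \<times> (int ^ 'd \<Rightarrow> int).
    finite (range code) \<and> ln (real (card (range code))) \<le> b \<and>
    (\<forall>x y. code x = code y \<longrightarrow> (\<forall>n\<in>cube (- int N) (int (k + N)).
      dist (eval_character a (\<alpha> n x)) (eval_character a (\<alpha> n y)) < e)))"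

text \<open>\<open>H\<close> is chosen before \<open>e\<close> and \<open>N\<close>, which makes the
  final bound independent of the cover. The number of boundary sites is one order below the volume,
  but their values are needed with a precision exponentially small in the side length; so the
  boundary costs as much as the interior, and \<open>e\<close> enters only the lower order
  term.\<close>

lemma torsion_coding:
  fixes \<alpha> :: "int ^ 'd \<Rightarrow> 'a::{topological_ab_group_add, metric_space} \<Rightarrow> 'a"
  assumes \<alpha>: "algebraic_action \<alpha>" and f: "f \<noteq> 0" "dual_scale \<alpha> f a = 0"
  shows "\<exists>H \<rho>. \<forall>e>0. \<exists>c. \<forall>N k. k \<ge> \<rho> \<longrightarrow>
    codable \<alpha> a e N k (H * real (k + 2 * N) ^ CARD('d) + c * real (k + 2 * N) ^ (CARD('d) - 1))"
proof -
  let ?K = "Poly_Mapping.keys f" and ?f = "Poly_Mapping.lookup f"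
  note ap = action_props[OF \<alpha>]
  obtain v l where l: "l \<in> ?K" "\<And>m. m \<in> ?K \<Longrightarrow> m \<noteq> l \<Longrightarrow> weight v m < weight v l"
    using leading_exponent[OF f(1)] by metis
  obtain \<rho> where \<rho>: "\<And>n i. n \<in> ?K \<Longrightarrow> \<bar>n $ i\<bar> \<le> int \<rho>" using keys_bounded[OF finite_keys] by metis
  define A where "A = (\<Sum>m\<in>?K. \<bar>?f m\<bar>)"
  define \<Omega> where "\<Omega> = (\<Sum>i\<in>UNIV. \<bar>v i\<bar>)"
  have \<Omega>: "\<Omega> \<ge> 0" unfolding \<Omega>_def by (intro sum_nonneg) auto
  have "\<bar>?f l\<bar> \<le> A" unfolding A_def using l(1) by (intro member_le_sum) auto
  then have A1: "1 \<le> A" using l(1) by (auto simp: in_keys_iff)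
  have A_real: "real_of_int A = (\<Sum>m\<in>?K. \<bar>real_of_int (?f m)\<bar>)" by (simp add: A_def)
  \<comment> \<open>The angle measured in full turns, so that applying \<open>f\<close> gives an
    integer \<open>p j x\<close>. The choice is discontinuous in \<open>x\<close>, which does not
    matter for coding.\<close>
  define t where "t n x = Im (Ln (eval_character a (\<alpha> n x))) / (2 * pi)" for n x
  have t: "exp (\<i> * of_real (2 * pi * t n x)) = eval_character a (\<alpha> n x)" for n x
    using unit_phase[OF eval_character_props(2)] by (simp add: t_def)
  have t1: "\<bar>t n x\<bar> \<le> 1" for n x
  proof -
    have "\<bar>Im (Ln (eval_character a (\<alpha> n x)))\<bar> \<le> pi"
      using mpi_less_Im_Ln[of "eval_character a (\<alpha> n x)"] Im_Ln_le_pi[of "eval_character a (\<alpha> n x)"] by simp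
    then show ?thesis using pi_gt_zero by (simp add: t_def)
  qed
  define p where "p j x = (\<Sum>m\<in>?K. of_int (?f m) * t (m + j) x)" for j x
  have p_int: "p j x \<in> \<int>" for j x
  proof -
    have "exp (\<i> * of_real (2 * pi * p j x)) = (\<Prod>m\<in>?K. exp (of_int (?f m) * (\<i> * of_real (2 * pi * t (m + j) x))))"
      unfolding p_def by (simp add: sum_distrib_left exp_sum[symmetric] mult_ac)
    also have "\<dots> = (\<Prod>m\<in>?K. eval_character a (\<alpha> m (\<alpha> j x)) powi ?f m)"
      by (simp only: exp_power_int[symmetric] t ap(5))
    also have "\<dots> = 1" unfolding eval_dual_scale[OF \<alpha>, symmetric] f(2) by simp
    finally obtain i :: int where "2 * pi * p j x = of_int (2 * i) * pi" by (auto simp: exp_eq_1)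
    then have "p j x = of_int i" by simp
    then show ?thesis by simp
  qed
  have p_bound: "\<bar>p j x\<bar> \<le> of_int A" for j x
  proof -
    have "\<bar>p j x\<bar> \<le> (\<Sum>m\<in>?K. \<bar>of_int (?f m) * t (m + j) x\<bar>)" unfolding p_def by (rule sum_abs)
    also have "\<dots> \<le> (\<Sum>m\<in>?K. \<bar>of_int (?f m)\<bar>)"
      using t1 by (intro sum_mono) (simp add: abs_mult mult_left_le)
    finally show ?thesis by (simp add: A_def)
  qed
  \<comment> \<open>The first term counts integers in \<open>{- A..A}\<close> at the interior sites.
    The second pays for the boundary: with side length \<open>L\<close> there are at most
    \<open>2 * \<rho> * CARD('d) * L ^ (CARD('d) - 1)\<close> sites, and the growth factor costs at
    most \<open>2 * \<Omega> * L * ln A\<close> at each.\<close>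
  define H where "H = ln (2 * real_of_int A + 1) + 4 * real \<rho> * real CARD('d) * real_of_int \<Omega> * ln (real_of_int A)"
  have main: "codable \<alpha> a e N k (H * real (k + 2 * N) ^ CARD('d) +
      (2 * real \<rho> * real CARD('d) * ln (16 / e + 3)) * real (k + 2 * N) ^ (CARD('d) - 1))"
    if e: "e > 0" and k: "k \<ge> 2 * \<rho> + 1" for e N k
  proof -
    define B :: "(int ^ 'd) set" where "B = cube (- int N) (int (k + N))"
    define J :: "(int ^ 'd) set" where "J = cube (- int N + int \<rho>) (int (k + N) - int \<rho>)"
    \<comment> \<open>The sites whose value is not obtained by solving the equation at some
      \<open>j\<close> in \<open>J\<close> for its leading term.\<close>
    define D where "D = B - (\<lambda>j. l + j) ` J"
    define L where "L = k + 2 * N"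
    define b where "b = \<Omega> * int (k + N)"
    define R where "R = nat (2 * b)"
    \<comment> \<open>Weights on the box lie between \<open>- b\<close> and \<open>b\<close>, so a
      boundary error grows at most by the factor \<open>A ^ R\<close>. The target
      \<open>e / 8\<close> leaves room for the factor \<open>2 * pi\<close>, which is less than
      8.\<close>
    define \<delta> where "\<delta> = e / 8 / real_of_int A ^ R"
    have fin: "finite B" "finite J" "finite D" by (simp_all add: B_def J_def D_def finite_cube)
    have \<delta>: "\<delta> > 0" using e A1 by (simp add: \<delta>_def)
    define Q where "Q = \<lceil>1 / \<delta>\<rceil>"
    have "0 < 1 / \<delta>" using \<delta> by simp
    then have Q0: "Q \<ge> 0" unfolding Q_def by linarith
    have JB: "m + j \<in> B" if "j \<in> J" "m \<in> ?K" for j m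
      unfolding B_def cube_def
    proof (intro CollectI allI)
      fix i
      have "- int N + int \<rho> \<le> j $ i" "j $ i < int (k + N) - int \<rho>" using that(1) by (auto simp: J_def cube_def)
      then show "- int N \<le> (m + j) $ i \<and> (m + j) $ i < int (k + N)" using \<rho>[OF that(2), of i] by (auto simp: abs_le_iff)
    qed
    have cB: "real (card B) = real L ^ CARD('d)"
      by (simp add: B_def card_cube L_def nat_add_distrib algebra_simps)
    have cJ: "real (card J) = (real L - 2 * real \<rho>) ^ CARD('d)"
    proof -
      have "real (nat (int (k + N) - int \<rho> - (- int N + int \<rho>))) = real L - 2 * real \<rho>"
        using k by (simp add: L_def)
      then show ?thesis by (simp only: J_def card_cube of_nat_power)
    qed
    have L: "real L \<ge> 2 * real \<rho>" "L > 0" using k by (auto simp: L_def)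
    have "(\<lambda>j. l + j) ` J \<subseteq> B" using JB l(1) by blast
    then have "card D = card B - card ((\<lambda>j. l + j) ` J)" unfolding D_def using fin by (intro card_Diff_subset) auto
    moreover have "card ((\<lambda>j. l + j) ` J) = card J" by (intro card_image inj_onI) simp
    moreover have "card ((\<lambda>j. l + j) ` J) \<le> card B" using \<open>(\<lambda>j. l + j) ` J \<subseteq> B\<close> fin by (intro card_mono)
    ultimately have cD: "real (card D) = real (card B) - real (card J)" by simp
    have cD': "real (card D) \<le> 2 * real \<rho> * real CARD('d) * real L ^ (CARD('d) - 1)"
      unfolding cD cB cJ by (rule card_cube_boundary[OF L])
    have low: "\<bar>weight v n\<bar> \<le> b" if "n \<in> B" for n
      unfolding b_def \<Omega>_def
    proof (rule weight_bound)
      fix i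
      have "- int N \<le> n $ i" "n $ i < int (k + N)" using that by (auto simp: B_def cube_def)
      then show "\<bar>n $ i\<bar> \<le> int (k + N)" by (auto simp: abs_le_iff)
    qed
    define code where "code x = (restrict (\<lambda>j. \<lfloor>p j x\<rfloor>) J, restrict (\<lambda>n. \<lfloor>t n x / \<delta>\<rfloor>) D)" for x
    have sub: "range code \<subseteq> (J \<rightarrow>\<^sub>E {- A..A}) \<times> (D \<rightarrow>\<^sub>E {- Q..Q})"
    proof -
      have "\<lfloor>p j x\<rfloor> \<in> {- A..A}" for j x
        using p_bound[of j x] p_int[of j x] by (auto simp: abs_le_iff le_floor_iff floor_le_iff Ints_def)
      moreover have "\<lfloor>t n x / \<delta>\<rfloor> \<in> {- Q..Q}" for n x
      proof -
        have "\<bar>t n x / \<delta>\<bar> \<le> 1 / \<delta>" using t1[of n x] \<delta> by (simp add: divide_right_mono)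
        also have "1 / \<delta> \<le> of_int Q" by (simp add: Q_def)
        finally have "- of_int Q \<le> t n x / \<delta>" "t n x / \<delta> \<le> of_int Q" by linarith+
        then show ?thesis by (simp add: le_floor_iff floor_le_iff)
      qed
      ultimately show ?thesis by (auto simp: code_def)
    qed
    have finP: "finite ((J \<rightarrow>\<^sub>E {- A..A}) \<times> (D \<rightarrow>\<^sub>E {- Q..Q}))"
      using fin by (intro finite_cartesian_product finite_PiE) auto
    have "card (range code) \<le> card ((J \<rightarrow>\<^sub>E {- A..A}) \<times> (D \<rightarrow>\<^sub>E {- Q..Q}))"
      by (rule card_mono[OF finP sub])
    also have "\<dots> = nat (2 * A + 1) ^ card J * nat (2 * Q + 1) ^ card D"
      using fin by (simp add: card_cartesian_product card_PiE)
    finally have "real (card (range code)) \<le> real (nat (2 * A + 1) ^ card J * nat (2 * Q + 1) ^ card D)"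
      by (simp only: of_nat_le_iff)
    also have "\<dots> = (2 * real_of_int A + 1) ^ card J * (2 * real_of_int Q + 1) ^ card D"
      using A1 Q0 by simp
    finally have card_le: "real (card (range code)) \<le> (2 * real_of_int A + 1) ^ card J * (2 * real_of_int Q + 1) ^ card D" .
    have finc: "finite (range code)" by (rule finite_subset[OF sub finP])
    have "ln (real (card (range code))) \<le> ln ((2 * real_of_int A + 1) ^ card J * (2 * real_of_int Q + 1) ^ card D)"
      using card_le finc by (intro ln_mono) (auto simp: card_gt_0_iff)
    also have "\<dots> = real (card J) * ln (2 * real_of_int A + 1) + real (card D) * ln (2 * real_of_int Q + 1)"
      using A1 Q0 by (simp add: ln_mult ln_realpow)
    also have "\<dots> \<le> real L ^ CARD('d) * ln (2 * real_of_int A + 1) +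
        (2 * real \<rho> * real CARD('d) * real L ^ (CARD('d) - 1)) * (2 * real_of_int \<Omega> * real L * ln (real_of_int A) + ln (16 / e + 3))"
    proof (intro add_mono mult_mono)
      show "real (card J) \<le> real L ^ CARD('d)" using cD cB of_nat_0_le_iff[of "card D", where 'a = real] by linarith
      have "2 * real_of_int Q + 1 \<le> 2 * (1 / \<delta> + 1) + 1" by (simp add: Q_def) linarith
      also have "\<dots> = 16 / e * real_of_int A ^ R + 3" using e A1 by (simp add: \<delta>_def)
      also have "\<dots> \<le> 16 / e * real_of_int A ^ R + 3 * real_of_int A ^ R" using A1 by (simp add: one_le_power)
      finally have "2 * real_of_int Q + 1 \<le> real_of_int A ^ R * (16 / e + 3)" by (simp add: algebra_simps)
      then have "ln (2 * real_of_int Q + 1) \<le> ln (real_of_int A ^ R * (16 / e + 3))" using Q0 by (intro ln_mono) auto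
      also have "\<dots> = real R * ln (real_of_int A) + ln (16 / e + 3)"
      proof -
        have "16 / e + 3 > 0" using e by (simp add: add_pos_pos)
        then show ?thesis using A1 by (simp add: ln_mult ln_realpow)
      qed
      also have "real R * ln (real_of_int A) \<le> (2 * real_of_int \<Omega> * real L) * ln (real_of_int A)"
      proof (rule mult_right_mono)
        have "real R = 2 * (real_of_int \<Omega> * real (k + N))"
          using \<Omega> by (simp add: R_def b_def)
        also have "\<dots> \<le> 2 * (real_of_int \<Omega> * real L)"
          using \<Omega> by (intro mult_left_mono) (auto simp: L_def)
        finally show "real R \<le> 2 * real_of_int \<Omega> * real L" by simp
        show "0 \<le> ln (real_of_int A)" using A1 by simp
      qed
      finally show "ln (2 * real_of_int Q + 1) \<le> 2 * real_of_int \<Omega> * real L * ln (real_of_int A) + ln (16 / e + 3)" by simp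
    qed (use A1 Q0 cD' in auto)
    also have "\<dots> = H * real L ^ CARD('d) + (2 * real \<rho> * real CARD('d) * ln (16 / e + 3)) * real L ^ (CARD('d) - 1)"
    proof -
      have "real L ^ (CARD('d) - 1) * real L = real L ^ CARD('d)"
        by (metis Suc_pred' power_Suc2 zero_less_card_finite)
      then show ?thesis by (simp add: H_def algebra_simps) 
    qed
    finally have ln_le: "ln (real (card (range code))) \<le>
        H * real L ^ CARD('d) + (2 * real \<rho> * real CARD('d) * ln (16 / e + 3)) * real L ^ (CARD('d) - 1)" .
    have close: "dist (eval_character a (\<alpha> n x)) (eval_character a (\<alpha> n y)) < e"
      if xy: "code x = code y" and n: "n \<in> B" for x y n
    proof -
      have pe: "p j x = p j y" if "j \<in> J" for j
      proof -
        have "fst (code x) j = fst (code y) j" using xy by simp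
        then have "\<lfloor>p j x\<rfloor> = \<lfloor>p j y\<rfloor>" using that by (simp add: code_def)
        moreover have "of_int \<lfloor>p j z\<rfloor> = p j z" for z using p_int[of j z] by (auto elim!: Ints_cases)
        ultimately show ?thesis by (metis (no_types))
      qed
      have te: "\<bar>t n x - t n y\<bar> \<le> \<delta>" if "n \<in> D" for n
      proof -
        have "snd (code x) n = snd (code y) n" using xy by simp
        then have "\<lfloor>t n x / \<delta>\<rfloor> = \<lfloor>t n y / \<delta>\<rfloor>" using that by (simp add: code_def)
        then have "\<bar>t n x / \<delta> - t n y / \<delta>\<bar> < 1" by linarith
        then have "\<bar>(t n x - t n y) / \<delta>\<bar> < 1" by (simp add: diff_divide_distrib)
        then show ?thesis using \<delta> by (simp add: abs_divide)
      qed
      have "\<bar>t n x - t n y\<bar> \<le> \<delta> * real_of_int A ^ nat (weight v n + b)"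
      proof (rule difference_equation_growth[where w = "\<lambda>n. t n x - t n y", OF l JB _ _ _ A_real less_imp_le[OF \<delta>] n])
        show "- b \<le> weight v n" if "n \<in> B" for n using low[OF that] by (auto simp: abs_le_iff)
        show "(\<Sum>m\<in>?K. of_int (?f m) * (t (m + j) x - t (m + j) y)) = 0" if "j \<in> J" for j
          using pe[OF that] by (simp add: p_def right_diff_distrib sum_subtractf)
        show "\<bar>t n x - t n y\<bar> \<le> \<delta>" if "n \<in> B - (\<lambda>j. l + j) ` J" for n using te that by (simp add: D_def)
      qed
      also have "\<dots> \<le> \<delta> * real_of_int A ^ R"
        using A1 \<delta> low[OF n] by (intro mult_left_mono power_increasing) (auto simp: R_def abs_le_iff)
      also have "\<dots> = e / 8" using A1 by (simp add: \<delta>_def)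
      finally have tt: "\<bar>t n x - t n y\<bar> \<le> e / 8" .
      have "dist (eval_character a (\<alpha> n x)) (eval_character a (\<alpha> n y)) =
          cmod (exp (\<i> * of_real (2 * pi * t n y)) * (exp (\<i> * of_real (2 * pi * (t n x - t n y))) - 1))"
        unfolding dist_norm t[symmetric]
        by (simp add: right_diff_distrib exp_diff)
      also have "\<dots> = cmod (exp (\<i> * of_real (2 * pi * (t n x - t n y))) - 1)" by (simp add: norm_mult)
      also have "\<dots> \<le> \<bar>2 * pi * (t n x - t n y)\<bar>"
        using iexp_approx1[of "2 * pi * (t n x - t n y)" 0] by simp
      also have "\<dots> = 2 * pi * \<bar>t n x - t n y\<bar>" by (simp add: abs_mult)
      also have "\<dots> \<le> 2 * pi * (e / 8)" using tt by (intro mult_left_mono) auto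
      also have "\<dots> < e" using e pi_less_4 by simp
      finally show ?thesis .
    qed
    show ?thesis
      unfolding codable_def
      using finc ln_le close unfolding L_def B_def by (intro exI[of _ code]) blast
  qed
  show ?thesis
    by (rule exI[of _ H], rule exI[of _ "2 * \<rho> + 1"]) (use main in blast)
qed

lemma finitely_generated_dual:
  fixes \<alpha> :: "int ^ 'd \<Rightarrow> 'a::{topological_ab_group_add, metric_space} \<Rightarrow> 'a"
  assumes \<alpha>: "algebraic_action \<alpha>" and noeth: "noetherian_action \<alpha>"
  obtains S where "finite S" "module.span (dual_scale \<alpha>) S = UNIV"
proof -
  interpret module "dual_scale \<alpha>" by (rule dual_module[OF \<alpha>])
  show ?thesis using noeth that subspace_UNIV
    unfolding noetherian_action_def noetherian_module_def by blast
qed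

text \<open>The characters that agree along the two orbits form a submodule, hence all characters do
  once the generators do.\<close>

lemma generators_separate:
  fixes \<alpha> :: "int ^ 'd \<Rightarrow> 'a::{topological_ab_group_add, metric_space} \<Rightarrow> 'a"
  assumes \<alpha>: "algebraic_action \<alpha>" and span: "module.span (dual_scale \<alpha>) S = UNIV"
    and eq: "\<And>s n. s \<in> S \<Longrightarrow> eval_character s (\<alpha> n x) = eval_character s (\<alpha> n y)"
  shows "x = y"
proof -
  interpret module "dual_scale \<alpha>" by (rule dual_module[OF \<alpha>])
  define W where "W = {a. \<forall>n. eval_character a (\<alpha> n x) = eval_character a (\<alpha> n y)}"
  have "subspace W"
    unfolding subspace_def
    by (auto simp: W_def eval_character_add eval_dual_scale[OF \<alpha>] action_props(5)[OF \<alpha>, symmetric])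
  then have "span S \<subseteq> W" using eq by (intro span_minimal) (auto simp: W_def)
  then have W: "a \<in> W" for a using span by auto
  have "x - y = 0"
  proof (rule ccontr)
    assume "x - y \<noteq> 0"
    then obtain a :: "'a character" where "eval_character a (x - y) \<noteq> 1"
      using character_separates[OF action_props(1)[OF \<alpha>]] by blast
    moreover have "eval_character a x = eval_character a y"
      using W[of a] unfolding W_def by (metis (mono_tags, lifting) action_props(6)[OF \<alpha>] mem_Collect_eq)
    ultimately show False by (simp add: eval_character_diff eval_character_props(6))
  qed
  then show ?thesis by simp
qed

text \<open>Otherwise there are points \<open>x N\<close> and \<open>y N\<close> agreeing ever
  better on ever larger windows. Along a subsequence both converge, to the same limit because
  generators separate points, and a member of the cover around that limit must contain some
  \<open>y N\<close>, against their choice.\<close>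

lemma generator_Lebesgue_number:
  fixes \<alpha> :: "int ^ 'd \<Rightarrow> 'a::{topological_ab_group_add, metric_space} \<Rightarrow> 'a"
  assumes \<alpha>: "algebraic_action \<alpha>" and span: "module.span (dual_scale \<alpha>) S = UNIV"
    and U: "finite_open_cover U"
  obtains N :: nat and e :: real where "e > 0" "\<And>x. \<exists>u\<in>U. \<forall>y. (\<forall>s\<in>S. \<forall>n\<in>cube (- int N) (int N + 1).
    dist (eval_character s (\<alpha> n x)) (eval_character s (\<alpha> n y)) < e) \<longrightarrow> y \<in> u"
proof (rule ccontr)
  assume neg: "\<not> thesis"
  define near where "near N x y \<longleftrightarrow> (\<forall>s\<in>S. \<forall>n\<in>cube (- int N) (int N + 1).
    dist (eval_character s (\<alpha> n x)) (eval_character s (\<alpha> n y)) < 1 / real (Suc N))" for N :: nat and x y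
  have "\<exists>x. \<forall>u\<in>U. \<exists>y. near N x y \<and> y \<notin> u" for N
  proof (rule ccontr)
    assume "\<nexists>x. \<forall>u\<in>U. \<exists>y. near N x y \<and> y \<notin> u"
    then have "\<exists>u\<in>U. \<forall>y. near N x y \<longrightarrow> y \<in> u" for x by blast
    then have thesis unfolding near_def by (rule that[of "1 / real (Suc N)" N, rotated]) simp
    with neg show False ..
  qed
  then obtain x where x: "\<And>N u. u \<in> U \<Longrightarrow> \<exists>y. near N (x N) y \<and> y \<notin> u" by metis
  have seq: "seq_compact (UNIV :: 'a set)"
    using action_props(1)[OF \<alpha>] compact_eq_seq_compact_metric by blast
  obtain l r where r: "strict_mono (r :: nat \<Rightarrow> nat)" "(x \<circ> r) \<longlonglongrightarrow> l"
    using seq unfolding seq_compact_def by blast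
  obtain u where u: "u \<in> U" "l \<in> u" using U by (auto simp: finite_open_cover_def) (metis UNIV_I UnionE)
  have "\<exists>y. near N (x N) y \<and> y \<notin> u" for N using x[OF u(1)] .
  then obtain y where y: "\<And>N. near N (x N) (y N)" "\<And>N. y N \<notin> u" by metis
  obtain m r' where r': "strict_mono (r' :: nat \<Rightarrow> nat)" "((y \<circ> r) \<circ> r') \<longlonglongrightarrow> m"
    using seq unfolding seq_compact_def by blast
  have "closed (- u)" using U u(1) by (auto simp: finite_open_cover_def closed_def)
  then have "m \<in> - u" using closed_sequentially[of "- u" "(y \<circ> r) \<circ> r'" m] y(2) r'(2) by auto
  moreover have "l = m"
  proof (rule generators_separate[OF \<alpha> span])
    fix s n assume s: "s \<in> S"
    define k where "k j = r (r' j)" for j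
    have k: "strict_mono k" using r(1) r'(1) by (auto simp: k_def strict_mono_def)
    have xl: "(\<lambda>j. x (k j)) \<longlonglongrightarrow> l"
      using LIMSEQ_subseq_LIMSEQ[OF r(2) r'(1)] by (simp add: o_def k_def)
    have ym: "(\<lambda>j. y (k j)) \<longlonglongrightarrow> m" using r'(2) by (simp add: o_def k_def)
    have c: "continuous_on UNIV (\<lambda>z. eval_character s (\<alpha> n z))"
      by (rule continuous_on_compose2[OF eval_character_props(1) action_props(3)[OF \<alpha>]]) simp
    have "(\<lambda>j. dist (eval_character s (\<alpha> n (x (k j)))) (eval_character s (\<alpha> n (y (k j)))))
        \<longlonglongrightarrow> dist (eval_character s (\<alpha> n l)) (eval_character s (\<alpha> n m))"
      by (intro tendsto_dist continuous_on_tendsto_compose[OF c xl] continuous_on_tendsto_compose[OF c ym]) auto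
    moreover have "(\<lambda>j. dist (eval_character s (\<alpha> n (x (k j)))) (eval_character s (\<alpha> n (y (k j))))) \<longlonglongrightarrow> 0"
    proof (rule tendsto_sandwich[OF _ _ tendsto_const])
      obtain \<rho> where \<rho>: "\<And>i. \<bar>n $ i\<bar> \<le> int \<rho>" using keys_bounded[of "{n}"] by (metis finite.emptyI finite.insertI singletonI)
      show "\<forall>\<^sub>F j in sequentially. dist (eval_character s (\<alpha> n (x (k j)))) (eval_character s (\<alpha> n (y (k j)))) \<le> 1 / real (Suc j)"
      proof (rule eventually_sequentiallyI[of \<rho>])
        fix j assume "\<rho> \<le> j"
        moreover have kj: "j \<le> k j" using k by (rule strict_mono_imp_increasing)
        ultimately have \<rho>k: "int \<rho> \<le> int (k j)" by simp
        have "n \<in> cube (- int (k j)) (int (k j) + 1)"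
          unfolding cube_def
        proof (intro CollectI allI)
          fix i show "- int (k j) \<le> n $ i \<and> n $ i < int (k j) + 1"
            using \<rho>[of i] \<rho>k unfolding abs_le_iff by linarith
        qed
        then have "dist (eval_character s (\<alpha> n (x (k j)))) (eval_character s (\<alpha> n (y (k j)))) < 1 / real (Suc (k j))"
          using y(1)[of "k j"] s unfolding near_def by blast
        also have "\<dots> \<le> 1 / real (Suc j)" using kj by (intro divide_left_mono) auto
        finally show "dist (eval_character s (\<alpha> n (x (k j)))) (eval_character s (\<alpha> n (y (k j)))) \<le> 1 / real (Suc j)" by simp
      qed
      show "(\<lambda>j. 1 / real (Suc j)) \<longlonglongrightarrow> 0" using LIMSEQ_inverse_real_of_nat by (simp add: inverse_eq_divide)
    qed auto
    ultimately have "dist (eval_character s (\<alpha> n l)) (eval_character s (\<alpha> n m)) = 0"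
      by (rule LIMSEQ_unique)
    then show "eval_character s (\<alpha> n l) = eval_character s (\<alpha> n m)" by simp
  qed
  ultimately show False using u(2) by simp
qed

text \<open>The sets of points with equal code refine the join: the window of radius
  \<open>N\<close> around a site of the box stays inside the box enlarged by
  \<open>N\<close>.\<close>

lemma min_subcover_card_le_codes:
  fixes \<alpha> :: "int ^ 'd \<Rightarrow> 'a::{topological_ab_group_add, metric_space} \<Rightarrow> 'a" and code :: "'a \<Rightarrow> 'c"
  assumes \<alpha>: "algebraic_action \<alpha>" and U: "finite_open_cover U"
    and leb: "\<And>x. \<exists>u\<in>U. \<forall>y. (\<forall>s\<in>S. \<forall>n\<in>cube (- int N) (int N + 1).
      dist (eval_character s (\<alpha> n x)) (eval_character s (\<alpha> n y)) < e) \<longrightarrow> y \<in> u"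
    and fin: "finite (range code)"
    and code: "\<And>x y s n. code x = code y \<Longrightarrow> s \<in> S \<Longrightarrow> n \<in> cube (- int N) (int (k + N)) \<Longrightarrow>
      dist (eval_character s (\<alpha> n x)) (eval_character s (\<alpha> n y)) < e"
  shows "min_subcover_card (join_cover \<alpha> k U) \<le> card (range code)"
proof -
  define V where "V = (\<lambda>c. code -` {c}) ` range code"
  have "min_subcover_card (join_cover \<alpha> k U) \<le> card V"
  proof (rule min_subcover_card_le)
    show "finite V" using fin by (simp add: V_def)
    show "\<Union>V = UNIV" by (auto simp: V_def)
    fix v assume "v \<in> V"
    then obtain x where v: "v = {y. code y = code x}" by (auto simp: V_def vimage_def)
    obtain u where u: "\<And>m. u m \<in> U" "\<And>m y. (\<forall>s\<in>S. \<forall>n\<in>cube (- int N) (int N + 1).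
        dist (eval_character s (\<alpha> n (\<alpha> m x))) (eval_character s (\<alpha> n y)) < e) \<Longrightarrow> y \<in> u m"
      using leb[of "\<alpha> _ x"] by metis
    define w where "w = (\<Inter>m\<in>cube 0 (int k). \<alpha> (- m) ` u m)"
    have "w \<in> join_cover \<alpha> k U" unfolding join_cover_eq join_over_def w_def using u(1) by auto
    moreover have "v \<subseteq> w"
    proof
      fix y assume "y \<in> v"
      then have xy: "code x = code y" by (simp add: v)
      have "\<alpha> m y \<in> u m" if m: "m \<in> cube 0 (int k)" for m
      proof (rule u(2), intro ballI)
        fix s and n :: "int ^ 'd" assume s: "s \<in> S" and n: "n \<in> cube (- int N) (int N + 1)"
        have "n + m \<in> cube (- int N) (int (k + N))"
          unfolding cube_def
        proof (intro CollectI allI)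
          fix i
          have "- int N \<le> n $ i" "n $ i < int N + 1" "0 \<le> m $ i" "m $ i < int k"
            using n m by (auto simp: cube_def)
          then show "- int N \<le> (n + m) $ i \<and> (n + m) $ i < int (k + N)" by simp
        qed
        from code[OF xy s this]
        show "dist (eval_character s (\<alpha> n (\<alpha> m x))) (eval_character s (\<alpha> n (\<alpha> m y))) < e"
          by (simp add: action_props(5)[OF \<alpha>])
      qed
      then show "y \<in> w" by (simp add: w_def mem_image_action[OF \<alpha> U])
    qed
    ultimately show "\<exists>w\<in>join_cover \<alpha> k U. v \<subseteq> w" by blast
  qed
  also have "\<dots> \<le> card (range code)" unfolding V_def using fin by (rule card_image_le)
  finally show ?thesis .
qed

lemma volume_ratio_limit:
  fixes d :: nat
  assumes "d > 0"
  shows "(\<lambda>k. (a * real (k + 2 * N) ^ d + b * real (k + 2 * N) ^ (d - 1)) / real k ^ d) \<longlonglongrightarrow> a"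
proof -
  have lim: "(\<lambda>k. 2 * real N / real k) \<longlonglongrightarrow> 0"
    by (rule real_tendsto_divide_at_top[OF tendsto_const filterlim_real_sequentially])
  have "(\<lambda>k. a * (1 + 2 * real N / real k) ^ d + b * (1 + 2 * real N / real k) ^ (d - 1) * (1 / real k))
      \<longlonglongrightarrow> a * (1 + 0) ^ d + b * (1 + 0) ^ (d - 1) * 0"
    by (intro tendsto_intros lim lim_1_over_n)
  then have *: "(\<lambda>k. a * (1 + 2 * real N / real k) ^ d + b * (1 + 2 * real N / real k) ^ (d - 1) * (1 / real k)) \<longlonglongrightarrow> a"
    by simp
  show ?thesis
  proof (rule Lim_transform_eventually[OF *], rule eventually_sequentiallyI[of 1])
    fix k :: nat assume k: "1 \<le> k"
    have q: "1 + 2 * real N / real k = real (k + 2 * N) / real k" using k by (simp add: field_simps)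
    obtain d' where d': "d = Suc d'" using assms by (cases d) auto
    show "a * (1 + 2 * real N / real k) ^ d + b * (1 + 2 * real N / real k) ^ (d - 1) * (1 / real k) =
        (a * real (k + 2 * N) ^ d + b * real (k + 2 * N) ^ (d - 1)) / real k ^ d"
      unfolding q d' power_divide using k by (simp add: add_divide_distrib)
  qed
qed

text \<open>The codes of finitely many generators combine into one code for the join, and their
  leading constants \<open>H s\<close> do not depend on the cover, so their sum bounds all cover
  entropies at once.\<close>

lemma torsion_dual_imp_finite_entropy:
  fixes \<alpha> :: "int ^ 'd \<Rightarrow> 'a::{topological_ab_group_add, metric_space} \<Rightarrow> 'a"
  assumes \<alpha>: "algebraic_action \<alpha>" and noeth: "noetherian_action \<alpha>" and tors: "torsion_dual \<alpha>"
  shows "topological_entropy \<alpha> < \<infinity>"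
proof -
  obtain S where S: "finite S" "module.span (dual_scale \<alpha>) S = UNIV"
    by (rule finitely_generated_dual[OF \<alpha> noeth])
  have "\<exists>H \<rho>. \<forall>e>0. \<exists>c. \<forall>N k. k \<ge> \<rho> \<longrightarrow>
    codable \<alpha> s e N k (H * real (k + 2 * N) ^ CARD('d) + c * real (k + 2 * N) ^ (CARD('d) - 1))" for s
  proof -
    obtain f where "f \<noteq> 0" "dual_scale \<alpha> f s = 0" using tors by (auto simp: torsion_dual_def)
    then show ?thesis by (rule torsion_coding[OF \<alpha>])
  qed
  then obtain H \<rho> where H: "\<And>s e. e > 0 \<Longrightarrow> \<exists>c. \<forall>N k. k \<ge> \<rho> s \<longrightarrow>
    codable \<alpha> s e N k (H s * real (k + 2 * N) ^ CARD('d) + c * real (k + 2 * N) ^ (CARD('d) - 1))"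
    by metis
  have le: "cover_entropy \<alpha> U \<le> (\<Sum>s\<in>S. H s)" if U: "finite_open_cover U" for U
  proof -
    obtain N :: nat and e :: real where e: "e > 0"
      and leb: "\<And>x. \<exists>u\<in>U. \<forall>y. (\<forall>s\<in>S. \<forall>n\<in>cube (- int N) (int N + 1).
        dist (eval_character s (\<alpha> n x)) (eval_character s (\<alpha> n y)) < e) \<longrightarrow> y \<in> u"
      by (rule generator_Lebesgue_number[OF \<alpha> S(2) U]) (rule that)
    from H[OF e] obtain c where c: "\<And>s N k. k \<ge> \<rho> s \<Longrightarrow>
      codable \<alpha> s e N k (H s * real (k + 2 * N) ^ CARD('d) + c s * real (k + 2 * N) ^ (CARD('d) - 1))"
      by metis
    have bound: "ln (real (min_subcover_card (join_cover \<alpha> k U))) \<le>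
        (\<Sum>s\<in>S. H s) * real (k + 2 * N) ^ CARD('d) + (\<Sum>s\<in>S. c s) * real (k + 2 * N) ^ (CARD('d) - 1)"
      if k: "k \<ge> (\<Sum>s\<in>S. \<rho> s)" for k
    proof -
      have "\<forall>s\<in>S. codable \<alpha> s e N k (H s * real (k + 2 * N) ^ CARD('d) + c s * real (k + 2 * N) ^ (CARD('d) - 1))"
      proof
        fix s assume "s \<in> S"
        then have "\<rho> s \<le> (\<Sum>s\<in>S. \<rho> s)" using S(1) by (intro member_le_sum) auto
        with k have "k \<ge> \<rho> s" by simp
        then show "codable \<alpha> s e N k (H s * real (k + 2 * N) ^ CARD('d) + c s * real (k + 2 * N) ^ (CARD('d) - 1))" by (rule c)
      qed
      from bchoice[OF this[unfolded codable_def]] obtain code :: "'a character \<Rightarrow> 'a \<Rightarrow> (int ^ 'd \<Rightarrow> int) \<times> (int ^ 'd \<Rightarrow> int)" where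
        code: "\<And>s. s \<in> S \<Longrightarrow> finite (range (code s))"
          "\<And>s. s \<in> S \<Longrightarrow> ln (real (card (range (code s)))) \<le> H s * real (k + 2 * N) ^ CARD('d) + c s * real (k + 2 * N) ^ (CARD('d) - 1)"
          "\<And>s x y n. s \<in> S \<Longrightarrow> code s x = code s y \<Longrightarrow> n \<in> cube (- int N) (int (k + N)) \<Longrightarrow>
            dist (eval_character s (\<alpha> n x)) (eval_character s (\<alpha> n y)) < e"
        by blast
      define C where "C x = restrict (\<lambda>s. code s x) S" for x
      have sub: "range C \<subseteq> (\<Pi>\<^sub>E s\<in>S. range (code s))" by (auto simp: C_def)
      have fin: "finite (\<Pi>\<^sub>E s\<in>S. range (code s))" using S(1) code(1) by (intro finite_PiE) auto
      have "min_subcover_card (join_cover \<alpha> k U) \<le> card (range C)"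
      proof (rule min_subcover_card_le_codes[OF \<alpha> U leb finite_subset[OF sub fin]])
        fix x y s and n :: "int ^ 'd" assume "C x = C y" and s: "s \<in> S" and n: "n \<in> cube (- int N) (int (k + N))"
        then have "C x s = C y s" by simp
        then have "code s x = code s y" using s by (simp add: C_def)
        then show "dist (eval_character s (\<alpha> n x)) (eval_character s (\<alpha> n y)) < e" using code(3) s n by blast
      qed
      also have "\<dots> \<le> card (\<Pi>\<^sub>E s\<in>S. range (code s))" by (rule card_mono[OF fin sub])
      also have "\<dots> = (\<Prod>s\<in>S. card (range (code s)))" using S(1) by (rule card_PiE)
      finally have "real (min_subcover_card (join_cover \<alpha> k U)) \<le> real (\<Prod>s\<in>S. card (range (code s)))"
        by (simp only: of_nat_le_iff)
      moreover have "min_subcover_card (join_cover \<alpha> k U) > 0"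
        using complexity_pos[OF \<alpha> U finite_cube, of 0 "int k"] by (simp add: complexity_def[OF \<alpha> U] join_cover_eq)
      ultimately have "ln (real (min_subcover_card (join_cover \<alpha> k U))) \<le> ln (\<Prod>s\<in>S. real (card (range (code s))))"
        by (intro ln_mono) auto
      also have "\<dots> = (\<Sum>s\<in>S. ln (real (card (range (code s)))))"
        using code(1) by (intro ln_prod S(1)) (auto simp: card_gt_0_iff)
      also have "\<dots> \<le> (\<Sum>s\<in>S. H s * real (k + 2 * N) ^ CARD('d) + c s * real (k + 2 * N) ^ (CARD('d) - 1))"
        by (intro sum_mono code(2))
      finally show ?thesis by (simp only: sum.distrib sum_distrib_right)
    qed
    show ?thesis
    proof (rule tendsto_le[OF sequentially_bot volume_ratio_limit cover_entropy_tendsto[OF \<alpha> U]])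
      show "CARD('d) > 0" by simp
      show "\<forall>\<^sub>F k in sequentially. ln (real (min_subcover_card (join_cover \<alpha> k U))) / real k ^ CARD('d) \<le>
          ((\<Sum>s\<in>S. H s) * real (k + 2 * N) ^ CARD('d) + (\<Sum>s\<in>S. c s) * real (k + 2 * N) ^ (CARD('d) - 1)) / real k ^ CARD('d)"
        by (rule eventually_sequentiallyI[of "\<Sum>s\<in>S. \<rho> s"]) (intro divide_right_mono bound; simp)
    qed
  qed
  have "topological_entropy \<alpha> \<le> ereal (\<Sum>s\<in>S. H s)"
    unfolding topological_entropy_def using le by (intro SUP_least) auto
  then show ?thesis by (rule le_less_trans) simp
qed

section \<open>Nonaffine maps for dual modules with free elements\<close>

lemma lookup_laurent_mult:
  fixes f g :: "'d::finite laurent"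
  shows "Poly_Mapping.lookup (f * g) m =
    (\<Sum>n\<in>Poly_Mapping.keys f. Poly_Mapping.lookup f n * Poly_Mapping.lookup g (m - n))"
proof -
  have "Poly_Mapping.lookup (f * g) m = Sum_any (\<lambda>n. Poly_Mapping.lookup f n * Poly_Mapping.lookup g (m - n))"
  proof -
    have "(m = n + q) = (m - n = q)" for n q :: "int ^ 'd" by (auto simp: algebra_simps)
    then show ?thesis unfolding lookup_mult by simp
  qed
  also have "\<dots> = (\<Sum>n\<in>Poly_Mapping.keys f. Poly_Mapping.lookup f n * Poly_Mapping.lookup g (m - n))"
    by (rule Sum_any.expand_superset) (auto simp: in_keys_iff)
  finally show ?thesis .
qed

text \<open>The coefficients of \<open>g\<close> form a finitely supported, hence square summable,
  solution of the difference equation of \<open>f\<close>.\<close>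

lemma laurent_no_zero_divisors:
  fixes f g :: "'d::finite laurent"
  assumes "f * g = 0" "f \<noteq> 0"
  shows "g = 0"
proof -
  have "real_of_int (Poly_Mapping.lookup g z) = 0" for z
  proof (rule square_summable_kernel_real[OF assms(2)])
    show "(\<Sum>n\<in>J. (real_of_int (Poly_Mapping.lookup g n))\<^sup>2) \<le>
        (\<Sum>n\<in>Poly_Mapping.keys g. (real_of_int (Poly_Mapping.lookup g n))\<^sup>2)" if "finite J" for J
    proof -
      have "(\<Sum>n\<in>J. (real_of_int (Poly_Mapping.lookup g n))\<^sup>2) =
          (\<Sum>n\<in>J \<inter> Poly_Mapping.keys g. (real_of_int (Poly_Mapping.lookup g n))\<^sup>2)"
        using that by (intro sum.mono_neutral_right) (auto simp: in_keys_iff)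
      also have "\<dots> \<le> (\<Sum>n\<in>Poly_Mapping.keys g. (real_of_int (Poly_Mapping.lookup g n))\<^sup>2)"
        by (intro sum_mono2) auto
      finally show ?thesis .
    qed
    show "(\<Sum>n\<in>Poly_Mapping.keys f. of_int (Poly_Mapping.lookup f n) * real_of_int (Poly_Mapping.lookup g (m - n))) = 0" for m
      using lookup_laurent_mult[of f g m] assms(1) by (simp flip: of_int_mult of_int_sum)
  qed
  then show ?thesis by (intro poly_mapping_eqI) simp
qed

text \<open>Let \<open>A\<close> be a maximal set of generators whose span misses the multiples of \<open>a\<close>. A common multiple
  \<open>f\<close> then carries the whole module into \<open>\<langle>a\<rangle> \<oplus> span A\<close>, and the functional is the coordinate of
  \<open>f *s x\<close> along \<open>a\<close>.\<close>

lemma functional_on_free_element: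
  fixes scale :: "'r::comm_ring_1 \<Rightarrow> 'm::ab_group_add \<Rightarrow> 'm"
  assumes "module scale" and nzd: "\<And>f g :: 'r. f * g = 0 \<Longrightarrow> f \<noteq> 0 \<Longrightarrow> g = 0"
    and S: "finite S" "module.span scale S = UNIV"
    and free: "\<And>r. scale r a = 0 \<Longrightarrow> r = 0"
  obtains T where "\<And>x y. T (x + y) = T x + T y" "\<And>r x. T (scale r x) = r * T x" "T a \<noteq> (0 :: 'r)"
proof -
  interpret module scale by fact
  define P where "P A \<longleftrightarrow> (\<forall>r. scale r a \<in> span A \<longrightarrow> r = 0)" for A
  define X where "X = {A. A \<subseteq> S \<and> P A}"
  have "finite X" using S(1) by (simp add: X_def)
  moreover have "{} \<in> X" using free by (simp add: P_def X_def)
  ultimately have "\<exists>A\<in>X. {} \<subseteq> A \<and> (\<forall>B\<in>X. A \<subseteq> B \<longrightarrow> A = B)"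
    by (rule finite_has_maximal2)
  then obtain A where "A \<in> X" and maxX: "\<forall>B\<in>X. A \<subseteq> B \<longrightarrow> A = B" by auto
  then have A: "A \<subseteq> S" "P A" by (auto simp: X_def)
  have max: "A = B" if "B \<subseteq> S" "P B" "A \<subseteq> B" for B
    using maxX that by (simp add: X_def)
  have "\<exists>g. g \<noteq> 0 \<and> (\<exists>h. scale g b - scale h a \<in> span A)" if b: "b \<in> S" for b
  proof (cases "b \<in> A")
    case True
    then show ?thesis by (intro exI[of _ 1] conjI exI[of _ 0]) (auto intro: span_base)
  next
    case False
    \<comment> \<open>By maximality, adding \<open>b\<close> brings a nonzero multiple of
      \<open>a\<close> into the span. The coefficient of \<open>b\<close> cannot be 0, since the
      span of \<open>A\<close> alone contains no such multiple.\<close>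
    have "\<not> P (insert b A)" using max[of "insert b A"] A(1) b False by blast
    then obtain r where r: "scale r a \<in> span (insert b A)" "r \<noteq> 0" by (auto simp: P_def)
    then obtain k where k: "scale r a - scale k b \<in> span A" by (auto simp: span_breakdown_eq)
    have "k \<noteq> 0" using k r(2) A(2) by (auto simp: P_def)
    moreover have "scale k b - scale r a \<in> span A" using span_neg[OF k] by simp
    ultimately show ?thesis by blast
  qed
  then obtain g where g: "\<And>b. b \<in> S \<Longrightarrow> g b \<noteq> 0" "\<And>b. b \<in> S \<Longrightarrow> \<exists>h. scale (g b) b - scale h a \<in> span A"
    by metis
  define f where "f = (\<Prod>b\<in>S. g b)"
  have f0: "f \<noteq> 0" unfolding f_def using S(1) g(1)
  proof (induction S)
    case (insert b S)
    then show ?case using nzd[of "g b" "\<Prod>b\<in>S. g b"] by auto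
  qed auto
  define W where "W = {x. \<exists>h. scale f x - scale h a \<in> span A}"
  have "subspace W"
    unfolding subspace_def
  proof (intro conjI ballI allI)
    show "0 \<in> W" unfolding W_def by (intro CollectI exI[of _ 0]) (simp add: span_zero)
    fix x assume "x \<in> W"
    then obtain h where h: "scale f x - scale h a \<in> span A" by (auto simp: W_def)
    show "scale c x \<in> W" for c
    proof -
      have "scale c (scale f x - scale h a) \<in> span A" by (rule span_scale[OF h])
      then have "scale f (scale c x) - scale (c * h) a \<in> span A"
        by (simp add: scale_right_diff_distrib mult.commute)
      then show ?thesis by (auto simp: W_def)
    qed
    fix y assume "y \<in> W"
    then obtain h' where h': "scale f y - scale h' a \<in> span A" by (auto simp: W_def)
    have "scale f (x + y) - scale (h + h') a \<in> span A"
      using span_add[OF h h'] by (simp add: scale_right_distrib scale_left_distrib algebra_simps)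
    then show "x + y \<in> W" by (auto simp: W_def)
  qed
  moreover have "S \<subseteq> W"
  proof
    fix b assume b: "b \<in> S"
    obtain h where h: "scale (g b) b - scale h a \<in> span A" using g(2)[OF b] by blast
    define c where "c = (\<Prod>b\<in>S - {b}. g b)"
    have f: "f = c * g b" unfolding f_def c_def using S(1) b by (simp add: prod.remove mult.commute)
    have "scale c (scale (g b) b - scale h a) \<in> span A" by (rule span_scale[OF h])
    then have "scale f b - scale (c * h) a \<in> span A" by (simp add: scale_right_diff_distrib f)
    then show "b \<in> W" by (auto simp: W_def)
  qed
  ultimately have "span S \<subseteq> W" by (intro span_minimal)
  then have W: "\<exists>h. scale f x - scale h a \<in> span A" for x using S(2) by (auto simp: W_def)
  then obtain T where T: "\<And>x. scale f x - scale (T x) a \<in> span A" by metis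
  have uniq: "T x = h" if "scale f x - scale h a \<in> span A" for x h
  proof -
    have "scale f x - scale h a - (scale f x - scale (T x) a) \<in> span A" by (rule span_diff[OF that T])
    then have "scale (T x - h) a \<in> span A" by (simp add: scale_left_diff_distrib)
    then have "T x - h = 0" using A(2) by (auto simp: P_def)
    then show ?thesis by simp
  qed
  show ?thesis
  proof (rule that)
    show "T (x + y) = T x + T y" for x y
      using span_add[OF T[of x] T[of y]]
      by (intro uniq) (simp add: scale_right_distrib scale_left_distrib algebra_simps)
    show "T (scale r x) = r * T x" for r x
      using span_scale[OF T[of x], of r]
      by (intro uniq) (simp add: scale_right_diff_distrib mult.commute)
    have "T a = f" by (rule uniq) (simp add: span_zero)
    then show "T a \<noteq> 0" using f0 by simp
  qed
qed

section \<open>Laurent polynomials acting on real functions, and Pontryagin duality\<close>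

definition difference_operator ::
    "(int ^ 'd \<Rightarrow> 'a \<Rightarrow> 'a) \<Rightarrow> 'd laurent \<Rightarrow> ('a \<Rightarrow> real) \<Rightarrow> 'a \<Rightarrow> real" where
  "difference_operator \<alpha> f F x =
     (\<Sum>n\<in>Poly_Mapping.keys f. of_int (Poly_Mapping.lookup f n) * F (\<alpha> n x))"

lemma difference_operator_superset:
  assumes "finite K" "Poly_Mapping.keys f \<subseteq> K"
  shows "difference_operator \<alpha> f F x = (\<Sum>n\<in>K. of_int (Poly_Mapping.lookup f n) * F (\<alpha> n x))"
  unfolding difference_operator_def using assms
  by (intro sum.mono_neutral_left) (auto simp: in_keys_iff)

lemma difference_operator_add:
  "difference_operator \<alpha> (f + g) F x = difference_operator \<alpha> f F x + difference_operator \<alpha> g F x"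
proof -
  let ?K = "Poly_Mapping.keys f \<union> Poly_Mapping.keys g"
  have "finite ?K" "Poly_Mapping.keys (f + g) \<subseteq> ?K" "Poly_Mapping.keys f \<subseteq> ?K" "Poly_Mapping.keys g \<subseteq> ?K"
    using keys_add[of f g] by auto
  then show ?thesis
    by (simp add: difference_operator_superset[of ?K] lookup_add distrib_right sum.distrib)
qed

lemma difference_operator_shift:
  fixes \<alpha> :: "int ^ 'd \<Rightarrow> 'a::{topological_ab_group_add, metric_space} \<Rightarrow> 'a"
  assumes \<alpha>: "algebraic_action \<alpha>"
  shows "difference_operator \<alpha> (Poly_Mapping.single m 1 * g) F x = difference_operator \<alpha> g F (\<alpha> m x)"
proof -
  have l: "Poly_Mapping.lookup (Poly_Mapping.single m 1 * g) k = Poly_Mapping.lookup g (k - m)" for k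
    by (simp add: lookup_laurent_mult)
  let ?K = "(\<lambda>n. n + m) ` Poly_Mapping.keys g"
  have "Poly_Mapping.keys (Poly_Mapping.single m 1 * g) \<subseteq> ?K"
  proof
    fix k assume "k \<in> Poly_Mapping.keys (Poly_Mapping.single m 1 * g)"
    then have "k - m \<in> Poly_Mapping.keys g" by (simp add: in_keys_iff l)
    then show "k \<in> ?K" by (intro image_eqI[of _ _ "k - m"]) auto
  qed
  then have "difference_operator \<alpha> (Poly_Mapping.single m 1 * g) F x =
      (\<Sum>k\<in>?K. of_int (Poly_Mapping.lookup g (k - m)) * F (\<alpha> k x))"
    by (subst difference_operator_superset[of ?K]) (auto simp: l)
  also have "\<dots> = (\<Sum>n\<in>Poly_Mapping.keys g. of_int (Poly_Mapping.lookup g n) * F (\<alpha> (n + m) x))"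
    by (subst sum.reindex) (auto intro: inj_onI)
  also have "\<dots> = difference_operator \<alpha> g F (\<alpha> m x)"
    by (simp add: difference_operator_def action_props(5)[OF \<alpha>])
  finally show ?thesis .
qed

text \<open>\<open>int_scale\<close> is defined through powers of values, so an abstract
  homomorphism has to be related to it by induction from 0 in both directions.\<close>

lemma int_scale_homomorphism:
  fixes \<zeta> :: "'a::topological_ab_group_add character \<Rightarrow> complex"
  assumes hom: "\<And>a b. \<zeta> (a + b) = \<zeta> a * \<zeta> b" and nz: "\<And>a. \<zeta> a \<noteq> 0"
  shows "\<zeta> (int_scale k b) = \<zeta> b powi k"
proof (induction k rule: int_induct[of _ 0])
  case base
  have "\<zeta> 0 * \<zeta> 0 = \<zeta> 0" using hom[of 0 0] by simp
  then have "\<zeta> 0 = 1" using nz[of 0] by simp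
  moreover have "int_scale 0 b = 0" by (rule character_eqI) (simp add: eval_character_int_scale)
  ultimately show ?case by simp
next
  case (step1 i)
  have "int_scale (i + 1) b = int_scale i b + b"
    by (rule character_eqI) (simp add: eval_character_int_scale eval_character_add power_int_add)
  then show ?case using step1 nz[of b] by (simp add: hom power_int_add)
next
  case (step2 i)
  have "int_scale i b = int_scale (i - 1) b + b"
  proof (rule character_eqI)
    fix x show "eval_character (int_scale i b) x = eval_character (int_scale (i - 1) b + b) x"
      using power_int_add[of "eval_character b x" "i - 1" 1]
      by (simp add: eval_character_int_scale eval_character_add)
  qed
  then have "\<zeta> b powi i = \<zeta> (int_scale (i - 1) b) * \<zeta> b" using step2 by (simp add: hom)
  moreover have "\<zeta> b powi i = \<zeta> b powi (i - 1) * \<zeta> b" using power_int_add[of "\<zeta> b" "i - 1" 1] nz[of b] by simp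
  ultimately show ?case using nz[of b] by simp
qed

text \<open>Finitely many approximate conditions are solvable by
  \<open>character_values_dense\<close>, since a homomorphism \<open>\<zeta>\<close> respects all
  relations, and compactness gives a common solution. This is the surjectivity of evaluation onto
  the bidual.\<close>

lemma Pontryagin_duality:
  fixes \<zeta> :: "'a::{topological_ab_group_add, metric_space} character \<Rightarrow> complex"
  assumes cpt: "compact (UNIV :: 'a set)" and unit: "\<And>a. cmod (\<zeta> a) = 1"
    and hom: "\<And>a b. \<zeta> (a + b) = \<zeta> a * \<zeta> b"
  obtains y where "\<And>a. eval_character a y = \<zeta> a"
proof -
  have nz: "\<zeta> a \<noteq> 0" for a using unit[of a] by auto
  note scale = int_scale_homomorphism[of \<zeta>, OF hom nz]
  have z0: "\<zeta> 0 = 1" using hom[of 0 0] nz[of 0] by simp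
  have sum: "\<zeta> (\<Sum>i\<in>I. c i) = (\<Prod>i\<in>I. \<zeta> (c i))" for I and c :: "'a character \<Rightarrow> 'a character"
    by (induction I rule: infinite_finite_induct) (auto simp: hom z0)
  define C where "C = (\<lambda>(a, k :: nat). {y. dist (eval_character a y) (\<zeta> a) \<le> 1 / real (Suc k)})"
  have "UNIV \<inter> (\<Inter>i\<in>UNIV. C i) \<noteq> {}"
  proof (rule compact_imp_fip_image[OF cpt])
    show "closed (C i)" for i
      unfolding C_def by (auto split: prod.split intro!: closed_Collect_le continuous_intros eval_character_props)
    fix I' :: "('a character \<times> nat) set" assume I': "finite I'" "I' \<subseteq> UNIV"
    define M where "M = (\<Sum>i\<in>I'. snd i)"
    obtain y where y: "\<And>a. a \<in> fst ` I' \<Longrightarrow> dist (eval_character a y) (\<zeta> a) < 1 / real (Suc M)"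
    proof (rule character_values_dense[OF cpt, of "fst ` I'" \<zeta> "\<lambda>a. a" "1 / real (Suc M)"])
      show "(\<Prod>i\<in>fst ` I'. \<zeta> i powi k i) = 1" if "(\<Sum>i\<in>fst ` I'. int_scale (k i) i) = 0" for k
        using sum[of "\<lambda>i. int_scale (k i) i" "fst ` I'"] that by (simp add: scale z0)
    qed (use I' unit in auto)
    have "y \<in> C i" if i: "i \<in> I'" for i
    proof -
      obtain a k where ak: "i = (a, k)" by (cases i)
      have "snd i \<le> M" unfolding M_def using i I'(1) by (intro member_le_sum) auto
      then have "1 / real (Suc M) \<le> 1 / real (Suc k)" using ak by (intro divide_left_mono) auto
      moreover have "a \<in> fst ` I'" using i ak by force
      ultimately show ?thesis using y[of a] by (simp add: C_def ak)
    qed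
    then show "UNIV \<inter> (\<Inter>i\<in>I'. C i) \<noteq> {}" by blast
  qed
  then obtain y where y: "\<And>i. y \<in> C i" by blast
  have "eval_character a y = \<zeta> a" for a
  proof -
    have "dist (eval_character a y) (\<zeta> a) \<le> 1 / real (Suc k)" for k using y[of "(a, k)"] by (simp add: C_def)
    moreover have "(\<lambda>k. 1 / real (Suc k)) \<longlonglongrightarrow> 0" using LIMSEQ_inverse_real_of_nat by (simp add: inverse_eq_divide)
    ultimately have "dist (eval_character a y) (\<zeta> a) \<le> 0" by (intro LIMSEQ_le_const[of _ 0]) auto
    then show ?thesis by simp
  qed
  then show ?thesis by (rule that)
qed

lemma characters_eq:
  fixes x y :: "'a::{topological_ab_group_add, metric_space}"
  assumes cpt: "compact (UNIV :: 'a set)" and eq: "\<And>a. eval_character a x = eval_character a y"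
  shows "x = y"
proof (rule ccontr)
  assume "x \<noteq> y"
  then obtain a :: "'a character" where "eval_character a (x - y) \<noteq> 1"
    using character_separates[OF cpt, of "x - y"] by auto
  then show False by (simp add: eval_character_diff eq eval_character_props(6))
qed

text \<open>A closed graph argument: characters separate points, so the graph is cut out by closed
  conditions, one for each character, and the projection of a compact set is closed.\<close>

lemma continuous_if_characters_continuous:
  fixes \<phi> :: "'a::metric_space \<Rightarrow> 'b::{topological_ab_group_add, metric_space}"
  assumes cpt: "compact (UNIV :: 'a set)" "compact (UNIV :: 'b set)"
    and cont: "\<And>a. continuous_on UNIV (\<lambda>x. eval_character a (\<phi> x))"
  shows "continuous_on UNIV \<phi>"
proof -
  define G where "G = (\<Inter>a. {p :: 'a \<times> 'b. eval_character a (\<phi> (fst p)) = eval_character a (snd p)})"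
  have "closed G"
    unfolding G_def
    by (intro closed_INT ballI closed_Collect_eq continuous_on_compose2[OF cont]
        continuous_on_compose2[OF eval_character_props(1)] continuous_intros) auto
  have G: "(x, y) \<in> G \<longleftrightarrow> y = \<phi> x" for x y
    using characters_eq[OF cpt(2), of "\<phi> x" y] by (auto simp: G_def)
  have "closed (\<phi> -` B)" if "closed B" for B
  proof -
    have "compact (UNIV :: ('a \<times> 'b) set)" using compact_Times[OF cpt] by simp
    moreover have "closed (G \<inter> UNIV \<times> B)" using \<open>closed G\<close> that by (intro closed_Int closed_Times) auto
    ultimately have "compact (G \<inter> UNIV \<times> B)" using compact_Int_closed by fastforce
    then have "compact (fst ` (G \<inter> UNIV \<times> B))" by (intro compact_continuous_image continuous_intros)
    moreover have "fst ` (G \<inter> UNIV \<times> B) = \<phi> -` B"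
      using G by (force simp: image_iff)
    ultimately show ?thesis by (simp add: compact_imp_closed)
  qed
  then show ?thesis by (simp add: continuous_on_closed_vimage)
qed

text \<open>An affine map composed with a character is a constant times a character, so by
  uniqueness of the decomposition the mean zero part of its phase vanishes.\<close>

lemma affine_exp_constant:
  fixes \<phi> :: "'a::{topological_ab_group_add, metric_space} \<Rightarrow> 'b::topological_ab_group_add" and F :: "'a \<Rightarrow> real"
  assumes cpt: "compact (UNIV :: 'a set)" and conn: "connected (UNIV :: 'a set)"
    and aff: "affine_map \<phi>" and F: "continuous_on UNIV F"
    and eq: "\<And>x. eval_character a (\<phi> x) = exp (\<i> * of_real (F x))"
  shows "F x = integral\<^sup>L haar_measure F"
proof -
  obtain \<psi> y where \<psi>: "continuous_on UNIV \<psi>" "Modules.additive \<psi>" and \<phi>: "\<And>x. \<phi> x = \<psi> x + y"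
    using aff by (auto simp: affine_map_def)
  have add: "\<psi> (u + v) = \<psi> u + \<psi> v" for u v using \<psi>(2) by (rule Modules.additive.add)
  define e where "e x = eval_character a (\<psi> x)" for x
  have "e \<in> {e. continuous_on UNIV e \<and> (\<forall>x. cmod (e x) = 1) \<and> (\<forall>x y. e (x + y) = e x * e y)}"
    unfolding e_def
    by (auto simp: add eval_character_props(2,3) intro!: continuous_on_compose2[OF eval_character_props(1) \<psi>(1)])
  then have ev: "eval_character (Character e) = e" by (rule Character_inverse)
  define m where "m = integral\<^sup>L haar_measure F"
  have "(\<lambda>x. F x - m) = (\<lambda>x. 0)"
  proof (rule circle_map_decomposition_unique(2)[OF cpt conn])
    show "continuous_on UNIV (\<lambda>x. F x - m)" by (intro continuous_intros F)
    show "integral\<^sup>L haar_measure (\<lambda>x. F x - m) = 0"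
      using haar_integrable[OF cpt F] haar_const[OF cpt, of m] haar_integrable[OF cpt continuous_on_const[of _ m]]
      by (simp only: Bochner_Integration.integral_diff m_def diff_self)
    show "exp (\<i> * of_real m) * eval_character 0 x * exp (\<i> * of_real (F x - m)) =
        eval_character a y * eval_character (Character e) x * exp (\<i> * of_real 0)" for x
      using eq[of x] unfolding ev e_def \<phi>
      by (simp add: eval_character_props(3) mult.commute right_diff_distrib exp_diff)
  qed auto
  then show ?thesis by (simp add: fun_eq_iff m_def)
qed

lemma free_element_imp_nonaffine:
  fixes \<alpha>1 :: "int ^ 'd \<Rightarrow> 'a::{topological_ab_group_add, metric_space} \<Rightarrow> 'a"
    and \<alpha>2 :: "int ^ 'd \<Rightarrow> 'b::{topological_ab_group_add, metric_space} \<Rightarrow> 'b"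
  assumes \<alpha>1: "algebraic_action \<alpha>1" and \<alpha>2: "algebraic_action \<alpha>2"
    and conn: "connected (UNIV :: 'a set)" and mix: "mixing \<alpha>1" and noeth: "noetherian_action \<alpha>2"
    and nontrivial: "(UNIV :: 'a set) \<noteq> {0}" and not_tors: "\<not> torsion_dual \<alpha>2"
  obtains \<phi> where "continuous_on UNIV \<phi>" "equivariant \<alpha>1 \<alpha>2 \<phi>" "\<not> affine_map \<phi>"
proof -
  note ap1 = action_props[OF \<alpha>1] and ap2 = action_props[OF \<alpha>2]
  obtain a where free: "\<And>f. dual_scale \<alpha>2 f a = 0 \<Longrightarrow> f = 0" using not_tors by (auto simp: torsion_dual_def)
  obtain S where S: "finite S" "module.span (dual_scale \<alpha>2) S = UNIV"
    by (rule finitely_generated_dual[OF \<alpha>2 noeth])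
  obtain T where T: "\<And>x y. T (x + y) = T x + T y" "\<And>r x. T (dual_scale \<alpha>2 r x) = r * T x" "T a \<noteq> 0"
  proof (rule functional_on_free_element[of "dual_scale \<alpha>2" S a])
    show "module (dual_scale \<alpha>2)" by (rule dual_module[OF \<alpha>2])
    show "g = 0" if "f * g = 0" "f \<noteq> 0" for f g :: "'d laurent" using that by (rule laurent_no_zero_divisors)
    show "r = 0" if "dual_scale \<alpha>2 r a = 0" for r using that by (rule free)
  qed (use S in auto)
  \<comment> \<open>This function vanishes only at 0 and is therefore nonconstant, as the group has
    another point.\<close>
  define F where "F x = dist x 0" for x :: 'a
  have Fc: "continuous_on UNIV F" unfolding F_def by (intro continuous_intros)
  define G where "G b = difference_operator \<alpha>1 (T b) F" for b
  have Gc: "continuous_on UNIV (G b)" for b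
    unfolding G_def difference_operator_def
    by (intro continuous_intros continuous_on_compose2[OF Fc ap1(3)]) auto
  have G_add: "G (b + c) x = G b x + G c x" for b c x by (simp add: G_def T(1) difference_operator_add)
  \<comment> \<open>Equivariance of the map is linearity of \<open>T\<close> with respect to
    monomials.\<close>
  have G_shift: "G (dual_map (\<alpha>2 n) b) x = G b (\<alpha>1 n x)" for n b x
  proof -
    have "dual_map (\<alpha>2 n) b = dual_scale \<alpha>2 (Poly_Mapping.single n 1) b"
      by (rule character_eqI) (simp add: eval_dual_map ap2(2) dual_scale_single[OF \<alpha>2])
    then show ?thesis by (simp add: G_def T(2) difference_operator_shift[OF \<alpha>1])
  qed
  have "\<exists>y. \<forall>b. eval_character b y = exp (\<i> * of_real (G b x))" for x
    by (rule Pontryagin_duality[OF ap2(1), of "\<lambda>b. exp (\<i> * of_real (G b x))"])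
      (auto simp: G_add distrib_left exp_add)
  then obtain \<phi> where \<phi>: "\<And>b x. eval_character b (\<phi> x) = exp (\<i> * of_real (G b x))" by metis
  have "continuous_on UNIV \<phi>"
    by (rule continuous_if_characters_continuous[OF ap1(1) ap2(1)]) (unfold \<phi>, intro continuous_intros Gc)
  moreover have "equivariant \<alpha>1 \<alpha>2 \<phi>"
    unfolding equivariant_def
  proof (intro allI ext)
    fix n x
    have "\<phi> (\<alpha>1 n x) = \<alpha>2 n (\<phi> x)"
    proof (rule characters_eq[OF ap2(1)])
      fix b
      have "eval_character b (\<alpha>2 n (\<phi> x)) = eval_character (dual_map (\<alpha>2 n) b) (\<phi> x)"
        by (simp add: eval_dual_map ap2(2))
      also have "\<dots> = eval_character b (\<phi> (\<alpha>1 n x))" by (simp add: \<phi> G_shift)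
      finally show "eval_character b (\<phi> (\<alpha>1 n x)) = eval_character b (\<alpha>2 n (\<phi> x))" by simp
    qed
    then show "(\<phi> \<circ> \<alpha>1 n) x = (\<alpha>2 n \<circ> \<phi>) x" by simp
  qed
  moreover have "\<not> affine_map \<phi>"
  proof
    assume "affine_map \<phi>"
    \<comment> \<open>\<open>G a\<close> is the nonzero Laurent polynomial \<open>T a\<close>
      applied to \<open>F\<close>; if it were constant, so would be \<open>F\<close>.\<close>
    then have "G a x = integral\<^sup>L haar_measure (G a)" for x
      by (rule affine_exp_constant[OF ap1(1) conn _ Gc \<phi>])
    then have "F x = F 0" for x
      using difference_operator_constant[OF \<alpha>1 mix Fc T(3)] unfolding G_def difference_operator_def by blast
    then have "x = 0" for x :: 'a by (simp add: F_def)
    then show False using nontrivial by auto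
  qed
  ultimately show ?thesis by (rule that)
qed

text \<open>If the first group is a single point, every map out of it is constant and hence affine,
  whatever the entropy of the second action; \<open>nontrivial\<close> excludes this degenerate
  case. Both properties are compared with \<open>torsion_dual \<alpha>2\<close>.\<close>

theorem theorem1p1:
  fixes \<alpha>1 :: "int ^ 'd \<Rightarrow> 'a::{topological_ab_group_add, metric_space} \<Rightarrow> 'a"
    and \<alpha>2 :: "int ^ 'd \<Rightarrow> 'b::{topological_ab_group_add, metric_space} \<Rightarrow> 'b"
  assumes "algebraic_action \<alpha>1" and "algebraic_action \<alpha>2"
    and "connected (UNIV :: 'a set)" and "connected (UNIV :: 'b set)"
    and "mixing \<alpha>1" and "mixing \<alpha>2"
    and "noetherian_action \<alpha>1" and "noetherian_action \<alpha>2"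
    and nontrivial: "(UNIV :: 'a set) \<noteq> {0}"
  shows "(\<forall>\<phi>. continuous_on UNIV \<phi> \<and> equivariant \<alpha>1 \<alpha>2 \<phi> \<longrightarrow> affine_map \<phi>) \<longleftrightarrow>
         topological_entropy \<alpha>2 < \<infinity>"
proof
  assume rigid: "\<forall>\<phi>. continuous_on UNIV \<phi> \<and> equivariant \<alpha>1 \<alpha>2 \<phi> \<longrightarrow> affine_map \<phi>"
  have "torsion_dual \<alpha>2"
  proof (rule ccontr)
    assume "\<not> torsion_dual \<alpha>2"
    then obtain \<phi> where "continuous_on UNIV \<phi>" "equivariant \<alpha>1 \<alpha>2 \<phi>" "\<not> affine_map \<phi>"
      by (rule free_element_imp_nonaffine[OF assms(1-3,5,8) nontrivial])
    with rigid show False by blast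
  qed
  then show "topological_entropy \<alpha>2 < \<infinity>"
    by (rule torsion_dual_imp_finite_entropy[OF assms(2,8)])
next
  assume "topological_entropy \<alpha>2 < \<infinity>"
  then have "torsion_dual \<alpha>2" by (rule finite_entropy_imp_torsion_dual[OF assms(2)])
  then show "\<forall>\<phi>. continuous_on UNIV \<phi> \<and> equivariant \<alpha>1 \<alpha>2 \<phi> \<longrightarrow> affine_map \<phi>"
    using torsion_dual_imp_affine[OF assms(1-3,5)] by blast
qed

end
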